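(* In the $\beta$-model, let $r$ be a fixed positive integer and assume $b_n^3/c_n=o\big(n^{1/6}/\log n\big)$. (a) Under the specified null $H_0:\beta_i=\beta_i^0$, $i=1,\dots,r$ (true $\boldsymbol\beta$ satisfying it), with $\hat{\boldsymbol\beta}^0$ the maximizer of $\ell$ over $\{\boldsymbol\gamma\in\mathbb R^n:\gamma_i=\beta_i^0,\ i=1,\dots,r\}$, the statistic $2\{\ell(\hat{\boldsymbol\beta})-\ell(\hat{\boldsymbol\beta}^0)\}$ converges in distribution to $\chi^2_r$ as $n\to\infty$. (b) If $r\ge2$, under the homogeneous null $H_0:\beta_1=\cdots=\beta_r$ (true $\boldsymbol\beta$ satisfying it), with $\hat{\boldsymbol\beta}^0$ the maximizer of $\ell$ over $\{\boldsymbol\gamma\in\mathbb R^n:\gamma_1=\cdots=\gamma_r\}$, $2\{\ell(\hat{\boldsymbol\beta})-\ell(\hat{\boldsymbol\beta}^0)\}$ converges in distribution to $\chi^2_{r-1}$ as $n\to\infty$. (In both cases the MLEs exist with probability tending to one.)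
   Context: All quantities may depend on $n$; asymptotics are as $n\to\infty$. $\beta$-model: for $\boldsymbol\beta=(\beta_1,\dots,\beta_n)^\top\in\mathbb R^n$, the symmetric adjacency matrix $A=(a_{ij})$ of an undirected graph on nodes $\{1,\dots,n\}$ has $a_{ii}=0$, $a_{ji}=a_{ij}$, and $a_{ij}$ ($1\le i<j\le n$) mutually independent Bernoulli with $P(a_{ij}=1)=\mu(\beta_i+\beta_j)$, where $\mu(x)=e^x/(1+e^x)$. Degrees: $d_i=\sum_{j\ne i}a_{ij}$. Log-likelihood: $\ell(\boldsymbol\gamma)=\sum_{i=1}^n\gamma_id_i-\sum_{1\le i<j\le n}\log(1+e^{\gamma_i+\gamma_j})$; $\hat{\boldsymbol\beta}$ is its maximizer over $\mathbb R^n$. $b_n=\max_{i\ne j}(1+e^{\beta_i+\beta_j})^2/e^{\beta_i+\beta_j}$, $c_n=\min_{i\ne j}(1+e^{\beta_i+\beta_j})^2/e^{\beta_i+\beta_j}$ at the true $\boldsymbol\beta$. $\chi^2_k$ denotes the chi-square distribution with $k$ degrees of freedom. *)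

theory Defs
  imports "HOL-Probability.Probability" "HOL-Library.Landau_Symbols"
begin

definition mu :: "real \<Rightarrow> real" where
  "mu x = exp x / (1 + exp x)"

definition pairs :: "nat \<Rightarrow> (nat \<times> nat) set" where
  "pairs n = {(i, j). 1 \<le> i \<and> i < j \<and> j \<le> n}"

(* law of the upper triangle (a_ij)_{i<j} of the adjacency matrix in the beta-model *)
definition beta_graph :: "nat \<Rightarrow> (nat \<Rightarrow> real) \<Rightarrow> (nat \<times> nat \<Rightarrow> bool) pmf" where
  "beta_graph n \<beta> = Pi_pmf (pairs n) False (\<lambda>(i, j). bernoulli_pmf (mu (\<beta> i + \<beta> j)))"

definition adj :: "(nat \<times> nat \<Rightarrow> bool) \<Rightarrow> nat \<Rightarrow> nat \<Rightarrow> real" where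
  "adj A i j = (if i < j then of_bool (A (i, j)) else if j < i then of_bool (A (j, i)) else 0)"

definition deg :: "nat \<Rightarrow> (nat \<times> nat \<Rightarrow> bool) \<Rightarrow> nat \<Rightarrow> real" where
  "deg n A i = (\<Sum>j\<in>{1..n} - {i}. adj A i j)"

definition loglik :: "nat \<Rightarrow> (nat \<times> nat \<Rightarrow> bool) \<Rightarrow> (nat \<Rightarrow> real) \<Rightarrow> real" where
  "loglik n A \<gamma> = (\<Sum>i=1..n. \<gamma> i * deg n A i)
      - (\<Sum>(i, j)\<in>pairs n. ln (1 + exp (\<gamma> i + \<gamma> j)))"

definition bn :: "nat \<Rightarrow> (nat \<Rightarrow> real) \<Rightarrow> real" where
  "bn n \<beta> = Max {(1 + exp (\<beta> i + \<beta> j))\<^sup>2 / exp (\<beta> i + \<beta> j) | i j.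
                  i \<in> {1..n} \<and> j \<in> {1..n} \<and> i \<noteq> j}"

definition cn :: "nat \<Rightarrow> (nat \<Rightarrow> real) \<Rightarrow> real" where
  "cn n \<beta> = Min {(1 + exp (\<beta> i + \<beta> j))\<^sup>2 / exp (\<beta> i + \<beta> j) | i j.
                  i \<in> {1..n} \<and> j \<in> {1..n} \<and> i \<noteq> j}"

definition has_max :: "('a \<Rightarrow> real) \<Rightarrow> 'a set \<Rightarrow> bool" where
  "has_max f S \<longleftrightarrow> (\<exists>x\<in>S. \<forall>y\<in>S. f y \<le> f x)"

(* likelihood-ratio statistic 2{ l(hat beta) - l(hat beta^0) }, with the maxima written as suprema
   (they coincide with the maxima whenever the MLEs exist) *)
definition LRT :: "nat \<Rightarrow> (nat \<times> nat \<Rightarrow> bool) \<Rightarrow> (nat \<Rightarrow> real) set \<Rightarrow> real" where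
  "LRT n A S = 2 * (Sup (loglik n A ` UNIV) - Sup (loglik n A ` S))"

definition fixed_null_set :: "nat \<Rightarrow> (nat \<Rightarrow> real) \<Rightarrow> (nat \<Rightarrow> real) set" where
  "fixed_null_set r \<beta>0 = {\<gamma>. \<forall>i\<in>{1..r}. \<gamma> i = \<beta>0 i}"

definition homog_null_set :: "nat \<Rightarrow> (nat \<Rightarrow> real) set" where
  "homog_null_set r = {\<gamma>. \<forall>i\<in>{1..r}. \<gamma> i = \<gamma> 1}"

definition chi_sq_density :: "nat \<Rightarrow> real \<Rightarrow> real" where
  "chi_sq_density k x = (if x > 0 then x powr (real k / 2 - 1) * exp (- x / 2)
       / (2 powr (real k / 2) * Gamma (real k / 2)) else 0)"

definition chi_sq :: "nat \<Rightarrow> real measure" where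
  "chi_sq k = density lborel (\<lambda>x. ennreal (chi_sq_density k x))"

definition LRT_law :: "nat \<Rightarrow> (nat \<Rightarrow> real) \<Rightarrow> (nat \<Rightarrow> real) set \<Rightarrow> real measure" where
  "LRT_law n \<beta> S = distr (measure_pmf (beta_graph n \<beta>)) borel (\<lambda>A. LRT n A S)"

definition prob_mle_exist :: "nat \<Rightarrow> (nat \<Rightarrow> real) \<Rightarrow> (nat \<Rightarrow> real) set \<Rightarrow> real" where
  "prob_mle_exist n \<beta> S = measure_pmf.prob (beta_graph n \<beta>)
      {A. has_max (loglik n A) UNIV \<and> has_max (loglik n A) S}"

end

theory Submission
  imports Defs
begin

text \<open>
  Let \<open>V\<close> be the Fisher information, with entries \<open>v\<^sub>j\<^sub>k = \<mu>'(\<beta>\<^sub>j + \<beta>\<^sub>k)\<close> off the diagonal and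
  \<open>v\<^sub>j\<^sub>j = \<Sum>k\<noteq>j. v\<^sub>j\<^sub>k\<close>, and let \<open>g\<^sub>j\<close> be the score at the true parameter. Maximising the concave
  likelihood over a small box around \<open>\<beta>\<close> and excluding active constraints shows that with high
  probability the full and the restricted maximum likelihood estimates exist within
  \<open>O(b sqrt (ln n / n))\<close> of \<open>\<beta>\<close>. The difference \<open>h\<close> of the two estimates satisfies
  \<open>2 (\<ell>(full) - \<ell>(restricted)) = (1 + o(1)) \<Sum>i\<le>r. h\<^sub>i s\<^sub>i\<close>, where \<open>s\<close> is the score at the restricted
  estimate. For \<open>i \<le> r\<close> every such estimate \<open>\<beta> + d\<close> satisfies \<open>s\<^sub>i = g\<^sub>i - v\<^sub>i\<^sub>i d\<^sub>i + O(b\<^sup>3 ln n)\<close>: the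
  nuisance term \<open>\<Sum>k. v\<^sub>i\<^sub>k d\<^sub>k\<close> is evaluated by pairing the score equations with the solution \<open>w\<close> of
  \<open>V w = (v\<^sub>i\<^sub>k)\<close>, \<open>k \<noteq> i\<close>, whose entries are \<open>O(b / n)\<close>, so only the weighted noise \<open>\<Sum>k. w\<^sub>k g\<^sub>k\<close> and quadratic
  remainders are left. Hence the statistic is \<open>\<Sum>i\<le>r. g\<^sub>i\<^sup>2 / v\<^sub>i\<^sub>i\<close>, respectively its centred version,
  up to \<open>O(b\<^sup>4 (ln n)\<^sup>2 / sqrt n)\<close>. Dropping the edges among the first \<open>r\<close> nodes makes the \<open>g\<^sub>i\<close> independent,
  and each is asymptotically normal.
\<close>

section \<open>Weak convergence\<close>

lemma abs_exp_minus_linear_le: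
  fixes x :: real
  assumes "0 \<le> x"
  shows "\<bar>exp (- x) - (1 - x)\<bar> \<le> x\<^sup>2 / 2"
proof -
  have "1 \<le> (1 - x + x\<^sup>2 / 2) * (1 + x + x\<^sup>2 / 2)"
  proof -
    have "(1 - x + x\<^sup>2 / 2) * (1 + x + x\<^sup>2 / 2) = 1 + (x\<^sup>2)\<^sup>2 / 4"
      by (simp add: power2_eq_square field_simps)
    thus ?thesis by simp
  qed
  also have "\<dots> \<le> (1 - x + x\<^sup>2 / 2) * exp x"
  proof (rule mult_left_mono[OF exp_lower_Taylor_quadratic[OF assms]])
    have "0 \<le> (1 - x)\<^sup>2 + 1" by simp
    thus "0 \<le> 1 - x + x\<^sup>2 / 2" by (simp add: power2_eq_square algebra_simps)
  qed
  finally have "exp (- x) \<le> 1 - x + x\<^sup>2 / 2" by (simp add: exp_minus field_simps)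
  thus ?thesis using exp_ge_add_one_self[of "- x"] by simp
qed

context prob_space
begin

lemma char_bounded_second_order:
  assumes X [measurable]: "random_variable borel X" and bound: "\<And>\<omega>. \<bar>X \<omega>\<bar> \<le> c" and mean: "expectation X = 0"
  shows "cmod (char (distr M borel X) t - (1 - t\<^sup>2 * expectation (\<lambda>\<omega>. (X \<omega>)\<^sup>2) / 2))
    \<le> \<bar>t\<bar> ^ 3 * c * expectation (\<lambda>\<omega>. (X \<omega>)\<^sup>2)"
proof -
  have c: "0 \<le> c" using bound[of undefined] by linarith
  have sq: "(X \<omega>)\<^sup>2 \<le> c\<^sup>2" for \<omega> using power_mono[OF bound[of \<omega>], of 2] by simp
  have int: "integrable M X" "integrable M (\<lambda>\<omega>. (X \<omega>)\<^sup>2)"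
    using bound sq integrable_const_bound[of X c] integrable_const_bound[of "\<lambda>\<omega>. (X \<omega>)\<^sup>2" "c\<^sup>2"] by auto
  have "cmod (char (distr M borel X) t - (1 - t\<^sup>2 * expectation (\<lambda>\<omega>. (X \<omega>)\<^sup>2) / 2))
    \<le> (t\<^sup>2 / 6) * expectation (\<lambda>\<omega>. min (6 * (X \<omega>)\<^sup>2) (\<bar>t\<bar> * \<bar>X \<omega>\<bar> ^ 3))"
    by (rule char_approx3'[OF X int mean _ refl]) (simp add: mean)
  also have "\<dots> \<le> (t\<^sup>2 / 6) * expectation (\<lambda>\<omega>. \<bar>t\<bar> * c * (X \<omega>)\<^sup>2)"
  proof (intro mult_left_mono integral_mono)
    show "integrable M (\<lambda>\<omega>. min (6 * (X \<omega>)\<^sup>2) (\<bar>t\<bar> * \<bar>X \<omega>\<bar> ^ 3))"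
      using sq by (intro integrable_const_bound[of _ "6 * c\<^sup>2"] AE_I2) (auto simp: min_le_iff_disj)
    show "min (6 * (X \<omega>)\<^sup>2) (\<bar>t\<bar> * \<bar>X \<omega>\<bar> ^ 3) \<le> \<bar>t\<bar> * c * (X \<omega>)\<^sup>2" for \<omega>
    proof -
      have "\<bar>t\<bar> * \<bar>X \<omega>\<bar> ^ 3 = \<bar>t\<bar> * \<bar>X \<omega>\<bar> * (X \<omega>)\<^sup>2" by (simp add: power3_eq_cube power2_eq_square)
      also have "\<dots> \<le> \<bar>t\<bar> * c * (X \<omega>)\<^sup>2"
        by (intro mult_right_mono mult_left_mono bound) auto
      finally show ?thesis by simp
    qed
  qed (use int in auto)
  also have "\<dots> = (\<bar>t\<bar> ^ 3 * c * expectation (\<lambda>\<omega>. (X \<omega>)\<^sup>2)) / 6"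
    by (simp add: power3_eq_cube power2_eq_square)
  also have "\<dots> \<le> \<bar>t\<bar> ^ 3 * c * expectation (\<lambda>\<omega>. (X \<omega>)\<^sup>2)" using c by simp
  finally show ?thesis .
qed

lemma char_bounded_gaussian_approx:
  assumes X [measurable]: "random_variable borel X" and bound: "\<And>\<omega>. \<bar>X \<omega>\<bar> \<le> c" and mean: "expectation X = 0"
  shows "cmod (char (distr M borel X) t - exp (- (t\<^sup>2 * expectation (\<lambda>\<omega>. (X \<omega>)\<^sup>2) / 2)))
    \<le> (\<bar>t\<bar> ^ 3 * c + t ^ 4 * c\<^sup>2) * expectation (\<lambda>\<omega>. (X \<omega>)\<^sup>2)"
proof -
  define s where "s = expectation (\<lambda>\<omega>. (X \<omega>)\<^sup>2)"
  define x where "x = t\<^sup>2 * s / 2"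
  have sq: "(X \<omega>)\<^sup>2 \<le> c\<^sup>2" for \<omega> using power_mono[OF bound[of \<omega>], of 2] by simp
  have s: "0 \<le> s" by (simp add: s_def)
  have "s \<le> expectation (\<lambda>_. c\<^sup>2)"
    unfolding s_def using sq by (intro integral_mono integrable_const_bound[of _ "c\<^sup>2"]) auto
  hence s_le: "s \<le> c\<^sup>2" by (simp add: prob_space)
  have "cmod (complex_of_real (1 - x) - complex_of_real (exp (- x))) = \<bar>exp (- x) - (1 - x)\<bar>"
    unfolding of_real_diff[symmetric] norm_of_real by (rule abs_minus_commute)
  also have "\<dots> \<le> x\<^sup>2 / 2" using s by (intro abs_exp_minus_linear_le) (simp add: x_def)
  also have "\<dots> = t ^ 4 * (s * s) / 8" by (simp add: x_def power2_eq_square power4_eq_xxxx)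
  also have "\<dots> \<le> t ^ 4 * (c\<^sup>2 * s) / 8"
    using s s_le by (intro divide_right_mono mult_left_mono mult_right_mono) auto
  also have "\<dots> \<le> t ^ 4 * c\<^sup>2 * s" using s by simp
  finally have "cmod (complex_of_real (1 - x) - complex_of_real (exp (- x))) \<le> t ^ 4 * c\<^sup>2 * s" .
  moreover have "cmod (char (distr M borel X) t - complex_of_real (1 - x)) \<le> \<bar>t\<bar> ^ 3 * c * s"
    using char_bounded_second_order[OF X bound mean] by (simp add: x_def s_def)
  ultimately have "cmod (char (distr M borel X) t - complex_of_real (exp (- x))) \<le>
      \<bar>t\<bar> ^ 3 * c * s + t ^ 4 * c\<^sup>2 * s"
    using norm_triangle_ineq[of "char (distr M borel X) t - complex_of_real (1 - x)"
        "complex_of_real (1 - x) - complex_of_real (exp (- x))"] by simp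
  thus ?thesis by (simp add: x_def s_def distrib_right)
qed

lemma char_indep_sum_gaussian_approx:
  assumes indep: "indep_vars (\<lambda>_. borel) X K" and K: "finite K"
    and bound: "\<And>k \<omega>. k \<in> K \<Longrightarrow> \<bar>X k \<omega>\<bar> \<le> c" and mean: "\<And>k. k \<in> K \<Longrightarrow> expectation (X k) = 0"
    and var: "(\<Sum>k\<in>K. expectation (\<lambda>\<omega>. (X k \<omega>)\<^sup>2)) = 1"
  shows "cmod (char (distr M borel (\<lambda>\<omega>. \<Sum>k\<in>K. X k \<omega>)) t - exp (- (t\<^sup>2 / 2))) \<le> \<bar>t\<bar> ^ 3 * c + t ^ 4 * c\<^sup>2"
proof -
  let ?s = "\<lambda>k. expectation (\<lambda>\<omega>. (X k \<omega>)\<^sup>2)"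
  let ?\<phi> = "\<lambda>k. char (distr M borel (X k)) t" and ?\<psi> = "\<lambda>k. complex_of_real (exp (- (t\<^sup>2 * ?s k / 2)))"
  have X: "random_variable borel (X k)" if "k \<in> K" for k
    using indep that by (simp add: indep_vars_def)
  have "(\<Sum>k\<in>K. - (t\<^sup>2 * ?s k / 2)) = - (t\<^sup>2 / 2)"
    unfolding sum_negf sum_divide_distrib[symmetric] sum_distrib_left[symmetric] var by simp
  hence "complex_of_real (exp (- (t\<^sup>2 / 2))) = (\<Prod>k\<in>K. ?\<psi> k)"
    using exp_sum[OF K, of "\<lambda>k. - (t\<^sup>2 * ?s k / 2)"] by (simp only: of_real_prod)
  moreover have "char (distr M borel (\<lambda>\<omega>. \<Sum>k\<in>K. X k \<omega>)) t = (\<Prod>k\<in>K. ?\<phi> k)"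
    by (rule char_distr_sum[OF indep])
  ultimately have "cmod (char (distr M borel (\<lambda>\<omega>. \<Sum>k\<in>K. X k \<omega>)) t - exp (- (t\<^sup>2 / 2))) \<le>
      (\<Sum>k\<in>K. cmod (?\<phi> k - ?\<psi> k))"
  proof (simp only:, intro norm_prod_diff)
    fix k assume "k \<in> K"
    thus "cmod (?\<phi> k) \<le> 1" by (intro real_distribution.cmod_char_le_1 real_distribution_distr X)
    show "cmod (?\<psi> k) \<le> 1" by simp
  qed
  also have "\<dots> \<le> (\<Sum>k\<in>K. (\<bar>t\<bar> ^ 3 * c + t ^ 4 * c\<^sup>2) * ?s k)"
    using X bound mean by (intro sum_mono char_bounded_gaussian_approx) auto
  also have "\<dots> = \<bar>t\<bar> ^ 3 * c + t ^ 4 * c\<^sup>2" by (simp add: var flip: sum_distrib_left)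
  finally show ?thesis .
qed

lemma char_diff_le:
  assumes [measurable]: "random_variable borel X" "random_variable borel Y" "S \<in> events"
    and close: "\<And>\<omega>. \<omega> \<in> S \<Longrightarrow> \<bar>X \<omega> - Y \<omega>\<bar> \<le> e" and e: "0 \<le> e"
  shows "cmod (char (distr M borel X) t - char (distr M borel Y) t) \<le> \<bar>t\<bar> * e + 2 * (1 - prob S)"
proof -
  have int: "integrable M (\<lambda>\<omega>. iexp (t * Z \<omega>))" if [measurable]: "random_variable borel Z" for Z
    by (intro integrable_const_bound[of _ 1]) (auto simp del: of_real_mult)
  have pointwise: "cmod (iexp (t * X \<omega>) - iexp (t * Y \<omega>)) \<le> \<bar>t\<bar> * e + 2 * indicator (space M - S) \<omega>"
    if "\<omega> \<in> space M" for \<omega>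
  proof (cases "\<omega> \<in> S")
    case True
    have "iexp (t * X \<omega>) - iexp (t * Y \<omega>) = iexp (t * Y \<omega>) * (iexp (t * X \<omega> - t * Y \<omega>) - 1)"
      by (simp add: right_diff_distrib flip: exp_add)
    hence "cmod (iexp (t * X \<omega>) - iexp (t * Y \<omega>)) = cmod (iexp (t * X \<omega> - t * Y \<omega>) - 1)"
      by (simp only: norm_mult norm_exp_i_times mult_1_left)
    also have "\<dots> \<le> \<bar>t * X \<omega> - t * Y \<omega>\<bar>"
      using iexp_approx1[of "t * X \<omega> - t * Y \<omega>" 0] by simp
    also have "\<dots> = \<bar>t\<bar> * \<bar>X \<omega> - Y \<omega>\<bar>" by (simp add: abs_mult flip: right_diff_distrib)
    also have "\<dots> \<le> \<bar>t\<bar> * e" using close[OF True] by (intro mult_left_mono) auto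
    finally show ?thesis using True by simp
  next
    case False
    have "cmod (iexp (t * X \<omega>) - iexp (t * Y \<omega>)) \<le> cmod (iexp (t * X \<omega>)) + cmod (iexp (t * Y \<omega>))"
      by (rule norm_triangle_ineq4)
    also have "\<dots> = 2" by (simp only: norm_exp_i_times)
    also have "\<dots> \<le> \<bar>t\<bar> * e + 2" using e by simp
    finally show ?thesis using False that by simp
  qed
  have "char (distr M borel X) t - char (distr M borel Y) t = (CLINT \<omega>|M. iexp (t * X \<omega>) - iexp (t * Y \<omega>))"
    unfolding char_def by (simp add: integral_distr Bochner_Integration.integral_diff int del: of_real_mult)
  also have "cmod \<dots> \<le> (LINT \<omega>|M. cmod (iexp (t * X \<omega>) - iexp (t * Y \<omega>)))"
    by (rule integral_norm_bound)
  also have "\<dots> \<le> (LINT \<omega>|M. \<bar>t\<bar> * e + 2 * indicator (space M - S) \<omega>)"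
    by (intro integral_mono pointwise integrable_norm Bochner_Integration.integrable_diff int)
       (auto intro!: Bochner_Integration.integrable_add integrable_real_indicator simp: less_top[symmetric])
  also have "\<dots> = \<bar>t\<bar> * e + 2 * prob (space M - S)"
    by (subst Bochner_Integration.integral_add) (auto simp: less_top[symmetric] prob_space)
  also have "prob (space M - S) = 1 - prob S" by (rule prob_compl) simp
  finally show ?thesis .
qed

end

theorem weak_conv_bounded_triangular_array:
  fixes X :: "nat \<Rightarrow> 'k \<Rightarrow> 'a \<Rightarrow> real"
  assumes M: "\<And>n. prob_space (M n)" and indep: "\<And>n. prob_space.indep_vars (M n) (\<lambda>_. borel) (X n) (K n)"
    and K: "\<And>n. finite (K n)" and bound: "\<And>n k \<omega>. k \<in> K n \<Longrightarrow> \<bar>X n k \<omega>\<bar> \<le> c n" and c: "c \<longlonglongrightarrow> 0"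
    and mean: "\<And>n k. k \<in> K n \<Longrightarrow> (LINT \<omega>|M n. X n k \<omega>) = 0"
    and var: "\<forall>\<^sub>F n in sequentially. (\<Sum>k\<in>K n. LINT \<omega>|M n. (X n k \<omega>)\<^sup>2) = 1"
  shows "weak_conv_m (\<lambda>n. distr (M n) borel (\<lambda>\<omega>. \<Sum>k\<in>K n. X n k \<omega>)) std_normal_distribution"
proof (rule levy_continuity[OF _ real_dist_normal_dist])
  have "X n k \<in> borel_measurable (M n)" if "k \<in> K n" for n k
    using indep[of n] that by (simp add: prob_space.indep_vars_def[OF M])
  thus "real_distribution (distr (M n) borel (\<lambda>\<omega>. \<Sum>k\<in>K n. X n k \<omega>))" for n
    by (intro prob_space.real_distribution_distr[OF M] borel_measurable_sum)
  fix t
  let ?\<phi> = "\<lambda>n. char (distr (M n) borel (\<lambda>\<omega>. \<Sum>k\<in>K n. X n k \<omega>)) t"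
  have "(\<lambda>n. \<bar>t\<bar> ^ 3 * c n + t ^ 4 * (c n)\<^sup>2) \<longlonglongrightarrow> \<bar>t\<bar> ^ 3 * 0 + t ^ 4 * 0\<^sup>2"
    by (intro tendsto_intros c)
  moreover have "\<forall>\<^sub>F n in sequentially. cmod (?\<phi> n - exp (- (t\<^sup>2 / 2))) \<le> \<bar>t\<bar> ^ 3 * c n + t ^ 4 * (c n)\<^sup>2"
    using var by eventually_elim
      (intro prob_space.char_indep_sum_gaussian_approx[OF M indep K] bound mean; assumption)
  ultimately have "(\<lambda>n. ?\<phi> n - exp (- (t\<^sup>2 / 2))) \<longlonglongrightarrow> 0"
    by (intro Lim_null_comparison[of "\<lambda>n. ?\<phi> n - exp (- (t\<^sup>2 / 2))"]) auto
  thus "?\<phi> \<longlonglongrightarrow> char std_normal_distribution t"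
    unfolding char_std_normal_distribution by (simp add: LIM_zero_cancel)
qed

theorem weak_conv_slutsky:
  fixes X Y :: "nat \<Rightarrow> 'a \<Rightarrow> real"
  assumes M: "\<And>n. prob_space (M n)" and L: "real_distribution L"
    and X: "\<And>n. X n \<in> borel_measurable (M n)" and Y: "\<And>n. Y n \<in> borel_measurable (M n)"
    and S: "\<And>n. S n \<in> sets (M n)" "(\<lambda>n. measure (M n) (S n)) \<longlonglongrightarrow> 1"
    and close: "\<forall>\<^sub>F n in sequentially. \<forall>\<omega>\<in>S n. \<bar>Y n \<omega> - X n \<omega>\<bar> \<le> e n" and e: "e \<longlonglongrightarrow> 0"
    and conv: "weak_conv_m (\<lambda>n. distr (M n) borel (X n)) L"
  shows "weak_conv_m (\<lambda>n. distr (M n) borel (Y n)) L"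
proof (rule levy_continuity[OF _ L])
  have distribution: "real_distribution (distr (M n) borel (Z n))" if "Z n \<in> borel_measurable (M n)" for Z n
    by (rule prob_space.real_distribution_distr[OF M that])
  show "real_distribution (distr (M n) borel (Y n))" for n by (rule distribution[OF Y])
  fix t
  let ?d = "\<lambda>n. char (distr (M n) borel (Y n)) t - char (distr (M n) borel (X n)) t"
  have "(\<lambda>n. \<bar>t\<bar> * \<bar>e n\<bar> + 2 * (1 - measure (M n) (S n))) \<longlonglongrightarrow> \<bar>t\<bar> * \<bar>0\<bar> + 2 * (1 - 1)"
    by (intro tendsto_intros e S)
  moreover have "\<forall>\<^sub>F n in sequentially. cmod (?d n) \<le> \<bar>t\<bar> * \<bar>e n\<bar> + 2 * (1 - measure (M n) (S n))"
    using close
  proof eventually_elim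
    case (elim n)
    show ?case
      by (rule prob_space.char_diff_le[OF M Y X S(1)]) (use elim in \<open>auto intro: order_trans[OF _ abs_ge_self]\<close>)
  qed
  ultimately have "?d \<longlonglongrightarrow> 0" by (intro Lim_null_comparison[of ?d]) auto
  moreover have "(\<lambda>n. char (distr (M n) borel (X n)) t) \<longlonglongrightarrow> char L t"
    by (rule levy_continuity1[OF _ L conv]) (rule distribution[OF X])
  ultimately show "(\<lambda>n. char (distr (M n) borel (Y n)) t) \<longlonglongrightarrow> char L t"
    using tendsto_add[of ?d 0 sequentially "\<lambda>n. char (distr (M n) borel (X n)) t" "char L t"] by simp
qed

lemma PiM_distr:
  fixes M :: "'i \<Rightarrow> 'a measure" and M' :: "'i \<Rightarrow> 'b measure" and f :: "'i \<Rightarrow> 'a \<Rightarrow> 'b"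
  assumes fin: "finite I" and M: "\<And>i. prob_space (M i)" and f: "\<And>i. f i \<in> measurable (M i) (M' i)"
  shows "PiM I (\<lambda>i. distr (M i) (M' i) (f i)) = distr (PiM I M) (PiM I M') (\<lambda>x. \<lambda>i\<in>I. f i (x i))"
proof -
  interpret M: prob_space "M i" for i by (rule M)
  interpret product_sigma_finite M by unfold_locales
  interpret D: product_sigma_finite "\<lambda>i. distr (M i) (M' i) (f i)"
    using M.prob_space_distr[OF f] by (simp add: product_sigma_finite_def prob_space_imp_sigma_finite)
  have meas: "(\<lambda>x. \<lambda>i\<in>I. f i (x i)) \<in> measurable (PiM I M) (PiM I M')"
    by (intro measurable_restrict measurable_PiM_component_rev f)
  show ?thesis
  proof (rule D.PiM_eqI[OF fin, symmetric])
    show "sets (distr (PiM I M) (PiM I M') (\<lambda>x. \<lambda>i\<in>I. f i (x i))) = sets (PiM I (\<lambda>i. distr (M i) (M' i) (f i)))"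
      by (simp cong: sets_PiM_cong)
    fix A assume "\<And>i. i \<in> I \<Longrightarrow> A i \<in> sets (distr (M i) (M' i) (f i))"
    hence A: "\<And>i. i \<in> I \<Longrightarrow> A i \<in> sets (M' i)" by simp
    have "(\<lambda>x. \<lambda>i\<in>I. f i (x i)) -` PiE I A \<inter> space (PiM I M) = PiE I (\<lambda>i. f i -` A i \<inter> space (M i))"
      by (auto simp: space_PiM PiE_iff)
    hence "emeasure (distr (PiM I M) (PiM I M') (\<lambda>x. \<lambda>i\<in>I. f i (x i))) (PiE I A) =
        emeasure (PiM I M) (PiE I (\<lambda>i. f i -` A i \<inter> space (M i)))"
      using A fin by (subst emeasure_distr[OF meas]) (auto intro: sets_PiM_I_finite)
    also have "\<dots> = (\<Prod>i\<in>I. emeasure (M i) (f i -` A i \<inter> space (M i)))"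
      using fin A by (intro emeasure_PiM) (auto intro: measurable_sets[OF f])
    also have "\<dots> = (\<Prod>i\<in>I. emeasure (distr (M i) (M' i) (f i)) (A i))"
      using A by (intro prod.cong refl) (simp add: emeasure_distr[OF f])
    finally show "emeasure (distr (PiM I M) (PiM I M') (\<lambda>x. \<lambda>i\<in>I. f i (x i))) (PiE I A) =
        (\<Prod>i\<in>I. emeasure (distr (M i) (M' i) (f i)) (A i))" .
  qed
qed

lemma tendsto_fun_componentwise:
  fixes z :: "'n \<Rightarrow> 'i \<Rightarrow> 'a::topological_space"
  assumes "\<And>i. ((\<lambda>n. z n i) \<longlongrightarrow> z' i) F"
  shows "(z \<longlongrightarrow> z') F"
proof -
  have "limitin (product_topology (\<lambda>_. euclidean) UNIV) z z' F"
    using assms by (simp add: limitin_componentwise)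
  thus ?thesis by (simp add: euclidean_product_topology)
qed

lemma Skorohod_independent:
  fixes \<mu> :: "'i \<Rightarrow> nat \<Rightarrow> real measure"
  assumes fin: "finite I" and \<mu>: "\<And>i n. i \<in> I \<Longrightarrow> real_distribution (\<mu> i n)"
    and M: "\<And>i. i \<in> I \<Longrightarrow> real_distribution (M i)"
    and conv: "\<And>i. i \<in> I \<Longrightarrow> weak_conv_m (\<mu> i) (M i)"
  obtains \<Omega> :: "('i \<Rightarrow> real) measure" and Z Z' where "prob_space \<Omega>"
    "\<And>n. Z n \<in> measurable \<Omega> (PiM I (\<lambda>_. borel))" "Z' \<in> measurable \<Omega> (PiM I (\<lambda>_. borel))"
    "\<And>n. distr \<Omega> (PiM I (\<lambda>_. borel)) (Z n) = PiM I (\<lambda>i. \<mu> i n)" "distr \<Omega> (PiM I (\<lambda>_. borel)) Z' = PiM I M"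
    "\<And>\<omega>. \<omega> \<in> space \<Omega> \<Longrightarrow> (\<lambda>n. Z n \<omega>) \<longlonglongrightarrow> Z' \<omega>"
proof -
  define \<nu> \<nu>' where "\<nu> i n = (if i \<in> I then \<mu> i n else std_normal_distribution)"
    and "\<nu>' i = (if i \<in> I then M i else std_normal_distribution)" for i n
  have "real_distribution (\<nu> i n)" "real_distribution (\<nu>' i)" for i n
    using \<mu> M real_dist_normal_dist by (simp_all add: \<nu>_def \<nu>'_def)
  moreover have "weak_conv_m (\<nu> i) (\<nu>' i)" for i
    using conv[of i] by (cases "i \<in> I") (auto simp: \<nu>_def[abs_def] \<nu>'_def weak_conv_m_def weak_conv_def)
  ultimately have "\<exists>\<Omega> Y Y'. prob_space (\<Omega> :: real measure) \<and> (\<forall>n. Y n \<in> measurable \<Omega> borel) \<and>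
      (\<forall>n. distr \<Omega> borel (Y n) = \<nu> i n) \<and> Y' \<in> measurable \<Omega> lborel \<and> distr \<Omega> borel Y' = \<nu>' i \<and>
      (\<forall>x\<in>space \<Omega>. (\<lambda>n. Y n x) \<longlonglongrightarrow> Y' x)" for i
    using Skorohod[of "\<nu> i" "\<nu>' i"] by blast
  then obtain \<Omega> Y Y' where \<Omega>: "\<And>i. prob_space (\<Omega> i :: real measure)"
    and Y: "\<And>i n. Y i n \<in> measurable (\<Omega> i) borel" "\<And>i n. distr (\<Omega> i) borel (Y i n) = \<nu> i n"
    and Y': "\<And>i. Y' i \<in> measurable (\<Omega> i) lborel" "\<And>i. distr (\<Omega> i) borel (Y' i) = \<nu>' i"
    and lim: "\<And>i x. x \<in> space (\<Omega> i) \<Longrightarrow> (\<lambda>n. Y i n x) \<longlonglongrightarrow> Y' i x"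
    by metis
  have Y'b: "Y' i \<in> measurable (\<Omega> i) borel" for i using Y'(1)[of i] by simp
  show thesis
  proof (rule that[of "PiM I \<Omega>" "\<lambda>n x. \<lambda>i\<in>I. Y i n (x i)" "\<lambda>x. \<lambda>i\<in>I. Y' i (x i)"])
    show "prob_space (PiM I \<Omega>)" by (rule prob_space_PiM) (rule \<Omega>)
    show "(\<lambda>x. \<lambda>i\<in>I. Y i n (x i)) \<in> measurable (PiM I \<Omega>) (PiM I (\<lambda>_. borel))" for n
      by (intro measurable_restrict measurable_PiM_component_rev Y(1))
    show "(\<lambda>x. \<lambda>i\<in>I. Y' i (x i)) \<in> measurable (PiM I \<Omega>) (PiM I (\<lambda>_. borel))"
      by (intro measurable_restrict measurable_PiM_component_rev Y'b)
    have "distr (PiM I \<Omega>) (PiM I (\<lambda>_. borel)) (\<lambda>x. \<lambda>i\<in>I. Y i n (x i)) = PiM I (\<lambda>i. \<nu> i n)" for n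
      using PiM_distr[OF fin \<Omega> Y(1)] by (simp add: Y(2))
    thus "distr (PiM I \<Omega>) (PiM I (\<lambda>_. borel)) (\<lambda>x. \<lambda>i\<in>I. Y i n (x i)) = PiM I (\<lambda>i. \<mu> i n)" for n
      by (simp add: \<nu>_def cong: PiM_cong)
    have "distr (PiM I \<Omega>) (PiM I (\<lambda>_. borel)) (\<lambda>x. \<lambda>i\<in>I. Y' i (x i)) = PiM I \<nu>'"
      using PiM_distr[OF fin \<Omega> Y'b] by (simp add: Y'(2))
    thus "distr (PiM I \<Omega>) (PiM I (\<lambda>_. borel)) (\<lambda>x. \<lambda>i\<in>I. Y' i (x i)) = PiM I M"
      by (simp add: \<nu>'_def[abs_def] cong: PiM_cong)
    show "(\<lambda>n. \<lambda>i\<in>I. Y i n (x i)) \<longlonglongrightarrow> (\<lambda>i\<in>I. Y' i (x i))" if "x \<in> space (PiM I \<Omega>)" for x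
      using that lim by (intro tendsto_fun_componentwise) (auto simp: space_PiM restrict_def)
  qed
qed

theorem weak_conv_PiM_continuous_mapping:
  fixes \<mu> :: "'i \<Rightarrow> nat \<Rightarrow> real measure" and F :: "('i \<Rightarrow> real) \<Rightarrow> real"
  assumes fin: "finite I" and \<mu>: "\<And>i n. i \<in> I \<Longrightarrow> real_distribution (\<mu> i n)"
    and M: "\<And>i. i \<in> I \<Longrightarrow> real_distribution (M i)"
    and conv: "\<And>i. i \<in> I \<Longrightarrow> weak_conv_m (\<mu> i) (M i)"
    and F [measurable]: "F \<in> borel_measurable (PiM I (\<lambda>_. borel))" and cont: "continuous_on UNIV F"
  shows "weak_conv_m (\<lambda>n. distr (PiM I (\<lambda>i. \<mu> i n)) borel F) (distr (PiM I M) borel F)"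
proof -
  obtain \<Omega> :: "('i \<Rightarrow> real) measure" and Z Z' where \<Omega>: "prob_space \<Omega>"
    and Z [measurable]: "\<And>n. Z n \<in> measurable \<Omega> (PiM I (\<lambda>_. borel))"
    and Z' [measurable]: "Z' \<in> measurable \<Omega> (PiM I (\<lambda>_. borel))"
    and law: "\<And>n. distr \<Omega> (PiM I (\<lambda>_. borel)) (Z n) = PiM I (\<lambda>i. \<mu> i n)"
      "distr \<Omega> (PiM I (\<lambda>_. borel)) Z' = PiM I M"
    and lim: "\<And>\<omega>. \<omega> \<in> space \<Omega> \<Longrightarrow> (\<lambda>n. Z n \<omega>) \<longlonglongrightarrow> Z' \<omega>"
    using Skorohod_independent[of I \<mu> M, OF fin \<mu> M conv] by blast
  interpret prob_space \<Omega> by (rule \<Omega>)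
  have FZ: "distr (PiM I (\<lambda>i. \<mu> i n)) borel F = distr \<Omega> borel (\<lambda>\<omega>. F (Z n \<omega>))" for n
    unfolding law(1)[symmetric] by (simp add: distr_distr comp_def)
  have FZ': "distr (PiM I M) borel F = distr \<Omega> borel (\<lambda>\<omega>. F (Z' \<omega>))"
    unfolding law(2)[symmetric] by (simp add: distr_distr comp_def)
  show ?thesis
    unfolding FZ FZ'
  proof (rule levy_continuity)
    fix t
    have "(\<lambda>n. CLINT \<omega>|\<Omega>. iexp (t * F (Z n \<omega>))) \<longlonglongrightarrow> (CLINT \<omega>|\<Omega>. iexp (t * F (Z' \<omega>)))"
    proof (rule integral_dominated_convergence[where w = "\<lambda>_. 1"])
      have "(\<lambda>n. F (Z n \<omega>)) \<longlonglongrightarrow> F (Z' \<omega>)" if "\<omega> \<in> space \<Omega>" for \<omega>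
        by (rule continuous_on_tendsto_compose[OF cont lim[OF that]]) auto
      thus "AE \<omega> in \<Omega>. (\<lambda>n. iexp (t * F (Z n \<omega>))) \<longlonglongrightarrow> iexp (t * F (Z' \<omega>))"
        by (intro AE_I2 tendsto_intros)
    qed (auto simp del: of_real_mult)
    thus "(\<lambda>n. char (distr \<Omega> borel (\<lambda>\<omega>. F (Z n \<omega>))) t) \<longlonglongrightarrow> char (distr \<Omega> borel (\<lambda>\<omega>. F (Z' \<omega>))) t"
      by (simp add: char_def integral_distr)
  qed simp_all
qed

section \<open>Chi-square laws of normal vectors\<close>

lemma chi_sq_density_nonneg: "0 \<le> chi_sq_density k x"
proof (cases "k = 0")
  case False
  hence "0 < Gamma (real k / 2)" by (intro Gamma_real_pos) auto
  thus ?thesis by (simp add: chi_sq_density_def)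
qed (auto simp: chi_sq_density_def)

lemma chi_sq_density_measurable [measurable]: "chi_sq_density k \<in> borel_measurable borel"
  unfolding chi_sq_density_def[abs_def] by measurable

lemma sets_chi_sq [simp, measurable_cong]: "sets (chi_sq k) = sets borel"
  by (simp add: chi_sq_def)

lemma prob_space_chi_sq:
  assumes "1 \<le> k" shows "prob_space (chi_sq k)"
proof
  define a where "a = real k / 2"
  have a: "0 < a" and Gamma: "0 < Gamma a" using assms by (auto simp: a_def intro!: Gamma_real_pos)
  have scaled: "chi_sq_density k (2 * u) =
      1 / (2 * Gamma a) * (indicator {0..} u * u powr (a - 1) / exp u)" for u
    using Gamma
      by (auto simp: chi_sq_density_def a_def[symmetric] powr_mult powr_diff exp_minus indicator_def field_simps)
  have "emeasure (chi_sq k) (space (chi_sq k)) = (\<integral>\<^sup>+x. chi_sq_density k x \<partial>lborel)"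
    by (simp add: chi_sq_def emeasure_density)
  also have "\<dots> = 2 * (\<integral>\<^sup>+u. chi_sq_density k (2 * u) \<partial>lborel)"
    by (subst nn_integral_real_affine[where c = 2 and t = 0]) auto
  also have "(\<integral>\<^sup>+u. chi_sq_density k (2 * u) \<partial>lborel) =
      ennreal (1 / (2 * Gamma a)) * (\<integral>\<^sup>+u. indicator {0..} u * u powr (a - 1) / exp u \<partial>lborel)"
    unfolding scaled using Gamma by (subst nn_integral_cmult[symmetric]) (auto simp flip: ennreal_mult)
  also have "(\<integral>\<^sup>+u. indicator {0..} u * u powr (a - 1) / exp u \<partial>lborel) = ennreal (Gamma a)"
    by (rule Gamma_conv_nn_integral_real[OF a, symmetric])
  also have "ennreal (1 / (2 * Gamma a)) * ennreal (Gamma a) = ennreal (1 / 2)"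
    using Gamma by (simp flip: ennreal_mult)
  also have "2 * ennreal (1 / 2) = 1"
    using ennreal_mult[of 2 "1 / 2"] by simp
  finally show "emeasure (chi_sq k) (space (chi_sq k)) = 1" .
qed

lemma prob_space_std_normal: "prob_space std_normal_distribution"
  by (rule prob_space_normal_density) simp

lemma nn_integral_even:
  fixes f :: "real \<Rightarrow> ennreal"
  assumes [measurable]: "f \<in> borel_measurable borel" and even: "\<And>x. f (- x) = f x"
  shows "(\<integral>\<^sup>+x. f x \<partial>lborel) = 2 * (\<integral>\<^sup>+x. f x * indicator {0<..} x \<partial>lborel)"
proof -
  have "(\<integral>\<^sup>+x. f x \<partial>lborel) = (\<integral>\<^sup>+x. f x * indicator {0<..} x + f x * indicator {..<0} x \<partial>lborel)"
    by (intro nn_integral_cong_AE AE_I[of _ _ "{0}"]) (auto simp: indicator_def)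
  also have "\<dots> = (\<integral>\<^sup>+x. f x * indicator {0<..} x \<partial>lborel) + (\<integral>\<^sup>+x. f x * indicator {..<0} x \<partial>lborel)"
    by (rule nn_integral_add) auto
  also have "(\<integral>\<^sup>+x. f x * indicator {..<0} x \<partial>lborel) = (\<integral>\<^sup>+x. f x * indicator {0<..} x \<partial>lborel)"
    by (subst nn_integral_real_affine[of _ "-1" 0]) (auto simp: even indicator_def intro!: nn_integral_cong)
  finally show ?thesis by (simp add: mult_2)
qed

lemma chi_sq_density_square:
  assumes "0 < x"
  shows "chi_sq_density 1 (x\<^sup>2) * (2 * x) = 2 * std_normal_density x"
proof -
  have "(x\<^sup>2) powr (- (1 / 2)) = 1 / x" using assms
    by (simp add: powr_minus powr_half_sqrt divide_simps)
  thus ?thesis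
    using assms Gamma_one_half_real
    by (simp add: chi_sq_density_def std_normal_density_def powr_half_sqrt real_sqrt_mult)
qed

lemma emeasure_chi_sq_1_atMost:
  assumes "0 \<le> s"
  shows "emeasure (chi_sq 1) {..s\<^sup>2} = emeasure std_normal_distribution {- s..s}"
proof -
  have "emeasure (chi_sq 1) {..s\<^sup>2} = (\<integral>\<^sup>+x. chi_sq_density 1 x * indicator {0\<^sup>2..s\<^sup>2} x \<partial>lborel)"
    unfolding chi_sq_def
    by (subst emeasure_density) (auto intro!: nn_integral_cong simp: indicator_def chi_sq_density_def)
  also have "\<dots> = (\<integral>\<^sup>+x. chi_sq_density 1 (x\<^sup>2) * (2 * x) * indicator {0..s} x \<partial>lborel)"
    using assms by (intro nn_integral_substitution)
      (auto intro!: derivative_eq_intros continuous_intros simp: set_borel_measurable_def)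
  also have "\<dots> = (\<integral>\<^sup>+x. 2 *
      (ennreal (std_normal_density x * indicator {- s..s} x) * indicator {0<..} x) \<partial>lborel)"
  proof (intro nn_integral_cong_AE, use AE_lborel_singleton[of 0] in eventually_elim)
    fix x :: real assume "x \<noteq> 0"
    show "ennreal (chi_sq_density 1 (x\<^sup>2) * (2 * x) * indicator {0..s} x) =
        2 * (ennreal (std_normal_density x * indicator {- s..s} x) * indicator {0<..} x)"
    proof (cases "0 < x \<and> x \<le> s")
      case True
      hence "chi_sq_density 1 (x\<^sup>2) * (2 * x) * indicator {0..s} x = 2 * std_normal_density x"
        using chi_sq_density_square[of x] by simp
      hence "ennreal (chi_sq_density 1 (x\<^sup>2) * (2 * x) * indicator {0..s} x) =
          ennreal (2 * std_normal_density x)"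
        by (rule arg_cong)
      also have "\<dots> = 2 * ennreal (std_normal_density x)"
        by (simp only: ennreal_mult' ennreal_numeral zero_le_numeral)
      finally show ?thesis using True by simp
    qed (use \<open>x \<noteq> 0\<close> in \<open>auto simp: indicator_def\<close>)
  qed
  also have "\<dots> = 2 * (\<integral>\<^sup>+x. ennreal (std_normal_density x * indicator {- s..s} x) * indicator {0<..} x \<partial>lborel)"
    by (rule nn_integral_cmult) simp
  also have "\<dots> = (\<integral>\<^sup>+x. std_normal_density x * indicator {- s..s} x \<partial>lborel)"
    by (rule nn_integral_even[symmetric]) (auto simp: indicator_def normal_density_def)
  also have "\<dots> = emeasure std_normal_distribution {- s..s}"
    by (subst emeasure_density) (auto intro!: nn_integral_cong simp: indicator_def)
  finally show ?thesis .
qed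

lemma distr_std_normal_square: "distr std_normal_distribution borel (\<lambda>x. x\<^sup>2) = chi_sq 1"
proof (rule cdf_unique)
  interpret N: prob_space std_normal_distribution by (rule prob_space_std_normal)
  show "real_distribution (distr std_normal_distribution borel (\<lambda>x. x\<^sup>2))" by simp
  show "real_distribution (chi_sq 1)"
    using prob_space_chi_sq[of 1] by (simp add: real_distribution_def real_distribution_axioms_def)
  show "cdf (distr std_normal_distribution borel (\<lambda>x. x\<^sup>2)) = cdf (chi_sq 1)"
  proof
    fix x :: real
    have "emeasure std_normal_distribution {v. v\<^sup>2 \<le> x} = emeasure (chi_sq 1) {..x}"
    proof (cases "0 \<le> x")
      case True
      have "v\<^sup>2 \<le> x \<longleftrightarrow> v \<in> {- sqrt x..sqrt x}" for v
        using abs_le_square_iff[of v "sqrt x"] True by auto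
      hence "{v. v\<^sup>2 \<le> x} = {- sqrt x..sqrt x}" by blast
      thus ?thesis using emeasure_chi_sq_1_atMost[of "sqrt x"] True by simp
    next
      case False
      hence "{v. v\<^sup>2 \<le> x} = {}" by (auto simp: not_le intro: less_le_trans)
      moreover have "emeasure (chi_sq 1) {..x} =
          (\<integral>\<^sup>+y. ennreal (chi_sq_density 1 y) * indicator {..x} y \<partial>lborel)"
        unfolding chi_sq_def by (rule emeasure_density) auto
      hence "emeasure (chi_sq 1) {..x} = (\<integral>\<^sup>+(y::real). 0 \<partial>lborel)"
        using False by (simp only:) (intro nn_integral_cong, auto simp: indicator_def chi_sq_density_def)
      ultimately show ?thesis by simp
    qed
    thus "cdf (distr std_normal_distribution borel (\<lambda>x. x\<^sup>2)) x = cdf (chi_sq 1) x"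
      by (simp add: cdf_def measure_def emeasure_distr vimage_def)
  qed
qed

lemma chi_sq_density_mult:
  fixes k l :: nat and x u :: real
  assumes x: "0 < x"
  defines "a \<equiv> real k / 2" and "b \<equiv> real l / 2"
  shows "chi_sq_density k (x - x * u) * chi_sq_density l (x * u) =
      exp (- x / 2) * x powr (a + b - 2) / (2 powr a * Gamma a * (2 powr b * Gamma b))
        * (u powr (b - 1) * (1 - u) powr (a - 1) * indicator {0..1} u)"
proof (cases "0 < u \<and> u < 1")
  case True
  have pos: "0 < x - x * u" "0 < x * u" using True x by (auto simp: algebra_simps)
  have "(x - x * u) powr (a - 1) = x powr (a - 1) * (1 - u) powr (a - 1)"
    using True x by (subst powr_mult[symmetric]) (auto simp: algebra_simps)
  moreover have "(x * u) powr (b - 1) = x powr (b - 1) * u powr (b - 1)"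
    using True x by (simp add: powr_mult)
  moreover have "x powr (a - 1) * x powr (b - 1) = x powr (a + b - 2)"
    by (simp flip: powr_add)
  moreover have "exp (- (x - x * u) / 2) * exp (- (x * u) / 2) = exp (- x / 2)"
    by (simp add: field_simps flip: exp_add)
  moreover have "chi_sq_density k (x - x * u) * chi_sq_density l (x * u) =
    ((x - x * u) powr (a - 1) * (x * u) powr (b - 1)) * (exp (- (x - x * u) / 2) * exp (- (x * u) / 2))
      / (2 powr a * Gamma a * (2 powr b * Gamma b))"
    using pos unfolding chi_sq_density_def a_def b_def by simp
  ultimately show ?thesis using True by (simp add: mult_ac)
next
  case False
  hence "x * u \<le> 0 \<or> x - x * u \<le> 0" using x by (auto simp: mult_le_0_iff not_less)
  hence "chi_sq_density k (x - x * u) * chi_sq_density l (x * u) = 0" by (auto simp: chi_sq_density_def)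
  moreover have "u powr (b - 1) * (1 - u) powr (a - 1) * indicator {0..1} u = 0"
    using False by (cases "u = 0 \<or> u = 1") (auto simp: indicator_def)
  ultimately show ?thesis by (simp only: mult_zero_right)
qed

lemma chi_sq_density_add:
  fixes k l :: nat
  assumes x: "0 < x" and kl: "1 \<le> k" "1 \<le> l"
  defines "a \<equiv> real k / 2" and "b \<equiv> real l / 2"
  shows "chi_sq_density (k + l) x =
      x * (exp (- x / 2) * x powr (a + b - 2) / (2 powr a * Gamma a * (2 powr b * Gamma b))) * Beta b a"
proof -
  have "0 < a" "0 < b" using kl by (auto simp: a_def b_def)
  hence Gamma: "Gamma a \<noteq> 0" "Gamma b \<noteq> 0" using Gamma_real_pos by (metis less_irrefl)+
  have shape: "real (k + l) / 2 = a + b" by (simp add: a_def b_def add_divide_distrib)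
  have "chi_sq_density (k + l) x = x powr (a + b - 1) * exp (- x / 2) / (2 powr (a + b) * Gamma (a + b))"
    using x unfolding chi_sq_density_def shape by simp
  moreover have "x * x powr (a + b - 2) = x powr (a + b - 1)" using x by (simp add: powr_mult_base)
  ultimately show ?thesis
    using Gamma unfolding Beta_def by (simp add: powr_add add.commute field_simps)
qed

lemma chi_sq_density_convolution:
  assumes "1 \<le> k" "1 \<le> l"
  shows "(\<integral>\<^sup>+y. ennreal (chi_sq_density k (x - y)) * ennreal (chi_sq_density l y) \<partial>lborel) =
      ennreal (chi_sq_density (k + l) x)"
proof (cases "x > 0")
  case False
  have "(\<integral>\<^sup>+y. ennreal (chi_sq_density k (x - y)) * ennreal (chi_sq_density l y) \<partial>lborel) =
      (\<integral>\<^sup>+(y::real). 0 \<partial>lborel)"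
    using False by (intro nn_integral_cong) (auto simp: chi_sq_density_def)
  thus ?thesis using False by (simp add: chi_sq_density_def)
next
  case True
  define a b where "a = real k / 2" and "b = real l / 2"
  have ab: "a > 0" "b > 0" using assms by (auto simp: a_def b_def)
  have Gamma: "0 < Gamma a" "0 < Gamma b" using ab by (auto intro!: Gamma_real_pos)
  define C where "C = exp (- x / 2) * x powr (a + b - 2) / (2 powr a * Gamma a * (2 powr b * Gamma b))"
  have C: "0 \<le> C" using Gamma by (simp add: C_def)
  have scaled: "ennreal (chi_sq_density k (x - x * u)) * ennreal (chi_sq_density l (x * u)) =
     ennreal C * (ennreal (u powr (b - 1) * (1 - u) powr (a - 1)) * indicator {0..1} u)" for u
  proof -
    have "ennreal (chi_sq_density k (x - x * u)) * ennreal (chi_sq_density l (x * u)) =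
       ennreal (C * (u powr (b - 1) * (1 - u) powr (a - 1) * indicator {0..1} u))"
      using chi_sq_density_mult[OF True, of k u l] unfolding a_def b_def C_def
      by (simp add: chi_sq_density_nonneg flip: ennreal_mult)
    also have "\<dots> = ennreal C * ennreal (u powr (b - 1) * (1 - u) powr (a - 1) * indicator {0..1} u)"
      using C by (rule ennreal_mult')
    finally show ?thesis by (auto simp: indicator_def)
  qed
  have "(\<integral>\<^sup>+y. ennreal (chi_sq_density k (x - y)) * ennreal (chi_sq_density l y) \<partial>lborel) =
     ennreal x * (\<integral>\<^sup>+u. ennreal (chi_sq_density k (x - x * u)) * ennreal (chi_sq_density l (x * u)) \<partial>lborel)"
    using True by (subst nn_integral_real_affine[where c = x and t = 0]) auto
  also have "\<dots> = ennreal x *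
      (ennreal C * (\<integral>\<^sup>+u. ennreal (u powr (b - 1) * (1 - u) powr (a - 1)) * indicator {0..1} u \<partial>lborel))"
    unfolding scaled by (subst nn_integral_cmult) auto
  also have "(\<integral>\<^sup>+u. ennreal (u powr (b - 1) * (1 - u) powr (a - 1)) * indicator {0..1} u \<partial>lborel) =
      ennreal (Beta b a)"
    by (rule nn_integral_has_integral_lebesgue'[OF _ has_integral_Beta_real[OF ab(2,1)]]) simp
  also have "ennreal x * (ennreal C * ennreal (Beta b a)) = ennreal (x * C * Beta b a)"
    using True C by (simp add: ennreal_mult' mult.assoc)
  also have "x * C * Beta b a = chi_sq_density (k + l) x"
    unfolding C_def a_def b_def by (rule chi_sq_density_add[OF True assms, symmetric])
  finally show ?thesis .
qed

lemma chi_sq_convolution: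
  assumes "1 \<le> k" "1 \<le> l" shows "chi_sq k \<star> chi_sq l = chi_sq (k + l)"
proof -
  interpret k: prob_space "chi_sq k" by (rule prob_space_chi_sq[OF assms(1)])
  interpret l: prob_space "chi_sq l" by (rule prob_space_chi_sq[OF assms(2)])
  have "chi_sq k \<star> chi_sq l =
      density lborel (\<lambda>x. \<integral>\<^sup>+y. ennreal (chi_sq_density k (x - y)) * ennreal (chi_sq_density l y) \<partial>lborel)"
    unfolding chi_sq_def
    by (rule convolution_density)
       (use k.finite_measure_axioms l.finite_measure_axioms in \<open>auto simp: chi_sq_def\<close>)
  also have "\<dots> = chi_sq (k + l)"
    unfolding chi_sq_def chi_sq_density_convolution[OF assms] ..
  finally show ?thesis .
qed

text \<open>As \<open>Gamma 0 = 0\<close>, division by zero makes \<open>chi_sq 0\<close> the zero measure rather than the point mass at 0.\<close>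

definition chi_sq0 :: "nat \<Rightarrow> real measure" where
  "chi_sq0 k = (if k = 0 then return borel 0 else chi_sq k)"

lemma sets_chi_sq0 [simp, measurable_cong]: "sets (chi_sq0 k) = sets borel"
  by (simp add: chi_sq0_def)

lemma nn_integral_chi_sq0_Suc:
  assumes [measurable]: "h \<in> borel_measurable borel"
  shows "(\<integral>\<^sup>+x. h x \<partial>chi_sq0 (Suc k)) = (\<integral>\<^sup>+q. \<integral>\<^sup>+v. h (q + v\<^sup>2) \<partial>std_normal_distribution \<partial>chi_sq0 k)"
proof -
  interpret chi_sq_1: prob_space "chi_sq 1" by (rule prob_space_chi_sq) simp
  have "(\<integral>\<^sup>+x. h x \<partial>chi_sq0 (Suc k)) = (\<integral>\<^sup>+q. \<integral>\<^sup>+p. h (q + p) \<partial>chi_sq 1 \<partial>chi_sq0 k)"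
  proof (cases "k = 0")
    case True
    have "(\<integral>\<^sup>+q. (\<integral>\<^sup>+p. h (q + p) \<partial>chi_sq 1) \<partial>return borel 0) = (\<integral>\<^sup>+p. h (0 + p) \<partial>chi_sq 1)"
      by (rule nn_integral_return) (simp, measurable)
    thus ?thesis using True by (simp add: chi_sq0_def)
  next
    case False
    have "(\<integral>\<^sup>+x. h x \<partial>(chi_sq k \<star> chi_sq 1)) = (\<integral>\<^sup>+q. \<integral>\<^sup>+p. h (q + p) \<partial>chi_sq 1 \<partial>chi_sq k)"
      using prob_space_chi_sq[of k] chi_sq_1.finite_measure_axioms False
      by (intro nn_integral_convolution) (auto simp: prob_space_def)
    thus ?thesis using False chi_sq_convolution[of k 1] by (simp add: chi_sq0_def)
  qed
  also have "\<dots> = (\<integral>\<^sup>+q. \<integral>\<^sup>+v. h (q + v\<^sup>2) \<partial>std_normal_distribution \<partial>chi_sq0 k)"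
    unfolding distr_std_normal_square[symmetric] by (subst nn_integral_distr) auto
  finally show ?thesis .
qed

text \<open>A rotation is the composition of two one-dimensional affine substitutions.\<close>

lemma nn_integral_lborel_rotation:
  fixes f :: "real \<Rightarrow> real \<Rightarrow> ennreal"
  assumes [measurable]: "case_prod f \<in> borel_measurable (borel \<Otimes>\<^sub>M borel)" and ab: "a\<^sup>2 + b\<^sup>2 = 1" "a \<noteq> 0"
  shows "(\<integral>\<^sup>+s. \<integral>\<^sup>+y. f (a * s + b * y) (a * y - b * s) \<partial>lborel \<partial>lborel) = (\<integral>\<^sup>+u. \<integral>\<^sup>+v. f u v \<partial>lborel \<partial>lborel)"
proof -
  have "(\<integral>\<^sup>+s. \<integral>\<^sup>+y. f (a * s + b * y) (a * y - b * s) \<partial>lborel \<partial>lborel) =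
      (\<integral>\<^sup>+y. \<integral>\<^sup>+s. f (a * s + b * y) (a * y - b * s) \<partial>lborel \<partial>lborel)"
    by (rule lborel_pair.Fubini') simp
  also have "\<dots> = (\<integral>\<^sup>+y. \<integral>\<^sup>+u. ennreal \<bar>1 / a\<bar> * f u ((y - b * u) / a) \<partial>lborel \<partial>lborel)"
  proof (rule nn_integral_cong)
    fix y :: real
    have shear: "a * (- b * y / a + 1 / a * u) + b * y = u"
      "a * y - b * (- b * y / a + 1 / a * u) = (y - b * u) / a" for u
    proof -
      have "a * y - b * (- b * y / a + 1 / a * u) = ((a\<^sup>2 + b\<^sup>2) * y - b * u) / a"
        using ab(2) by (simp add: field_simps power2_eq_square)
      thus "a * y - b * (- b * y / a + 1 / a * u) = (y - b * u) / a" by (simp add: ab(1))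
    qed (use ab(2) in \<open>simp add: field_simps\<close>)
    have "(\<integral>\<^sup>+s. f (a * s + b * y) (a * y - b * s) \<partial>lborel) =
       ennreal \<bar>1 / a\<bar> * (\<integral>\<^sup>+u.
           f (a * (- b * y / a + 1 / a * u) + b * y) (a * y - b * (- b * y / a + 1 / a * u)) \<partial>lborel)"
      using ab(2) by (intro nn_integral_real_affine) auto
    thus "(\<integral>\<^sup>+s. f (a * s + b * y) (a * y - b * s) \<partial>lborel) =
        (\<integral>\<^sup>+u. ennreal \<bar>1 / a\<bar> * f u ((y - b * u) / a) \<partial>lborel)"
      unfolding shear by (simp add: nn_integral_cmult)
  qed
  also have "\<dots> = (\<integral>\<^sup>+u. \<integral>\<^sup>+y. ennreal \<bar>1 / a\<bar> * f u ((y - b * u) / a) \<partial>lborel \<partial>lborel)"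
    by (rule lborel_pair.Fubini') simp
  also have "\<dots> = (\<integral>\<^sup>+u. \<integral>\<^sup>+v. f u v \<partial>lborel \<partial>lborel)"
  proof (rule nn_integral_cong)
    fix u :: real
    have "(\<integral>\<^sup>+y. ennreal \<bar>1 / a\<bar> * f u ((y - b * u) / a) \<partial>lborel) =
       ennreal \<bar>a\<bar> * (\<integral>\<^sup>+v. ennreal \<bar>1 / a\<bar> * f u ((b * u + a * v - b * u) / a) \<partial>lborel)"
      using ab(2) by (intro nn_integral_real_affine) auto
    also have "\<dots> = (ennreal \<bar>a\<bar> * ennreal \<bar>1 / a\<bar>) * (\<integral>\<^sup>+v. f u v \<partial>lborel)"
      using ab(2) by (simp add: nn_integral_cmult mult.assoc)
    also have "ennreal \<bar>a\<bar> * ennreal \<bar>1 / a\<bar> = 1"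
      using ab(2) by (simp add: abs_mult[symmetric] flip: ennreal_mult)
    finally show "(\<integral>\<^sup>+y. ennreal \<bar>1 / a\<bar> * f u ((y - b * u) / a) \<partial>lborel) = (\<integral>\<^sup>+v. f u v \<partial>lborel)" by simp
  qed
  finally show ?thesis .
qed

lemma nn_integral_std_normal_pair:
  fixes f :: "real \<Rightarrow> real \<Rightarrow> ennreal"
  assumes [measurable]: "case_prod f \<in> borel_measurable (borel \<Otimes>\<^sub>M borel)"
  shows "(\<integral>\<^sup>+s. \<integral>\<^sup>+y. f s y \<partial>std_normal_distribution \<partial>std_normal_distribution) =
    (\<integral>\<^sup>+s. \<integral>\<^sup>+y. ennreal (exp (- (s\<^sup>2 + y\<^sup>2) / 2) / (2 * pi)) * f s y \<partial>lborel \<partial>lborel)"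
proof -
  have density: "ennreal (std_normal_density s) * ennreal (std_normal_density y) =
      ennreal (exp (- (s\<^sup>2 + y\<^sup>2) / 2) / (2 * pi))" for s y
    unfolding std_normal_density_def by (simp add: mult_exp_exp add_divide_distrib flip: ennreal_mult)
  have "(\<integral>\<^sup>+s. \<integral>\<^sup>+y. f s y \<partial>std_normal_distribution \<partial>std_normal_distribution) =
    (\<integral>\<^sup>+s. ennreal (std_normal_density s) * (\<integral>\<^sup>+y. ennreal (std_normal_density y) * f s y \<partial>lborel) \<partial>lborel)"
    by (subst nn_integral_density) (auto simp: nn_integral_density intro!: nn_integral_cong)
  also have "\<dots> =
      (\<integral>\<^sup>+s. \<integral>\<^sup>+y. ennreal (std_normal_density s) * (ennreal (std_normal_density y) * f s y) \<partial>lborel \<partial>lborel)"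
    by (intro nn_integral_cong nn_integral_cmult[symmetric]) simp
  finally show ?thesis by (simp only: mult.assoc[symmetric] density)
qed

lemma nn_integral_std_normal_rotation:
  fixes f :: "real \<Rightarrow> real \<Rightarrow> ennreal"
  assumes [measurable]: "case_prod f \<in> borel_measurable (borel \<Otimes>\<^sub>M borel)" and ab: "a\<^sup>2 + b\<^sup>2 = 1" "a \<noteq> 0"
  shows "(\<integral>\<^sup>+s. \<integral>\<^sup>+y. f (a * s + b * y) (a * y - b * s) \<partial>std_normal_distribution \<partial>std_normal_distribution) =
    (\<integral>\<^sup>+u. \<integral>\<^sup>+v. f u v \<partial>std_normal_distribution \<partial>std_normal_distribution)"
proof -
  have "(a * s + b * y)\<^sup>2 + (a * y - b * s)\<^sup>2 = (a\<^sup>2 + b\<^sup>2) * (s\<^sup>2 + y\<^sup>2)" for s y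
    by (simp add: power2_eq_square algebra_simps)
  hence "(a * s + b * y)\<^sup>2 + (a * y - b * s)\<^sup>2 = s\<^sup>2 + y\<^sup>2" for s y by (simp add: ab(1))
  thus ?thesis
    using nn_integral_lborel_rotation[of "\<lambda>u v. ennreal (exp (- (u\<^sup>2 + v\<^sup>2) / 2) / (2 * pi)) * f u v", OF _ ab]
    by (simp add: nn_integral_std_normal_pair)
qed

definition sum_sq :: "nat \<Rightarrow> (nat \<Rightarrow> real) \<Rightarrow> real" where
  "sum_sq r z = (\<Sum>i\<in>{1..r}. (z i)\<^sup>2)"

definition centred_sum_sq :: "nat \<Rightarrow> (nat \<Rightarrow> real) \<Rightarrow> real" where
  "centred_sum_sq r z = (\<Sum>i\<in>{1..r}. (z i - (\<Sum>j\<in>{1..r}. z j) / real r)\<^sup>2)"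

lemma centred_sum_sq_divide_sqrt:
  assumes "0 < v"
  shows "centred_sum_sq k (\<lambda>i. y i / sqrt v) = (\<Sum>i\<in>{1..k}. (y i - (\<Sum>j\<in>{1..k}. y j) / real k)\<^sup>2 / v)"
proof -
  have "(\<Sum>j\<in>{1..k}. y j / sqrt v) / real k = (\<Sum>j\<in>{1..k}. y j) / real k / sqrt v"
    by (simp flip: sum_divide_distrib)
  thus ?thesis
    unfolding centred_sum_sq_def
      using assms by (simp only: power_divide real_sqrt_pow2 less_imp_le flip: diff_divide_distrib)
qed

lemma sum_sq_Suc: "sum_sq (Suc k) (z(Suc k := y)) = sum_sq k z + y\<^sup>2"
  unfolding sum_sq_def by (simp add: sum.atLeast1_atMost_eq)

lemma centred_sum_sq_alt:
  assumes "1 \<le> k"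
  shows "centred_sum_sq k z = sum_sq k z - (\<Sum>i\<in>{1..k}. z i)\<^sup>2 / real k"
proof -
  define m where "m = (\<Sum>i\<in>{1..k}. z i) / real k"
  have total: "(\<Sum>i\<in>{1..k}. z i) = real k * m" using assms by (simp add: m_def)
  have "centred_sum_sq k z = (\<Sum>i\<in>{1..k}. (z i)\<^sup>2 - 2 * m * z i + m\<^sup>2)"
    unfolding centred_sum_sq_def m_def[symmetric]
    by (intro sum.cong) (auto simp: power2_eq_square algebra_simps)
  also have "\<dots> = sum_sq k z - 2 * m * (\<Sum>i\<in>{1..k}. z i) + real k * m\<^sup>2"
    by (simp add: sum_sq_def sum.distrib sum_subtractf sum_distrib_left)
  also have "\<dots> = sum_sq k z - (\<Sum>i\<in>{1..k}. z i)\<^sup>2 / real k"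
    unfolding total using assms by (simp add: power2_eq_square)
  finally show ?thesis .
qed

lemma centred_sum_sq_Suc:
  fixes z :: "nat \<Rightarrow> real"
  assumes k: "1 \<le> k"
  defines "S \<equiv> (\<Sum>i\<in>{1..k}. z i) / sqrt k"
  shows "centred_sum_sq (Suc k) (z(Suc k := y)) =
    centred_sum_sq k z + (sqrt (k / Suc k) * y - sqrt (1 / Suc k) * S)\<^sup>2"
proof -
  define q where "q = sqrt (real k)"
  have q: "q > 0" "q\<^sup>2 = real k" using k by (auto simp: q_def)
  have total: "(\<Sum>i\<in>{1..k}. z i) = q * S" using q by (simp add: S_def q_def)
  have "(sqrt (k / Suc k) * y - sqrt (1 / Suc k) * S)\<^sup>2 = ((q * y - S) / sqrt (Suc k))\<^sup>2"
    by (simp add: q_def real_sqrt_divide diff_divide_distrib)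
  also have "\<dots> = (q * y - S)\<^sup>2 / (q\<^sup>2 + 1)" using q by (simp add: power_divide)
  finally have contrast: "(sqrt (k / Suc k) * y - sqrt (1 / Suc k) * S)\<^sup>2 = (q * y - S)\<^sup>2 / (q\<^sup>2 + 1)" .
  have "(\<Sum>i\<in>{1..Suc k}. (z(Suc k := y)) i) = q * S + y"
    using total by (simp add: sum.atLeast1_atMost_eq)
  hence "centred_sum_sq (Suc k) (z(Suc k := y)) = sum_sq k z + y\<^sup>2 - (q * S + y)\<^sup>2 / (q\<^sup>2 + 1)"
    using centred_sum_sq_alt[of "Suc k" "z(Suc k := y)"] by (simp add: q(2) sum_sq_Suc add.commute)
  moreover have "centred_sum_sq k z = sum_sq k z - (q * S)\<^sup>2 / q\<^sup>2"
    by (simp only: centred_sum_sq_alt[OF k] total q(2))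
  moreover have "y\<^sup>2 - (q * S + y)\<^sup>2 / (q\<^sup>2 + 1) = - (q * S)\<^sup>2 / q\<^sup>2 + (q * y - S)\<^sup>2 / (q\<^sup>2 + 1)"
  proof -
    have "q\<^sup>2 + 1 > 0" using q by (simp add: add_pos_pos)
    thus ?thesis using q(1) by (simp add: divide_simps) (simp add: power2_eq_square algebra_simps)
  qed
  ultimately show ?thesis unfolding contrast by simp
qed

abbreviation normal_vector :: "nat \<Rightarrow> (nat \<Rightarrow> real) measure" where
  "normal_vector k \<equiv> PiM {1..k} (\<lambda>_. std_normal_distribution)"

lemma sum_sq_measurable [measurable]: "sum_sq k \<in> borel_measurable (PiM {1..k} (\<lambda>_. borel))"
  unfolding sum_sq_def[abs_def] by measurable

lemma centred_sum_sq_measurable [measurable]: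
  "centred_sum_sq k \<in> borel_measurable (PiM {1..k} (\<lambda>_. borel))"
  unfolding centred_sum_sq_def[abs_def] by measurable

lemma sum_sq_continuous: "continuous_on UNIV (sum_sq r)"
  unfolding sum_sq_def[abs_def] by (intro continuous_intros) auto

lemma centred_sum_sq_continuous: "1 \<le> r \<Longrightarrow> continuous_on UNIV (centred_sum_sq r)"
  unfolding centred_sum_sq_def[abs_def] by (intro continuous_intros) auto

lemma sum_sq_restrict: "sum_sq r (restrict z {1..r}) = sum_sq r z"
  by (simp add: sum_sq_def)

lemma centred_sum_sq_restrict: "centred_sum_sq r (restrict z {1..r}) = centred_sum_sq r z"
  by (simp add: centred_sum_sq_def)

interpretation std_normal: prob_space std_normal_distribution
  by (rule prob_space_std_normal)

interpretation normal_product: product_sigma_finite "\<lambda>_::nat. std_normal_distribution"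
  by standard

lemma sets_normal_vector [measurable_cong]: "sets (normal_vector k) = sets (PiM {1..k} (\<lambda>_. borel))"
  by (rule sets_PiM_cong) auto

lemma nn_integral_normal_vector_Suc:
  assumes "f \<in> borel_measurable (PiM {1..Suc k} (\<lambda>_. borel))"
  shows "(\<integral>\<^sup>+z. f z \<partial>normal_vector (Suc k)) =
    (\<integral>\<^sup>+z. \<integral>\<^sup>+y. f (z(Suc k := y)) \<partial>std_normal_distribution \<partial>normal_vector k)"
proof -
  have "{1..Suc k} = insert (Suc k) {1..k}" by auto
  moreover have "f \<in> borel_measurable (normal_vector (Suc k))"
    using assms by (simp only: measurable_cong_sets[OF sets_normal_vector refl])
  ultimately show ?thesis using normal_product.product_nn_integral_insert[of "{1..k}" "Suc k" f] by simp
qed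

lemma nn_integral_sum_sq:
  assumes [measurable]: "h \<in> borel_measurable borel"
  shows "(\<integral>\<^sup>+z. h (sum_sq k z) \<partial>normal_vector k) = (\<integral>\<^sup>+x. h x \<partial>chi_sq0 k)"
  using assms
proof (induction k arbitrary: h)
  case 0
  thus ?case by (simp add: chi_sq0_def sum_sq_def nn_integral_return PiM_empty)
next
  case (Suc k)
  note [measurable] = Suc.prems
  have "(\<integral>\<^sup>+z. h (sum_sq (Suc k) z) \<partial>normal_vector (Suc k)) =
      (\<integral>\<^sup>+z. \<integral>\<^sup>+y. h (sum_sq k z + y\<^sup>2) \<partial>std_normal_distribution \<partial>normal_vector k)"
    unfolding sum_sq_Suc[symmetric] by (rule nn_integral_normal_vector_Suc) measurable
  also have "\<dots> = (\<integral>\<^sup>+q. \<integral>\<^sup>+y. h (q + y\<^sup>2) \<partial>std_normal_distribution \<partial>chi_sq0 k)"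
    by (rule Suc.IH) measurable
  also have "\<dots> = (\<integral>\<^sup>+x. h x \<partial>chi_sq0 (Suc k))"
    by (rule nn_integral_chi_sq0_Suc[symmetric]) simp
  finally show ?case .
qed

lemma normalised_sum_Suc:
  assumes "1 \<le> k"
  shows "(\<Sum>i\<in>{1..Suc k}. (z(Suc k := y)) i) / sqrt (Suc k) =
    sqrt (k / Suc k) * ((\<Sum>i\<in>{1..k}. z i) / sqrt k) + sqrt (1 / Suc k) * y"
  using assms by (simp add: sum.atLeast1_atMost_eq real_sqrt_divide add_divide_distrib)

lemma nn_integral_centred_sum_sq_1:
  assumes [measurable]: "case_prod f \<in> borel_measurable (borel \<Otimes>\<^sub>M borel)"
  shows "(\<integral>\<^sup>+z. f (centred_sum_sq 1 z) (\<Sum>i\<in>{1..1}. z i) \<partial>normal_vector 1) =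
    (\<integral>\<^sup>+q. \<integral>\<^sup>+s. f q s \<partial>std_normal_distribution \<partial>chi_sq0 0)"
proof -
  have "(\<integral>\<^sup>+z. f (centred_sum_sq 1 z) (\<Sum>i\<in>{1..1}. z i) \<partial>normal_vector 1) =
      (\<integral>\<^sup>+z. f 0 (z 1) \<partial>PiM {1::nat} (\<lambda>_. std_normal_distribution))"
    by (simp add: centred_sum_sq_def del: One_nat_def)
  also have "\<dots> = (\<integral>\<^sup>+s. f 0 s \<partial>std_normal_distribution)"
    by (rule normal_product.product_nn_integral_singleton) measurable
  also have "\<dots> = (\<integral>\<^sup>+q. \<integral>\<^sup>+s. f q s \<partial>std_normal_distribution \<partial>return borel 0)"
    by (rule nn_integral_return[symmetric]) measurable
  finally show ?thesis by (simp add: chi_sq0_def)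
qed

text \<open>Adding one more normal variable rotates (normalised sum, new variable) into (new normalised
  sum, new contrast), so the centred sum of squares gains the square of an independent normal.\<close>

lemma nn_integral_centred_sum_sq:
  assumes "1 \<le> k" "case_prod f \<in> borel_measurable (borel \<Otimes>\<^sub>M borel)"
  shows "(\<integral>\<^sup>+z. f (centred_sum_sq k z) ((\<Sum>i\<in>{1..k}. z i) / sqrt k) \<partial>normal_vector k) =
    (\<integral>\<^sup>+q. \<integral>\<^sup>+s. f q s \<partial>std_normal_distribution \<partial>chi_sq0 (k - 1))"
  using assms
proof (induction k arbitrary: f rule: dec_induct)
  case base
  thus ?case using nn_integral_centred_sum_sq_1[of f] by simp
next
  case (step k)
  note [measurable] = step.prems
  interpret pair_sigma_finite std_normal_distribution std_normal_distribution ..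
  define a b where "a = sqrt (k / Suc k)" and "b = sqrt (1 / Suc k)"
  have ab: "a\<^sup>2 + b\<^sup>2 = 1" "a \<noteq> 0" using step.hyps by (simp_all add: a_def b_def field_simps)
  have "(\<integral>\<^sup>+z. f (centred_sum_sq (Suc k) z) ((\<Sum>i\<in>{1..Suc k}. z i) / sqrt (Suc k)) \<partial>normal_vector (Suc k)) =
     (\<integral>\<^sup>+z. \<integral>\<^sup>+y. f (centred_sum_sq (Suc k) (z(Suc k := y))) ((\<Sum>i\<in>{1..Suc k}. (z(Suc k := y)) i) / sqrt (Suc k))
        \<partial>std_normal_distribution \<partial>normal_vector k)"
    by (rule nn_integral_normal_vector_Suc) measurable
  also have "\<dots> = (\<integral>\<^sup>+z. (\<lambda>q s. \<integral>\<^sup>+y. f (q + (a * y - b * s)\<^sup>2) (a * s + b * y) \<partial>std_normal_distribution)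
       (centred_sum_sq k z) ((\<Sum>i\<in>{1..k}. z i) / sqrt k) \<partial>normal_vector k)"
    using step.hyps by (simp only: normalised_sum_Suc centred_sum_sq_Suc a_def b_def)
  also have "\<dots> = (\<integral>\<^sup>+q. \<integral>\<^sup>+s. \<integral>\<^sup>+y. f (q + (a * y - b * s)\<^sup>2) (a * s + b * y)
       \<partial>std_normal_distribution \<partial>std_normal_distribution \<partial>chi_sq0 (k - 1))"
    by (rule step.IH) measurable
  also have "\<dots> = (\<integral>\<^sup>+q. \<integral>\<^sup>+u. \<integral>\<^sup>+v. f (q + v\<^sup>2) u
       \<partial>std_normal_distribution \<partial>std_normal_distribution \<partial>chi_sq0 (k - 1))"
    by (rule nn_integral_cong, rule nn_integral_std_normal_rotation[OF _ ab,
        of "\<lambda>u v. f (_ + v\<^sup>2) u"]) measurable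
  also have "\<dots> = (\<integral>\<^sup>+q. \<integral>\<^sup>+v. \<integral>\<^sup>+u. f (q + v\<^sup>2) u
       \<partial>std_normal_distribution \<partial>std_normal_distribution \<partial>chi_sq0 (k - 1))"
    by (rule nn_integral_cong, rule Fubini') measurable
  also have "\<dots> = (\<integral>\<^sup>+q. \<integral>\<^sup>+u. f q u \<partial>std_normal_distribution \<partial>chi_sq0 (Suc (k - 1)))"
    by (rule nn_integral_chi_sq0_Suc[symmetric]) measurable
  also have "Suc (k - 1) = Suc k - 1" using step.hyps by simp
  finally show ?case .
qed

lemma distr_eqI_nn_integral:
  fixes f :: "'a \<Rightarrow> 'b" and N L :: "'b measure"
  assumes f: "f \<in> measurable M N" and L: "sets N = sets L"
    and eq: "\<And>h. h \<in> borel_measurable N \<Longrightarrow> (\<integral>\<^sup>+x. h (f x) \<partial>M) = (\<integral>\<^sup>+y. h y \<partial>L)"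
  shows "distr M N f = L"
proof (rule measure_eqI)
  fix A assume "A \<in> sets (distr M N f)"
  hence A [measurable]: "A \<in> sets N" by simp
  have "emeasure (distr M N f) A = (\<integral>\<^sup>+x. indicator A (f x) \<partial>M)"
    using nn_integral_distr[OF f, of "indicator A"] by simp
  also have "\<dots> = emeasure L A" using A L by (simp add: eq)
  finally show "emeasure (distr M N f) A = emeasure L A" .
qed (simp add: L)

lemma distr_sum_sq:
  assumes "1 \<le> k" shows "distr (normal_vector k) borel (sum_sq k) = chi_sq k"
proof (rule distr_eqI_nn_integral)
  show "sum_sq k \<in> borel_measurable (normal_vector k)" by measurable
  fix h :: "real \<Rightarrow> ennreal" assume "h \<in> borel_measurable borel"
  thus "(\<integral>\<^sup>+z. h (sum_sq k z) \<partial>normal_vector k) = (\<integral>\<^sup>+x. h x \<partial>chi_sq k)"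
    using assms nn_integral_sum_sq[of h k] by (simp add: chi_sq0_def)
qed simp

lemma distr_centred_sum_sq:
  assumes "2 \<le> k" shows "distr (normal_vector k) borel (centred_sum_sq k) = chi_sq (k - 1)"
proof (rule distr_eqI_nn_integral)
  show "centred_sum_sq k \<in> borel_measurable (normal_vector k)" by measurable
  fix h :: "real \<Rightarrow> ennreal" assume [measurable]: "h \<in> borel_measurable borel"
  show "(\<integral>\<^sup>+z. h (centred_sum_sq k z) \<partial>normal_vector k) = (\<integral>\<^sup>+x. h x \<partial>chi_sq (k - 1))"
    using nn_integral_centred_sum_sq[of k "\<lambda>q s. h q"] assms
    using std_normal.emeasure_space_1 by (simp add: chi_sq0_def)
qed simp

section \<open>The logistic function\<close>

abbreviation softplus :: "real \<Rightarrow> real" where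
  "softplus x \<equiv> ln (1 + exp x)"

definition dmu :: "real \<Rightarrow> real" where
  "dmu x = exp x / (1 + exp x)\<^sup>2"

lemma one_plus_exp_pos [simp]: "0 < 1 + exp (x::real)" "1 + exp x \<noteq> 0"
  by (simp_all add: add_pos_pos add_nonneg_eq_0_iff)

lemma softplus_has_derivative: "(softplus has_real_derivative mu x) (at x)"
  unfolding mu_def by (auto intro!: derivative_eq_intros)

lemma mu_has_derivative: "(mu has_real_derivative dmu x) (at x)"
  unfolding mu_def[abs_def] dmu_def
  by (auto intro!: derivative_eq_intros simp: power2_eq_square divide_simps) (simp add: algebra_simps)

lemma mu_bounds: "0 \<le> mu x" "mu x \<le> 1"
  unfolding mu_def by (auto simp: divide_simps add_pos_pos)

lemma dmu_eq_mu_mult: "dmu x = mu x * (1 - mu x)"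
  unfolding dmu_def mu_def by (simp add: field_simps power2_eq_square)

lemma dmu_pos: "0 < dmu x"
  unfolding dmu_def by simp

lemma dmu_le_quarter: "dmu x \<le> 1 / 4"
proof -
  have "0 \<le> (mu x - 1/2)\<^sup>2" by simp
  thus ?thesis unfolding dmu_eq_mu_mult by (simp add: power2_eq_square algebra_simps)
qed

lemma inverse_dmu: "1 / dmu x = (1 + exp x) * (1 + exp (- x))"
  unfolding dmu_def by (simp add: exp_minus field_simps power2_eq_square)

lemma dmu_le_exp_mult: "dmu y \<le> exp \<bar>x - y\<bar> * dmu x"
proof -
  have ordered: "1 / dmu x \<le> exp (x - y) * (1 / dmu y)" if "y \<le> x" for x y
  proof -
    have "1 + exp x \<le> exp (x - y) * (1 + exp y)"
      using that by (simp add: distrib_left flip: exp_add)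
    moreover have "1 + exp (- x) \<le> 1 + exp (- y)" using that by simp
    ultimately have "(1 + exp x) * (1 + exp (- x)) \<le> (exp (x - y) * (1 + exp y)) * (1 + exp (- y))"
      by (intro mult_mono) (auto simp: add_nonneg_nonneg)
    thus ?thesis by (simp add: inverse_dmu mult_ac)
  qed
  have even: "dmu (- z) = dmu z" for z
    unfolding dmu_eq_mu_mult mu_def by (simp add: exp_minus field_simps)
  have "1 / dmu x \<le> exp \<bar>x - y\<bar> * (1 / dmu y)"
  proof (cases "y \<le> x")
    case True
    thus ?thesis using ordered[of y x] by simp
  next
    case False
    thus ?thesis using ordered[of "- y" "- x"] by (simp add: even)
  qed
  thus ?thesis using dmu_pos[of x] dmu_pos[of y] by (simp add: field_simps)
qed

lemma dmu_relative_lipschitz: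
  assumes "\<bar>x - y\<bar> \<le> t" "t \<le> 1"
  shows "\<bar>dmu y - dmu x\<bar> \<le> 2 * t * dmu x"
proof -
  have t: "0 \<le> t" using assms(1) by linarith
  have "exp t \<le> 1 + t + t\<^sup>2" using exp_bound[of t] t assms(2) by auto
  also have "\<dots> \<le> 1 + 2 * t" using t assms(2) by (simp add: power2_eq_square mult_left_le)
  finally have exp_le: "exp t \<le> 1 + 2 * t" .
  have exp_ratio: "dmu u \<le> exp t * dmu z" if "\<bar>z - u\<bar> \<le> t" for z u
    by (rule order_trans[OF dmu_le_exp_mult[of u z]])
       (use that dmu_pos[of z] in \<open>auto intro!: mult_right_mono\<close>)
  have "dmu y \<le> exp t * dmu x" using assms by (intro exp_ratio)
  also have "\<dots> \<le> (1 + 2 * t) * dmu x" using exp_le dmu_pos[of x] by (intro mult_right_mono) auto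
  finally have upper: "dmu y \<le> dmu x + 2 * t * dmu x" by (simp add: algebra_simps)
  have "dmu x \<le> exp t * dmu y" using assms by (intro exp_ratio) auto
  hence "exp (- t) * dmu x \<le> dmu y" by (simp add: exp_minus divide_simps mult_ac)
  moreover have "(1 - t) * dmu x \<le> exp (- t) * dmu x"
    using exp_ge_add_one_self[of "- t"] dmu_pos[of x] by (intro mult_right_mono) auto
  ultimately have "dmu x - t * dmu x \<le> dmu y" by (simp add: algebra_simps)
  moreover have "0 \<le> t * dmu x" using t dmu_pos[of x] by simp
  ultimately show ?thesis using upper by linarith
qed

lemma mu_mvt:
  obtains z where "\<bar>z - x\<bar> \<le> \<bar>t\<bar>" "\<bar>z - (x + t)\<bar> \<le> \<bar>t\<bar>" "mu (x + t) - mu x = dmu z * t"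
proof -
  consider "t > 0" | "t = 0" | "t < 0" by linarith
  thus thesis
  proof cases
    case 1
    obtain z where "x < z" "z < x + t" "mu (x + t) - mu x = (x + t - x) * dmu z"
      using MVT2[of x "x + t" mu dmu] 1 mu_has_derivative by auto
    thus thesis using 1 by (intro that[of z]) auto
  next
    case 3
    obtain z where "x + t < z" "z < x" "mu x - mu (x + t) = (x - (x + t)) * dmu z"
      using MVT2[of "x + t" x mu dmu] 3 mu_has_derivative by auto
    thus thesis using 3 by (intro that[of z]) (auto simp: algebra_simps)
  qed (use that in auto)
qed

lemma mu_lipschitz: "\<bar>mu (x + t) - mu x\<bar> \<le> \<bar>t\<bar>"
proof (rule mu_mvt[of x t])
  fix z assume "mu (x + t) - mu x = dmu z * t"
  thus ?thesis using dmu_pos[of z] dmu_le_quarter[of z]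
    by (simp add: abs_mult mult_left_le_one_le)
qed

lemma mu_diff_mult_nonneg: "0 \<le> (mu (x + t) - mu x) * t"
proof (rule mu_mvt[of x t])
  fix z assume "mu (x + t) - mu x = dmu z * t"
  thus ?thesis using dmu_pos[of z] by (simp add: mult.assoc)
qed

lemma mu_secant_slope_ge:
  assumes "\<bar>t\<bar> \<le> 1 / 2"
  shows "\<exists>c\<ge>dmu x / 2. mu (x + t) - mu x = c * t"
proof (rule mu_mvt[of x t])
  fix z assume z: "\<bar>z - x\<bar> \<le> \<bar>t\<bar>" "mu (x + t) - mu x = dmu z * t"
  have "dmu x \<le> exp (1 / 2) * dmu z"
    by (rule order_trans[OF dmu_le_exp_mult[of x z]])
       (use z assms dmu_pos[of z] in \<open>auto intro!: mult_right_mono\<close>)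
  also have "exp (1 / 2) \<le> (2::real)"
    using exp_bound[of "1/2"] by (simp add: power2_eq_square)
  hence "exp (1 / 2) * dmu z \<le> 2 * dmu z" using dmu_pos[of z] by (intro mult_right_mono) auto
  finally show ?thesis using z by (intro exI[of _ "dmu z"]) auto
qed

lemma mu_taylor_bound:
  assumes "\<bar>t\<bar> \<le> 1"
  shows "\<bar>mu (x + t) - mu x - dmu x * t\<bar> \<le> t\<^sup>2"
proof (rule mu_mvt[of x t])
  fix z assume z: "\<bar>z - x\<bar> \<le> \<bar>t\<bar>" "mu (x + t) - mu x = dmu z * t"
  have "\<bar>dmu z - dmu x\<bar> \<le> 2 * \<bar>t\<bar> * dmu x"
    using z assms by (intro dmu_relative_lipschitz) auto
  also have "\<dots> \<le> 2 * \<bar>t\<bar> * (1 / 4)" by (intro mult_left_mono dmu_le_quarter) auto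
  finally have "\<bar>dmu z - dmu x\<bar> \<le> \<bar>t\<bar>" by linarith
  hence "\<bar>dmu z - dmu x\<bar> * \<bar>t\<bar> \<le> \<bar>t\<bar> * \<bar>t\<bar>" by (intro mult_right_mono) auto
  thus ?thesis using z by (simp add: power2_eq_square abs_mult[symmetric] algebra_simps)
qed

definition softplus_bregman :: "real \<Rightarrow> real \<Rightarrow> real" where
  "softplus_bregman x t = softplus x - softplus (x + t) + mu (x + t) * t"

lemma softplus_bregman_taylor:
  obtains z where "\<bar>z - x\<bar> \<le> \<bar>t\<bar>" "\<bar>z - (x + t)\<bar> \<le> \<bar>t\<bar>" "softplus_bregman x t = dmu z * t\<^sup>2 / 2"
proof (cases "t = 0")
  case False
  define diff :: "nat \<Rightarrow> real \<Rightarrow> real"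
    where "diff m = (if m = 0 then softplus else if m = 1 then mu else dmu)" for m
  define y where "y = x + t"
  have "\<exists>z. (if x < y then x < z \<and> z < y else y < z \<and> z < x) \<and>
     softplus x = (\<Sum>m<2. diff m y / fact m * (x - y) ^ m) + diff 2 z / fact 2 * (x - y)\<^sup>2"
    by (rule Taylor[where a = "min x y" and b = "max x y"])
       (use False in \<open>auto simp: diff_def y_def less_2_cases_iff softplus_has_derivative
          mu_has_derivative\<close>)
  then obtain z where z: "if x < y then x < z \<and> z < y else y < z \<and> z < x"
    and eq: "softplus x = softplus y - mu y * t + dmu z / 2 * t\<^sup>2"
    by (auto simp: diff_def y_def numeral_2_eq_2 power2_eq_square)
  show thesis
  proof (rule that)
    show "\<bar>z - x\<bar> \<le> \<bar>t\<bar>" "\<bar>z - (x + t)\<bar> \<le> \<bar>t\<bar>"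
      using z unfolding y_def by (auto split: if_splits)
    show "softplus_bregman x t = dmu z * t\<^sup>2 / 2"
      using eq by (simp add: softplus_bregman_def y_def)
  qed
qed (auto intro: that[of x] simp: softplus_bregman_def)

lemma softplus_bregman_nonneg: "0 \<le> softplus_bregman x t"
proof (rule softplus_bregman_taylor[of x t])
  fix z assume "softplus_bregman x t = dmu z * t\<^sup>2 / 2"
  moreover have "0 \<le> dmu z * t\<^sup>2 / 2" using dmu_pos[of z] by simp
  ultimately show ?thesis by simp
qed

text \<open>Both terms on the left are \<open>t\<^sup>2\<close> times a value of \<open>\<mu>'\<close> on the same interval.\<close>

lemma softplus_bregman_approx:
  assumes "\<bar>t\<bar> \<le> 1"
  shows "\<bar>2 * softplus_bregman x t - (mu (x + t) - mu x) * t\<bar> \<le> 2 * \<bar>t\<bar> * ((mu (x + t) - mu x) * t)"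
proof -
  obtain z where z: "\<bar>z - x\<bar> \<le> \<bar>t\<bar>" "\<bar>z - (x + t)\<bar> \<le> \<bar>t\<bar>" "softplus_bregman x t = dmu z * t\<^sup>2 / 2"
    by (rule softplus_bregman_taylor)
  obtain s where s: "\<bar>s - x\<bar> \<le> \<bar>t\<bar>" "\<bar>s - (x + t)\<bar> \<le> \<bar>t\<bar>" "mu (x + t) - mu x = dmu s * t"
    by (rule mu_mvt)
  have "\<bar>s - z\<bar> \<le> \<bar>t\<bar>" using z(1,2) s(1,2) by linarith
  hence "\<bar>dmu z - dmu s\<bar> \<le> 2 * \<bar>t\<bar> * dmu s" by (intro dmu_relative_lipschitz assms)
  hence "\<bar>(dmu z - dmu s) * t\<^sup>2\<bar> \<le> 2 * \<bar>t\<bar> * dmu s * t\<^sup>2"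
    unfolding abs_mult by (auto intro!: mult_right_mono)
  thus ?thesis unfolding s(3) z(3) by (simp add: power2_eq_square algebra_simps)
qed

section \<open>Sums over pairs of distinct nodes\<close>

abbreviation offdiag_sum :: "nat \<Rightarrow> (nat \<Rightarrow> nat \<Rightarrow> real) \<Rightarrow> real" where
  "offdiag_sum n F \<equiv> (\<Sum>j\<in>{1..n}. \<Sum>k\<in>{1..n} - {j}. F j k)"

lemma offdiag_sum_swap: "offdiag_sum n F = offdiag_sum n (\<lambda>j k. F k j)"
proof -
  have "offdiag_sum n F = (\<Sum>j\<in>{1..n}. \<Sum>k\<in>{k \<in> {1..n}. k \<noteq> j}. F j k)"
    by (intro sum.cong) auto
  also have "\<dots> = (\<Sum>k\<in>{1..n}. \<Sum>j\<in>{j \<in> {1..n}. k \<noteq> j}. F j k)"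
    by (rule sum.swap_restrict) auto
  also have "\<dots> = offdiag_sum n (\<lambda>j k. F k j)" by (intro sum.cong) auto
  finally show ?thesis .
qed

lemma finite_pairs [simp]: "finite (pairs n)"
  by (rule finite_subset[of _ "{1..n} \<times> {1..n}"]) (auto simp: pairs_def)

lemma offdiag_sum_pairs: "offdiag_sum n F = (\<Sum>(j, k)\<in>pairs n. F j k + F k j)"
proof -
  have "offdiag_sum n F = (\<Sum>(j, k)\<in>Sigma {1..n} (\<lambda>j. {1..n} - {j}). F j k)"
    by (rule sum.Sigma) auto
  also have "Sigma {1..n} (\<lambda>j. {1..n} - {j}) = pairs n \<union> prod.swap ` pairs n"
    by (auto simp: pairs_def image_iff)
  also have "(\<Sum>(j, k)\<in>pairs n \<union> prod.swap ` pairs n. F j k) =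
      (\<Sum>(j, k)\<in>pairs n. F j k) + (\<Sum>(j, k)\<in>prod.swap ` pairs n. F j k)"
    by (rule sum.union_disjoint) (simp, simp, auto simp: pairs_def)
  also have "(\<Sum>(j, k)\<in>prod.swap ` pairs n. F j k) = (\<Sum>(j, k)\<in>pairs n. F k j)"
    by (subst sum.reindex) (auto simp: case_prod_beta intro: inj_onI)
  finally show ?thesis by (simp add: sum.distrib case_prod_beta)
qed

lemma offdiag_sum_symmetric_weight:
  assumes "\<And>j k. f j k = f k j"
  shows "offdiag_sum n (\<lambda>j k. x j * f j k) = offdiag_sum n (\<lambda>j k. (x j + x k) * f j k) / 2"
proof -
  have "offdiag_sum n (\<lambda>j k. (x j + x k) * f j k) =
      offdiag_sum n (\<lambda>j k. x j * f j k) + offdiag_sum n (\<lambda>j k. x k * f j k)"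
    by (simp add: distrib_right sum.distrib)
  also have "offdiag_sum n (\<lambda>j k. x k * f j k) = offdiag_sum n (\<lambda>j k. x j * f j k)"
    by (subst offdiag_sum_swap) (simp add: assms)
  finally show ?thesis by simp
qed

lemma offdiag_sum_square_ge:
  "2 * (real n - 2) * (\<Sum>j=1..n. (x j)\<^sup>2) \<le> offdiag_sum n (\<lambda>j k. (x j + x k)\<^sup>2)"
proof -
  have "offdiag_sum n (\<lambda>j k. (x j + x k)\<^sup>2) = (\<Sum>j=1..n. (\<Sum>k=1..n. (x j + x k)\<^sup>2) - (x j + x j)\<^sup>2)"
    by (intro sum.cong refl) (simp add: sum_diff1)
  also have "\<dots> = (\<Sum>j=1..n. \<Sum>k=1..n. (x j)\<^sup>2 + (x k)\<^sup>2 + 2 * (x j * x k)) - 4 * (\<Sum>j=1..n. (x j)\<^sup>2)"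
    by (simp add: sum_subtractf sum_distrib_left power2_eq_square algebra_simps)
  also have "(\<Sum>j=1..n. \<Sum>k=1..n. (x j)\<^sup>2 + (x k)\<^sup>2 + 2 * (x j * x k)) =
      real (2 * n) * (\<Sum>j=1..n. (x j)\<^sup>2) + 2 * (\<Sum>j=1..n. x j)\<^sup>2"
    by (simp add: sum.distrib power2_eq_square sum_product flip: sum_distrib_left)
  finally show ?thesis by (simp add: algebra_simps)
qed

section \<open>Critical points of pairwise potentials\<close>

lemma interval_maximum_variational:
  fixes f :: "real \<Rightarrow> real"
  assumes deriv: "(f has_real_derivative D) (at x)" and x: "x \<in> {l..u}" and y: "y \<in> {l..u}"
    and max: "\<And>z. z \<in> {l..u} \<Longrightarrow> f z \<le> f x"
  shows "D * (y - x) \<le> 0"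
proof (rule ccontr)
  assume "\<not> D * (y - x) \<le> 0"
  moreover have "((\<lambda>s. f (x + s * (y - x))) has_real_derivative D * (y - x)) (at 0)"
    by (rule DERIV_chain2[of f]) (use deriv in \<open>auto intro!: derivative_eq_intros\<close>)
  ultimately obtain e where "e > 0" and inc: "\<And>h. 0 < h \<Longrightarrow> h < e \<Longrightarrow> f x < f (x + h * (y - x))"
    using DERIV_pos_inc_right[of "\<lambda>s. f (x + s * (y - x))" "D * (y - x)" 0] by auto
  define h where "h = min (e / 2) 1"
  have h: "0 < h" "h < e" "h \<le> 1" using \<open>e > 0\<close> by (auto simp: h_def)
  have "(1 - h) *\<^sub>R x + h *\<^sub>R y \<in> {l..u}"
    by (rule convexD_alt[OF convex_real_interval(5)]) (use x y h in auto)
  hence "x + h * (y - x) \<in> {l..u}" by (simp add: algebra_simps)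
  thus False using inc[OF h(1,2)] max by force
qed

text \<open>The coordinate \<open>p j\<close> is shared by all nodes \<open>j\<close> of a block; block \<open>0\<close> is held at \<open>0\<close>.\<close>

locale pair_potential =
  fixes n :: nat and a t G :: real and g :: "nat \<Rightarrow> real"
    and \<Phi> \<phi> :: "nat \<Rightarrow> nat \<Rightarrow> real \<Rightarrow> real" and p :: "nat \<Rightarrow> nat"
  assumes n_ge: "4 \<le> n" and a_pos: "0 < a" and t_pos: "0 < t"
    and potential_deriv: "\<And>j k y. (\<Phi> j k has_real_derivative \<phi> j k y) (at y)"
    and force_sym: "\<And>j k. \<phi> j k = \<phi> k j"
    and force_slope: "\<And>j k y. \<lbrakk>j \<in> {1..n}; k \<in> {1..n}; j \<noteq> k; \<bar>y\<bar> \<le> 2 * t\<rbrakk> \<Longrightarrow> \<exists>c\<ge>a. \<phi> j k y = c * y"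
    and load_le: "\<And>j. j \<in> {1..n} \<Longrightarrow> \<bar>g j\<bar> \<le> G"
    and box_large: "3 * G < a * (real n - 1) * t"
begin

definition objective :: "(nat \<Rightarrow> real) \<Rightarrow> real" where
  "objective x = (\<Sum>j\<in>{1..n}. g j * x (p j)) - offdiag_sum n (\<lambda>j k. \<Phi> j k (x (p j) + x (p k))) / 2"

definition residual :: "(nat \<Rightarrow> real) \<Rightarrow> nat \<Rightarrow> real" where
  "residual x j = g j - (\<Sum>k\<in>{1..n} - {j}. \<phi> j k (x (p j) + x (p k)))"

definition gradient :: "(nat \<Rightarrow> real) \<Rightarrow> nat \<Rightarrow> real" where
  "gradient x m = (\<Sum>j\<in>{j\<in>{1..n}. p j = m}. residual x j)"

definition coordinate_box :: "(nat \<Rightarrow> real) set" where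
  "coordinate_box = {x. x 0 = 0 \<and> (\<forall>m. \<bar>x m\<bar> \<le> t)}"

lemma compact_coordinate_box: "compact coordinate_box"
proof -
  let ?B = "\<lambda>m::nat. if m = 0 then {0} else {- t..t}"
  have "compactin (product_topology (\<lambda>i. euclidean) UNIV) (PiE UNIV ?B)"
    by (subst compactin_PiE) auto
  moreover have "PiE UNIV ?B = coordinate_box"
  proof (intro equalityI subsetI)
    fix x assume "x \<in> PiE UNIV ?B"
    hence coord: "x m \<in> ?B m" for m by (rule PiE_mem) simp
    have "\<bar>x m\<bar> \<le> t" for m using coord[of m] t_pos by (cases "m = 0") auto
    thus "x \<in> coordinate_box" using coord[of 0] by (simp add: coordinate_box_def)
  qed (auto simp: coordinate_box_def abs_le_iff minus_le_iff)
  ultimately show ?thesis by (simp add: euclidean_product_topology)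
qed

lemma objective_has_derivative:
  "((\<lambda>y. objective (x(m := y))) has_real_derivative gradient x m) (at (x m))"
proof -
  let ?e = "\<lambda>j. if p j = m then 1 else 0 :: real"
  let ?\<phi> = "\<lambda>j k. \<phi> j k (x (p j) + x (p k))"
  have coord: "((\<lambda>y. (x(m := y)) (p j)) has_real_derivative ?e j) (at (x m))" for j
    by (cases "p j = m") auto
  have "((\<lambda>y. \<Phi> j k ((x(m := y)) (p j) + (x(m := y)) (p k))) has_real_derivative
       ?\<phi> j k * (?e j + ?e k)) (at (x m))" for j k
    using DERIV_chain2[OF potential_deriv DERIV_add[OF coord[of j] coord[of k]]] by simp
  hence "((\<lambda>y. objective (x(m := y))) has_real_derivative (\<Sum>j\<in>{1..n}. g j * ?e j) -
       offdiag_sum n (\<lambda>j k. ?\<phi> j k * (?e j + ?e k)) / 2) (at (x m))"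
    unfolding objective_def by (intro DERIV_diff DERIV_sum DERIV_cmult DERIV_cdivide coord)
  also have "offdiag_sum n (\<lambda>j k. ?\<phi> j k * (?e j + ?e k)) / 2 = offdiag_sum n (\<lambda>j k. ?e j * ?\<phi> j k)"
    by (subst offdiag_sum_symmetric_weight) (simp_all only: force_sym add.commute mult.commute)
  also have "(\<Sum>j\<in>{1..n}. g j * ?e j) - \<dots> = (\<Sum>j\<in>{1..n}. ?e j * residual x j)"
    by (simp only: residual_def sum_subtractf right_diff_distrib sum_distrib_left mult.commute)
  also have "\<dots> = gradient x m"
    unfolding gradient_def by (subst sum.inter_filter) (auto intro!: sum.cong)
  finally show ?thesis .
qed

lemma box_maximizer:
  obtains x where "x \<in> coordinate_box" "\<And>m y. \<lbrakk>1 \<le> m; \<bar>y\<bar> \<le> t\<rbrakk> \<Longrightarrow> gradient x m * (y - x m) \<le> 0"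
proof -
  have coord: "continuous_on coordinate_box (\<lambda>x. x i)" for i
    by (rule continuous_on_subset[OF continuous_on_product_coordinates]) simp
  have "continuous_on UNIV (\<Phi> j k)" for j k
    by (auto intro!: continuous_at_imp_continuous_on DERIV_isCont[OF potential_deriv])
  hence "continuous_on coordinate_box (\<lambda>x. \<Phi> j k (x (p j) + x (p k)))" for j k
    by (rule continuous_on_compose2) (auto intro!: continuous_intros coord)
  hence "continuous_on coordinate_box objective"
    unfolding objective_def[abs_def] by (intro continuous_intros coord) auto
  moreover have "(\<lambda>_. 0) \<in> coordinate_box" unfolding coordinate_box_def using t_pos by simp
  ultimately obtain x where x: "x \<in> coordinate_box" and max: "\<And>y. y \<in> coordinate_box \<Longrightarrow> objective y \<le> objective x"
    using continuous_attains_sup[OF compact_coordinate_box, of objective] by blast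
  show thesis
  proof (rule that[OF x])
    fix m :: nat and y assume m: "1 \<le> m" and y: "\<bar>y\<bar> \<le> t"
    have "\<bar>x m\<bar> \<le> t" using x by (simp add: coordinate_box_def)
    moreover have "objective (x(m := z)) \<le> objective (x(m := x m))" if "z \<in> {- t..t}" for z
      using that x m by (auto intro!: max simp: coordinate_box_def)
    ultimately show "gradient x m * (y - x m) \<le> 0"
      using y by (intro interval_maximum_variational[OF objective_has_derivative, where l = "- t" and u = t])
        auto
  qed
qed

lemma force_coercive:
  assumes jk: "j \<in> {1..n}" "k \<in> {1..n} - {j}" and y: "\<bar>y\<bar> \<le> 2 * t" and u: "0 \<le> u * y"
  shows "a * (u * y) \<le> u * \<phi> j k y"
proof -
  have "k \<in> {1..n}" "j \<noteq> k" using jk by auto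
  then obtain c where "a \<le> c" "\<phi> j k y = c * y" using force_slope[OF jk(1) _ _ y] by auto
  thus ?thesis using mult_right_mono[OF _ u, of a c] by (simp add: mult_ac)
qed

lemma load_mult_le: "j \<in> {1..n} \<Longrightarrow> u * g j \<le> \<bar>u\<bar> * G"
  using abs_ge_self[of "u * g j"] mult_left_mono[OF load_le, of j "\<bar>u\<bar>"] by (simp add: abs_mult)

lemma energy_le_sum_abs:
  assumes x: "x \<in> coordinate_box" and grad: "\<And>m. 0 \<le> x m * gradient x m"
  shows "offdiag_sum n (\<lambda>j k. a * (x (p j) + x (p k))\<^sup>2) \<le> 2 * (\<Sum>j\<in>{1..n}. \<bar>x (p j)\<bar>) * G"
proof -
  define d where "d j = x (p j)" for j
  have coercive: "a * (d j + d k)\<^sup>2 \<le> (d j + d k) * \<phi> j k (d j + d k)"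
    if "j \<in> {1..n}" "k \<in> {1..n} - {j}" for j k
  proof -
    have "\<bar>d j\<bar> \<le> t" "\<bar>d k\<bar> \<le> t" using x by (simp_all add: d_def coordinate_box_def)
    thus ?thesis using force_coercive[OF that, of "d j + d k" "d j + d k"] by (simp add: power2_eq_square)
  qed
  have "0 \<le> (\<Sum>m\<in>p ` {1..n}. x m * gradient x m)" by (intro sum_nonneg grad)
  also have "\<dots> = (\<Sum>m\<in>p ` {1..n}. \<Sum>j\<in>{j\<in>{1..n}. p j = m}. d j * residual x j)"
    unfolding gradient_def sum_distrib_left by (intro sum.cong refl) (auto simp: d_def)
  also have "\<dots> = (\<Sum>j\<in>{1..n}. d j * residual x j)"
    by (rule sum.image_gen[symmetric]) simp
  also have "\<dots> = (\<Sum>j\<in>{1..n}. d j * g j) - offdiag_sum n (\<lambda>j k. d j * \<phi> j k (d j + d k))"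
    by (simp add: residual_def d_def right_diff_distrib sum_subtractf sum_distrib_left)
  also have "offdiag_sum n (\<lambda>j k. d j * \<phi> j k (d j + d k)) =
      offdiag_sum n (\<lambda>j k. (d j + d k) * \<phi> j k (d j + d k)) / 2"
    by (rule offdiag_sum_symmetric_weight) (simp add: force_sym add.commute)
  finally have "offdiag_sum n (\<lambda>j k. (d j + d k) * \<phi> j k (d j + d k)) \<le> 2 * (\<Sum>j\<in>{1..n}. d j * g j)" by simp
  also have "\<dots> \<le> 2 * (\<Sum>j\<in>{1..n}. \<bar>d j\<bar> * G)" by (intro mult_left_mono sum_mono load_mult_le) auto
  finally have "offdiag_sum n (\<lambda>j k. (d j + d k) * \<phi> j k (d j + d k)) \<le> 2 * (\<Sum>j\<in>{1..n}. \<bar>d j\<bar>) * G"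
    by (simp add: sum_distrib_right mult.assoc)
  moreover have "offdiag_sum n (\<lambda>j k. a * (d j + d k)\<^sup>2) \<le>
      offdiag_sum n (\<lambda>j k. (d j + d k) * \<phi> j k (d j + d k))"
    by (intro sum_mono coercive)
  ultimately show ?thesis by (simp add: d_def)
qed

lemma sum_abs_le:
  assumes x: "x \<in> coordinate_box" and grad: "\<And>m. 0 \<le> x m * gradient x m"
  shows "a * (\<Sum>j\<in>{1..n}. \<bar>x (p j)\<bar>) \<le> 2 * G"
proof -
  define N1 N2 where "N1 = (\<Sum>j\<in>{1..n}. \<bar>x (p j)\<bar>)" and "N2 = (\<Sum>j\<in>{1..n}. (x (p j))\<^sup>2)"
  have N1: "0 \<le> N1" and G: "0 \<le> G" using load_le[of 1] n_ge by (auto simp: N1_def sum_nonneg)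
  have "a * (2 * (real n - 2) * N2) \<le> a * offdiag_sum n (\<lambda>j k. (x (p j) + x (p k))\<^sup>2)"
    unfolding N2_def using a_pos by (intro mult_left_mono offdiag_sum_square_ge) auto
  also have "\<dots> = offdiag_sum n (\<lambda>j k. a * (x (p j) + x (p k))\<^sup>2)" by (simp add: sum_distrib_left)
  also have "\<dots> \<le> 2 * N1 * G" unfolding N1_def by (rule energy_le_sum_abs[OF x grad])
  finally have quadratic: "a * ((real n - 2) * N2) \<le> N1 * G" by (simp add: algebra_simps)
  have "N1\<^sup>2 \<le> real n * N2"
    using Cauchy_Schwarz_ineq_sum[of "\<lambda>j. \<bar>x (p j)\<bar>" "\<lambda>_. 1" "{1..n}"]
    by (simp add: N1_def N2_def mult.commute)
  also have "\<dots> \<le> 2 * (real n - 2) * N2"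
    using n_ge by (intro mult_right_mono) (auto simp: N2_def sum_nonneg)
  finally have "a * N1\<^sup>2 \<le> a * (2 * (real n - 2) * N2)" using a_pos by (intro mult_left_mono) auto
  also have "\<dots> = 2 * (a * ((real n - 2) * N2))" by simp
  also have "\<dots> \<le> 2 * (N1 * G)" using quadratic by simp
  finally have "(a * N1) * N1 \<le> (2 * G) * N1" by (simp add: power2_eq_square mult_ac)
  thus ?thesis using N1 G unfolding N1_def[symmetric] by (cases "N1 = 0") auto
qed

lemma residual_opposes_active_constraint:
  assumes x: "x \<in> coordinate_box" and l1: "a * (\<Sum>j\<in>{1..n}. \<bar>x (p j)\<bar>) \<le> 2 * G"
    and j: "j \<in> {1..n}" "\<bar>x (p j)\<bar> = t"
  shows "x (p j) * residual x j < 0"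
proof -
  define d where "d j = x (p j)" for j
  have d: "\<bar>d k\<bar> \<le> t" for k using x by (simp add: d_def coordinate_box_def)
  have dj: "\<bar>d j\<bar> = t" using j by (simp add: d_def)
  have force: "a * (t\<^sup>2 - t * \<bar>d k\<bar>) \<le> d j * \<phi> j k (d j + d k)" if k: "k \<in> {1..n} - {j}" for k
  proof -
    have "- (d j * d k) \<le> t * \<bar>d k\<bar>" using abs_ge_minus_self[of "d j * d k"] by (simp add: abs_mult dj)
    moreover have "(d j)\<^sup>2 = t\<^sup>2" using dj by (metis power2_abs)
    ultimately have inner: "t\<^sup>2 - t * \<bar>d k\<bar> \<le> d j * (d j + d k)" by (simp add: power2_eq_square algebra_simps)
    have "0 \<le> t\<^sup>2 - t * \<bar>d k\<bar>" using d[of k] t_pos by (simp add: power2_eq_square mult_left_mono)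
    moreover have "\<bar>d j + d k\<bar> \<le> 2 * t" using d[of j] d[of k] by linarith
    ultimately show ?thesis
      using force_coercive[OF j(1) k, of "d j + d k" "d j"] mult_left_mono[OF inner, of a] inner a_pos
      by linarith
  qed
  have "(\<Sum>k\<in>{1..n} - {j}. \<bar>d k\<bar>) \<le> (\<Sum>k\<in>{1..n}. \<bar>d k\<bar>)" by (intro sum_mono2) auto
  hence "a * t * (\<Sum>k\<in>{1..n} - {j}. \<bar>d k\<bar>) \<le> t * (a * (\<Sum>k\<in>{1..n}. \<bar>d k\<bar>))"
    using a_pos t_pos by (simp add: mult_ac mult_left_mono)
  also have "\<dots> \<le> t * (2 * G)" using l1 t_pos by (intro mult_left_mono) (auto simp: d_def)
  finally have rest: "a * t * (\<Sum>k\<in>{1..n} - {j}. \<bar>d k\<bar>) \<le> t * (2 * G)" .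
  have load: "d j * g j \<le> t * G" using load_mult_le[OF j(1), of "d j"] dj by simp
  have "d j * residual x j = d j * g j - (\<Sum>k\<in>{1..n} - {j}. d j * \<phi> j k (d j + d k))"
    by (simp add: residual_def d_def right_diff_distrib sum_distrib_left)
  also have "\<dots> \<le> t * G - (\<Sum>k\<in>{1..n} - {j}. a * (t\<^sup>2 - t * \<bar>d k\<bar>))"
    by (intro diff_mono load sum_mono force)
  also have "(\<Sum>k\<in>{1..n} - {j}. a * (t\<^sup>2 - t * \<bar>d k\<bar>)) =
      a * (real n - 1) * t\<^sup>2 - a * t * (\<Sum>k\<in>{1..n} - {j}. \<bar>d k\<bar>)"
    using j n_ge by (simp add: sum_subtractf of_nat_diff algebra_simps flip: sum_distrib_left)
  also have "t * G - \<dots> \<le> t * (3 * G - a * (real n - 1) * t)"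
    using rest by (simp add: power2_eq_square algebra_simps)
  also have "\<dots> < 0" using t_pos box_large by (simp add: mult_pos_neg)
  finally show ?thesis by (simp add: d_def)
qed

theorem critical_point_exists:
  obtains x where "x \<in> coordinate_box" "\<And>m. 1 \<le> m \<Longrightarrow> gradient x m = 0"
proof -
  obtain x where x: "x \<in> coordinate_box"
    and grad: "\<And>m y. \<lbrakk>1 \<le> m; \<bar>y\<bar> \<le> t\<rbrakk> \<Longrightarrow> gradient x m * (y - x m) \<le> 0"
    using box_maximizer by blast
  have outward: "0 \<le> x m * gradient x m" for m
  proof (cases "m = 0")
    case False
    thus ?thesis using grad[of m 0] t_pos by (simp add: mult.commute)
  qed (use x in \<open>simp add: coordinate_box_def\<close>)
  note l1 = sum_abs_le[OF x outward]
  have "gradient x m = 0" if m: "1 \<le> m" for m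
  proof (cases "{j\<in>{1..n}. p j = m} = {}")
    case False
    have "\<bar>x m\<bar> \<noteq> t"
    proof
      assume "\<bar>x m\<bar> = t"
      hence "(\<Sum>j\<in>{j\<in>{1..n}. p j = m}. x m * residual x j) < (\<Sum>j\<in>{j\<in>{1..n}. p j = m}. 0)"
        using False residual_opposes_active_constraint[OF x l1] by (intro sum_strict_mono) auto
      thus False using outward[of m] by (simp add: gradient_def sum_distrib_left)
    qed
    hence "\<bar>x m\<bar> < t" using x by (simp add: coordinate_box_def order_less_le)
    hence "0 < t - x m" "- t - x m < 0" by auto
    moreover have "gradient x m * (t - x m) \<le> 0" "gradient x m * (- t - x m) \<le> 0"
      using m t_pos by (intro grad; simp)+
    ultimately show ?thesis by (simp add: mult_le_0_iff)
  qed (simp only: gradient_def sum.empty)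
  thus thesis using x by (rule that[rotated])
qed

end

section \<open>The score and the likelihood\<close>

definition score :: "nat \<Rightarrow> (nat \<times> nat \<Rightarrow> bool) \<Rightarrow> (nat \<Rightarrow> real) \<Rightarrow> nat \<Rightarrow> real" where
  "score n A \<gamma> j = deg n A j - (\<Sum>k\<in>{1..n} - {j}. mu (\<gamma> j + \<gamma> k))"

lemma score_shift:
  "score n A (\<lambda>j. \<beta> j + d j) j =
     score n A \<beta> j - (\<Sum>k\<in>{1..n} - {j}. mu (\<beta> j + \<beta> k + (d j + d k)) - mu (\<beta> j + \<beta> k))"
  unfolding score_def by (simp add: sum_subtractf add_ac)

lemma loglik_offdiag:
  "loglik n A \<gamma> = (\<Sum>j\<in>{1..n}. \<gamma> j * deg n A j) - offdiag_sum n (\<lambda>j k. softplus (\<gamma> j + \<gamma> k)) / 2"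
proof -
  have "offdiag_sum n (\<lambda>j k. softplus (\<gamma> j + \<gamma> k)) = (\<Sum>(j, k)\<in>pairs n. 2 * softplus (\<gamma> j + \<gamma> k))"
    unfolding offdiag_sum_pairs by (intro sum.cong) (auto simp: add.commute)
  thus ?thesis unfolding loglik_def by (simp add: case_prod_beta flip: sum_distrib_left)
qed

lemma sum_mult_score:
  "(\<Sum>j\<in>{1..n}. h j * score n A \<gamma> j) =
     (\<Sum>j\<in>{1..n}. h j * deg n A j) - offdiag_sum n (\<lambda>j k. (h j + h k) * mu (\<gamma> j + \<gamma> k)) / 2"
proof -
  have "(\<Sum>j\<in>{1..n}. h j * score n A \<gamma> j) =
     (\<Sum>j\<in>{1..n}. h j * deg n A j) - offdiag_sum n (\<lambda>j k. h j * mu (\<gamma> j + \<gamma> k))"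
    unfolding score_def by (simp add: right_diff_distrib sum_subtractf sum_distrib_left)
  also have "offdiag_sum n (\<lambda>j k. h j * mu (\<gamma> j + \<gamma> k)) =
      offdiag_sum n (\<lambda>j k. (h j + h k) * mu (\<gamma> j + \<gamma> k)) / 2"
    by (rule offdiag_sum_symmetric_weight) (simp add: add.commute)
  finally show ?thesis .
qed

lemma loglik_diff_bregman:
  "loglik n A (\<lambda>j. \<gamma> j + h j) - loglik n A \<gamma> = (\<Sum>j\<in>{1..n}. h j * score n A (\<lambda>j. \<gamma> j + h j) j)
     + offdiag_sum n (\<lambda>j k. softplus_bregman (\<gamma> j + \<gamma> k) (h j + h k)) / 2"
proof -
  have shift: "(\<gamma> j + h j) + (\<gamma> k + h k) = (\<gamma> j + \<gamma> k) + (h j + h k)" for j k by simp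
  have "(\<Sum>j\<in>{1..n}. (\<gamma> j + h j) * deg n A j) = (\<Sum>j\<in>{1..n}. \<gamma> j * deg n A j) + (\<Sum>j\<in>{1..n}. h j * deg n A j)"
    by (simp add: distrib_right sum.distrib)
  thus ?thesis
    unfolding loglik_offdiag sum_mult_score softplus_bregman_def shift
    by (simp add: sum.distrib sum_subtractf mult.commute diff_divide_distrib add_divide_distrib)
qed

lemma sum_mult_score_diff:
  "(\<Sum>j\<in>{1..n}. h j * score n A \<gamma> j) - (\<Sum>j\<in>{1..n}. h j * score n A (\<lambda>j. \<gamma> j + h j) j) =
     offdiag_sum n (\<lambda>j k. (mu (\<gamma> j + \<gamma> k + (h j + h k)) - mu (\<gamma> j + \<gamma> k)) * (h j + h k)) / 2"
proof -
  have shift: "(\<gamma> j + h j) + (\<gamma> k + h k) = (\<gamma> j + \<gamma> k) + (h j + h k)" for j k by simp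
  show ?thesis
    unfolding sum_mult_score shift
    by (simp add: left_diff_distrib sum_subtractf mult.commute[of "mu _"] diff_divide_distrib)
qed

lemma loglik_le_tangent:
  "loglik n A \<gamma>' \<le> loglik n A \<gamma> + (\<Sum>j\<in>{1..n}. (\<gamma>' j - \<gamma> j) * score n A \<gamma> j)"
proof -
  have "0 \<le> offdiag_sum n (\<lambda>j k. softplus_bregman (\<gamma>' j + \<gamma>' k) ((\<gamma> j - \<gamma>' j) + (\<gamma> k - \<gamma>' k)))"
    by (intro sum_nonneg softplus_bregman_nonneg)
  hence "loglik n A \<gamma>' \<le> loglik n A \<gamma> - (\<Sum>j\<in>{1..n}. (\<gamma> j - \<gamma>' j) * score n A \<gamma> j)"
    using loglik_diff_bregman[of n A \<gamma>' "\<lambda>j. \<gamma> j - \<gamma>' j"] by simp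
  also have "\<dots> = loglik n A \<gamma> + (\<Sum>j\<in>{1..n}. (\<gamma>' j - \<gamma> j) * score n A \<gamma> j)"
    by (simp add: left_diff_distrib sum_subtractf)
  finally show ?thesis .
qed

lemma critical_point_maximizes:
  assumes "\<gamma> \<in> S" "\<And>\<gamma>'. \<gamma>' \<in> S \<Longrightarrow> (\<Sum>j\<in>{1..n}. (\<gamma>' j - \<gamma> j) * score n A \<gamma> j) = 0"
  shows "has_max (loglik n A) S" "Sup (loglik n A ` S) = loglik n A \<gamma>"
proof -
  have le: "loglik n A \<gamma>' \<le> loglik n A \<gamma>" if "\<gamma>' \<in> S" for \<gamma>'
    using loglik_le_tangent[of n A \<gamma>' \<gamma>] assms(2)[OF that] by simp
  show "has_max (loglik n A) S" unfolding has_max_def using le assms(1) by blast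
  show "Sup (loglik n A ` S) = loglik n A \<gamma>"
    by (rule cSup_eq_maximum) (use le assms(1) in auto)
qed

lemma twice_loglik_diff_approx:
  assumes crit: "(\<Sum>j\<in>{1..n}. h j * score n A (\<lambda>j. \<gamma> j + h j) j) = 0"
    and h: "\<And>j. j \<in> {1..n} \<Longrightarrow> \<bar>h j\<bar> \<le> e" and e: "e \<le> 1 / 2"
  shows "\<bar>2 * (loglik n A (\<lambda>j. \<gamma> j + h j) - loglik n A \<gamma>) - (\<Sum>j\<in>{1..n}. h j * score n A \<gamma> j)\<bar>
     \<le> 4 * e * (\<Sum>j\<in>{1..n}. h j * score n A \<gamma> j)"
proof -
  define D where "D j k = softplus_bregman (\<gamma> j + \<gamma> k) (h j + h k)" for j k
  define E where "E j k = (mu (\<gamma> j + \<gamma> k + (h j + h k)) - mu (\<gamma> j + \<gamma> k)) * (h j + h k)" for j k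
  define S where "S = (\<Sum>j\<in>{1..n}. h j * score n A \<gamma> j)"
  have gap: "2 * (loglik n A (\<lambda>j. \<gamma> j + h j) - loglik n A \<gamma>) = offdiag_sum n D"
    unfolding loglik_diff_bregman crit D_def by simp
  have S: "S = offdiag_sum n E / 2"
    using sum_mult_score_diff[of h n A \<gamma>] unfolding crit S_def E_def by simp
  have pointwise: "\<bar>D j k - E j k / 2\<bar> \<le> 2 * e * E j k" if jk: "j \<in> {1..n}" "k \<in> {1..n} - {j}" for j k
  proof -
    have t: "\<bar>h j + h k\<bar> \<le> 2 * e" using h[of j] h[of k] jk by force
    have "\<bar>2 * D j k - E j k\<bar> \<le> 2 * \<bar>h j + h k\<bar> * E j k"
      unfolding D_def E_def by (rule softplus_bregman_approx) (use t e in linarith)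
    also have "\<dots> \<le> 2 * (2 * e) * E j k"
      using t unfolding E_def by (intro mult_right_mono mu_diff_mult_nonneg) auto
    finally show ?thesis by (simp add: abs_le_iff)
  qed
  have "\<bar>offdiag_sum n D - S\<bar> = \<bar>offdiag_sum n (\<lambda>j k. D j k - E j k / 2)\<bar>"
    unfolding S by (simp add: sum_subtractf sum_divide_distrib)
  also have "\<dots> \<le> offdiag_sum n (\<lambda>j k. \<bar>D j k - E j k / 2\<bar>)"
    by (rule order_trans[OF sum_abs]) (intro sum_mono sum_abs)
  also have "\<dots> \<le> offdiag_sum n (\<lambda>j k. 2 * e * E j k)" by (intro sum_mono pointwise)
  also have "\<dots> = 4 * e * S" unfolding S by (simp flip: sum_distrib_left)
  finally show ?thesis unfolding gap S_def .
qed

locale curvature_bound =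
  fixes n :: nat and \<beta> :: "nat \<Rightarrow> real" and b :: real
  assumes n_ge: "4 \<le> n" and b_ge: "4 \<le> b"
    and dmu_ge: "\<And>j k. \<lbrakk>j \<in> {1..n}; k \<in> {1..n}; j \<noteq> k\<rbrakk> \<Longrightarrow> 1 / b \<le> dmu (\<beta> j + \<beta> k)"

lemma (in curvature_bound) pair_potential_loglik:
  assumes t: "0 < t" "t \<le> 1 / 4"
    and score_le: "\<And>j. j \<in> {1..n} \<Longrightarrow> \<bar>score n A \<beta> j\<bar> \<le> G"
    and large: "6 * b * G < (real n - 1) * t"
  shows "pair_potential n (1 / (2 * b)) t G (score n A \<beta>)
    (\<lambda>j k y. softplus (\<beta> j + \<beta> k + y) - mu (\<beta> j + \<beta> k) * y)
    (\<lambda>j k y. mu (\<beta> j + \<beta> k + y) - mu (\<beta> j + \<beta> k))"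
proof
  show "((\<lambda>y. softplus (\<beta> j + \<beta> k + y) - mu (\<beta> j + \<beta> k) * y) has_real_derivative
      mu (\<beta> j + \<beta> k + y) - mu (\<beta> j + \<beta> k)) (at y)" for j k y
    by (auto intro!: derivative_eq_intros simp: mu_def)
  show "\<exists>c\<ge>1 / (2 * b). mu (\<beta> j + \<beta> k + y) - mu (\<beta> j + \<beta> k) = c * y"
    if "j \<in> {1..n}" "k \<in> {1..n}" "j \<noteq> k" "\<bar>y\<bar> \<le> 2 * t" for j k y
  proof -
    have "\<bar>y\<bar> \<le> 1 / 2" using that t by linarith
    then obtain c where "dmu (\<beta> j + \<beta> k) / 2 \<le> c" "mu (\<beta> j + \<beta> k + y) - mu (\<beta> j + \<beta> k) = c * y"
      using mu_secant_slope_ge by blast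
    moreover have "1 / (2 * b) \<le> dmu (\<beta> j + \<beta> k) / 2" using dmu_ge[OF that(1-3)] by simp
    ultimately show ?thesis by (intro exI[of _ c]) auto
  qed
  show "3 * G < 1 / (2 * b) * (real n - 1) * t" using large b_ge by (simp add: field_simps)
qed (use n_ge b_ge t score_le in \<open>auto simp: add.commute\<close>)

text \<open>With \<open>r = 0\<close> this is the unrestricted likelihood equation.\<close>

lemma (in curvature_bound) block_critical_point:
  fixes r :: nat and frozen :: bool
  assumes t: "0 < t" "t \<le> 1 / 4"
    and score_le: "\<And>j. j \<in> {1..n} \<Longrightarrow> \<bar>score n A \<beta> j\<bar> \<le> G"
    and large: "6 * b * G < (real n - 1) * t"
  obtains c \<kappa> where "\<And>j. \<bar>c j\<bar> \<le> t" "\<And>i. i \<in> {1..r} \<Longrightarrow> c i = \<kappa>"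
    "\<And>j. j \<in> {r+1..n} \<Longrightarrow> score n A (\<lambda>j. \<beta> j + c j) j = 0"
    "frozen \<Longrightarrow> \<kappa> = 0"
    "\<lbrakk>\<not> frozen; 1 \<le> r; r \<le> n\<rbrakk> \<Longrightarrow> (\<Sum>i\<in>{1..r}. score n A (\<lambda>j. \<beta> j + c j) i) = 0"
proof -
  define p where "p j = (if j \<le> r then of_bool (\<not> frozen) else j)" for j :: nat
  interpret pair_potential n "1 / (2 * b)" t G "score n A \<beta>"
    "\<lambda>j k y. softplus (\<beta> j + \<beta> k + y) - mu (\<beta> j + \<beta> k) * y"
    "\<lambda>j k y. mu (\<beta> j + \<beta> k + y) - mu (\<beta> j + \<beta> k)" p
    by (rule pair_potential_loglik) (use t score_le large in auto)
  obtain x where x: "x \<in> coordinate_box" and grad: "\<And>m. 1 \<le> m \<Longrightarrow> gradient x m = 0"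
    using critical_point_exists by blast
  have residual: "residual x j = score n A (\<lambda>j. \<beta> j + x (p j)) j" for j
    by (simp add: residual_def score_shift)
  show thesis
  proof (rule that[of "\<lambda>j. x (p j)" "x (of_bool (\<not> frozen))"])
    show "\<bar>x (p j)\<bar> \<le> t" for j using x by (simp add: coordinate_box_def)
    show "x (p i) = x (of_bool (\<not> frozen))" if "i \<in> {1..r}" for i using that by (simp add: p_def)
    show "score n A (\<lambda>j. \<beta> j + x (p j)) j = 0" if j: "j \<in> {r+1..n}" for j
    proof -
      have "{j'\<in>{1..n}. p j' = j} = {j}" using j by (auto simp: p_def split: if_splits)
      thus ?thesis using grad[of j] j by (simp add: gradient_def residual)
    qed
    show "x (of_bool (\<not> frozen)) = 0" if frozen using x that by (simp add: coordinate_box_def)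
    show "(\<Sum>i\<in>{1..r}. score n A (\<lambda>j. \<beta> j + x (p j)) i) = 0" if "\<not> frozen" "1 \<le> r" "r \<le> n"
    proof -
      have "{j\<in>{1..n}. p j = 1} = {1..r}" using that by (auto simp: p_def split: if_splits)
      thus ?thesis using grad[of 1] by (simp add: gradient_def residual del: One_nat_def)
    qed
  qed
qed

section \<open>Expansion of the score at a critical point\<close>

definition fisher :: "nat \<Rightarrow> (nat \<Rightarrow> real) \<Rightarrow> (nat \<Rightarrow> real) \<Rightarrow> nat \<Rightarrow> real" where
  "fisher n \<beta> x j = (\<Sum>k\<in>{1..n} - {j}. dmu (\<beta> j + \<beta> k) * (x j + x k))"

lemma fisher_self_adjoint:
  "(\<Sum>j\<in>{1..n}. w j * fisher n \<beta> d j) = (\<Sum>j\<in>{1..n}. d j * fisher n \<beta> w j)"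
proof -
  have pairing: "(\<Sum>j\<in>{1..n}. x j * fisher n \<beta> y j) =
      offdiag_sum n (\<lambda>j k. (x j + x k) * (dmu (\<beta> j + \<beta> k) * (y j + y k))) / 2" for x y
    unfolding fisher_def sum_distrib_left
    by (rule offdiag_sum_symmetric_weight) (simp add: add.commute)
  show ?thesis unfolding pairing by (simp add: mult_ac)
qed

text \<open>\<open>V w\<close> is the \<open>i\<close>-th row of the Fisher information \<open>V\<close> without its diagonal entry.\<close>

definition nuisance_weights :: "nat \<Rightarrow> (nat \<Rightarrow> real) \<Rightarrow> nat \<Rightarrow> (nat \<Rightarrow> real) \<Rightarrow> bool" where
  "nuisance_weights n \<beta> i w \<longleftrightarrow> (\<forall>j\<in>{1..n}. fisher n \<beta> w j = (if j = i then 0 else dmu (\<beta> i + \<beta> j)))"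

lemma (in curvature_bound) nuisance_weights_exist:
  assumes i: "i \<in> {1..n}"
  shows "\<exists>w. nuisance_weights n \<beta> i w \<and> (\<forall>j. \<bar>w j\<bar> \<le> 2 * b / real n)"
proof -
  interpret pair_potential n "1 / b" "2 * b / real n" "1 / 4" "\<lambda>j. if j = i then 0 else dmu (\<beta> i + \<beta> j)"
    "\<lambda>j k y. dmu (\<beta> j + \<beta> k) * y\<^sup>2 / 2" "\<lambda>j k y. dmu (\<beta> j + \<beta> k) * y" id
  proof
    show "((\<lambda>y. dmu (\<beta> j + \<beta> k) * y\<^sup>2 / 2) has_real_derivative dmu (\<beta> j + \<beta> k) * y) (at y)"
      for j k y
      by (auto intro!: derivative_eq_intros)
    show "3 * (1 / 4) < 1 / b * (real n - 1) * (2 * b / real n)"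
      using n_ge b_ge by (simp add: field_simps)
    show "\<bar>if j = i then 0 else dmu (\<beta> i + \<beta> j)\<bar> \<le> 1 / 4" for j
      using dmu_le_quarter[of "\<beta> i + \<beta> j"] dmu_pos[of "\<beta> i + \<beta> j"] by auto
  qed (use n_ge b_ge dmu_ge in \<open>auto simp: add.commute\<close>)
  obtain w where w: "w \<in> coordinate_box" and grad: "\<And>m. 1 \<le> m \<Longrightarrow> gradient w m = 0"
    using critical_point_exists by blast
  have "fisher n \<beta> w j = (if j = i then 0 else dmu (\<beta> i + \<beta> j))" if j: "j \<in> {1..n}" for j
  proof -
    have "{j'\<in>{1..n}. id j' = j} = {j}" using j by auto
    thus ?thesis using grad[of j] j by (simp add: gradient_def residual_def fisher_def)
  qed
  hence "nuisance_weights n \<beta> i w" by (simp add: nuisance_weights_def)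
  thus ?thesis using w by (auto simp: coordinate_box_def)
qed

lemma sum_nuisance_weights_fisher:
  assumes "nuisance_weights n \<beta> i w" "i \<in> {1..n}"
  shows "(\<Sum>j\<in>{1..n}. w j * fisher n \<beta> d j) = (\<Sum>k\<in>{1..n} - {i}. dmu (\<beta> i + \<beta> k) * d k)"
proof -
  have "(\<Sum>j\<in>{1..n}. w j * fisher n \<beta> d j) = (\<Sum>j\<in>{1..n}. d j * (if j = i then 0 else dmu (\<beta> i + \<beta> j)))"
    unfolding fisher_self_adjoint[of w] using assms(1) by (intro sum.cong) (auto simp: nuisance_weights_def)
  also have "\<dots> = (\<Sum>k\<in>{1..n} - {i}. dmu (\<beta> i + \<beta> k) * d k)"
    using assms(2) by (subst sum.remove[of _ i]) (auto intro!: sum.cong)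
  finally show ?thesis .
qed

lemma abs_sum_others_le:
  fixes f :: "nat \<Rightarrow> real"
  assumes "\<And>k. k \<in> {1..n} - {j} \<Longrightarrow> \<bar>f k\<bar> \<le> K" "0 \<le> K"
  shows "\<bar>\<Sum>k\<in>{1..n} - {j}. f k\<bar> \<le> real n * K"
proof -
  have "\<bar>\<Sum>k\<in>{1..n} - {j}. f k\<bar> \<le> real (card ({1..n} - {j})) * K"
    using sum_norm_bound[of "{1..n} - {j}" f K] assms(1) by simp
  also have "\<dots> \<le> real n * K"
    using card_mono[of "{1..n}" "{1..n} - {j}"] assms(2) by (intro mult_right_mono) auto
  finally show ?thesis .
qed

lemma score_lipschitz:
  assumes d: "\<And>k. k \<in> {1..n} \<Longrightarrow> \<bar>d k\<bar> \<le> t" and j: "j \<in> {1..n}"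
  shows "\<bar>score n A (\<lambda>j. \<beta> j + d j) j - score n A \<beta> j\<bar> \<le> real n * (2 * t)"
proof -
  have "\<bar>mu (\<beta> j + \<beta> k + (d j + d k)) - mu (\<beta> j + \<beta> k)\<bar> \<le> 2 * t" if "k \<in> {1..n} - {j}" for k
    using mu_lipschitz[of "\<beta> j + \<beta> k" "d j + d k"] d[of k] d[OF j] that by force
  moreover have "0 \<le> t" using d[OF j] by linarith
  ultimately have "\<bar>\<Sum>k\<in>{1..n} - {j}. mu (\<beta> j + \<beta> k + (d j + d k)) - mu (\<beta> j + \<beta> k)\<bar> \<le> real n * (2 * t)"
    by (intro abs_sum_others_le) auto
  thus ?thesis unfolding score_shift by simp
qed

lemma score_linearization:
  assumes d: "\<And>k. k \<in> {1..n} \<Longrightarrow> \<bar>d k\<bar> \<le> t" and t: "t \<le> 1 / 2" and j: "j \<in> {1..n}"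
  shows "\<bar>score n A (\<lambda>j. \<beta> j + d j) j - (score n A \<beta> j - fisher n \<beta> d j)\<bar> \<le> real n * (2 * t)\<^sup>2"
proof -
  have "\<bar>mu (\<beta> j + \<beta> k + (d j + d k)) - mu (\<beta> j + \<beta> k) - dmu (\<beta> j + \<beta> k) * (d j + d k)\<bar> \<le> (2 * t)\<^sup>2"
    if "k \<in> {1..n} - {j}" for k
  proof -
    have dd: "\<bar>d j + d k\<bar> \<le> 2 * t" using d[of k] d[OF j] that by force
    hence "(d j + d k)\<^sup>2 \<le> (2 * t)\<^sup>2" using power_mono[OF dd, of 2] by simp
    thus ?thesis using mu_taylor_bound[of "d j + d k" "\<beta> j + \<beta> k"] dd t by linarith
  qed
  hence "\<bar>\<Sum>k\<in>{1..n} - {j}. mu (\<beta> j + \<beta> k + (d j + d k)) - mu (\<beta> j + \<beta> k) - dmu (\<beta> j + \<beta> k) * (d j + d k)\<bar>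
      \<le> real n * (2 * t)\<^sup>2"
    by (intro abs_sum_others_le) auto
  thus ?thesis unfolding score_shift fisher_def by (simp add: sum_subtractf)
qed

text \<open>A coordinatewise estimate of the nuisance sum is of the same order as the leading term of the
  score. Pairing the score equations with the weights \<open>w\<close> turns it into weighted noise, which is smaller.\<close>

lemma nuisance_sum_le:
  assumes i: "i \<in> {1..n}" and r: "r \<le> n"
    and w: "nuisance_weights n \<beta> i w" "\<And>j. j \<in> {1..n} \<Longrightarrow> \<bar>w j\<bar> \<le> W"
    and score_le: "\<And>j. j \<in> {1..n} \<Longrightarrow> \<bar>score n A \<beta> j\<bar> \<le> G"
    and weighted_score_le: "\<bar>\<Sum>j\<in>{1..n}. w j * score n A \<beta> j\<bar> \<le> B"
    and d: "\<And>j. j \<in> {1..n} \<Longrightarrow> \<bar>d j\<bar> \<le> t" and t: "t \<le> 1 / 2"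
    and critical: "\<And>j. j \<in> {r+1..n} \<Longrightarrow> score n A (\<lambda>j. \<beta> j + d j) j = 0"
  shows "\<bar>\<Sum>k\<in>{1..n} - {i}. dmu (\<beta> i + \<beta> k) * d k\<bar>
     \<le> B + real n * (W * (real n * (2 * t)\<^sup>2)) + real r * (W * (G + real n * (2 * t)))"
proof -
  define g where "g = score n A \<beta>"
  define s where "s = score n A (\<lambda>j. \<beta> j + d j)"
  define \<rho> where "\<rho> j = s j - (g j - fisher n \<beta> d j)" for j
  have W: "0 \<le> W" using w(2)[OF i] by linarith
  have "(\<Sum>j\<in>{1..n}. w j * s j) = (\<Sum>j\<in>{1..r}. w j * s j)"
    using r critical by (intro sum.mono_neutral_right) (auto simp: s_def)
  moreover have "\<bar>w j * s j\<bar> \<le> W * (G + real n * (2 * t))" if "j \<in> {1..r}" for j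
  proof -
    have "j \<in> {1..n}" using that r by auto
    thus ?thesis
      using w(2)[of j] score_lipschitz[of n d t j A \<beta>, OF d] score_le[of j] W
      unfolding abs_mult s_def by (intro mult_mono) auto
  qed
  ultimately have tested: "\<bar>\<Sum>j\<in>{1..n}. w j * s j\<bar> \<le> real r * (W * (G + real n * (2 * t)))"
    using sum_norm_bound[of "{1..r}" "\<lambda>j. w j * s j"] by simp
  have "\<bar>w j * \<rho> j\<bar> \<le> W * (real n * (2 * t)\<^sup>2)" if "j \<in> {1..n}" for j
    unfolding abs_mult \<rho>_def s_def g_def
    using w(2)[OF that] score_linearization[of n d t j A \<beta>, OF d t that] W by (intro mult_mono) auto
  hence remainder: "\<bar>\<Sum>j\<in>{1..n}. w j * \<rho> j\<bar> \<le> real n * (W * (real n * (2 * t)\<^sup>2))"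
    using sum_norm_bound[of "{1..n}" "\<lambda>j. w j * \<rho> j"] by simp
  have "(\<Sum>k\<in>{1..n} - {i}. dmu (\<beta> i + \<beta> k) * d k) = (\<Sum>j\<in>{1..n}. w j * fisher n \<beta> d j)"
    by (rule sum_nuisance_weights_fisher[OF w(1) i, symmetric])
  also have "\<dots> = (\<Sum>j\<in>{1..n}. w j * g j) + (\<Sum>j\<in>{1..n}. w j * \<rho> j) - (\<Sum>j\<in>{1..n}. w j * s j)"
    by (simp add: \<rho>_def algebra_simps sum.distrib sum_subtractf)
  finally show ?thesis using tested remainder weighted_score_le unfolding g_def by linarith
qed

definition cross_score :: "nat \<Rightarrow> nat \<Rightarrow> (nat \<Rightarrow> real) \<Rightarrow> (nat \<times> nat \<Rightarrow> bool) \<Rightarrow> nat \<Rightarrow> real" where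
  "cross_score n r \<beta> A i = (\<Sum>k\<in>{r+1..n}. of_bool (A (i, k)) - mu (\<beta> i + \<beta> k))"

definition cross_info :: "nat \<Rightarrow> nat \<Rightarrow> (nat \<Rightarrow> real) \<Rightarrow> nat \<Rightarrow> real" where
  "cross_info n r \<beta> i = (\<Sum>k\<in>{r+1..n}. dmu (\<beta> i + \<beta> k))"

lemma sum_others_minus_cross_le:
  fixes f :: "nat \<Rightarrow> real"
  assumes i: "i \<in> {1..r}" and r: "r \<le> n" and f: "\<And>k. \<bar>f k\<bar> \<le> 1"
  shows "\<bar>(\<Sum>k\<in>{1..n} - {i}. f k) - (\<Sum>k\<in>{r+1..n}. f k)\<bar> \<le> real r"
proof -
  have split: "{1..n} - {i} = ({1..r} - {i}) \<union> {r+1..n}" using i r by auto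
  have "(\<Sum>k\<in>{1..n} - {i}. f k) = (\<Sum>k\<in>{1..r} - {i}. f k) + (\<Sum>k\<in>{r+1..n}. f k)"
    unfolding split by (rule sum.union_disjoint) auto
  thus ?thesis using abs_sum_others_le[of r i f 1] f by simp
qed

lemma score_minus_cross_score_le:
  assumes i: "i \<in> {1..r}" and r: "r \<le> n"
  shows "\<bar>score n A \<beta> i - cross_score n r \<beta> A i\<bar> \<le> real r"
proof -
  define f where "f k = adj A i k - mu (\<beta> i + \<beta> k)" for k
  have "\<bar>f k\<bar> \<le> 1" for k using mu_bounds[of "\<beta> i + \<beta> k"] by (auto simp: f_def adj_def)
  moreover have "score n A \<beta> i = (\<Sum>k\<in>{1..n} - {i}. f k)"
    by (simp add: f_def score_def deg_def sum_subtractf)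
  moreover have "cross_score n r \<beta> A i = (\<Sum>k\<in>{r+1..n}. f k)"
    unfolding cross_score_def f_def using i by (intro sum.cong) (auto simp: adj_def)
  ultimately show ?thesis using sum_others_minus_cross_le[OF i r] by simp
qed

lemma score_expansion:
  assumes i: "i \<in> {1..r}" and r: "r \<le> n"
    and w: "nuisance_weights n \<beta> i w" "\<And>j. j \<in> {1..n} \<Longrightarrow> \<bar>w j\<bar> \<le> W"
    and score_le: "\<And>j. j \<in> {1..n} \<Longrightarrow> \<bar>score n A \<beta> j\<bar> \<le> G"
    and weighted_score_le: "\<bar>\<Sum>j\<in>{1..n}. w j * score n A \<beta> j\<bar> \<le> B"
    and d: "\<And>j. j \<in> {1..n} \<Longrightarrow> \<bar>d j\<bar> \<le> t" and t: "t \<le> 1 / 2"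
    and critical: "\<And>j. j \<in> {r+1..n} \<Longrightarrow> score n A (\<lambda>j. \<beta> j + d j) j = 0"
  shows "\<bar>score n A (\<lambda>j. \<beta> j + d j) i - cross_score n r \<beta> A i + cross_info n r \<beta> i * d i\<bar>
     \<le> B + real n * (W * (real n * (2 * t)\<^sup>2)) + real r * (W * (G + real n * (2 * t)))
         + real n * (2 * t)\<^sup>2 + 2 * real r"
proof -
  have i_n: "i \<in> {1..n}" using i r by auto
  have "\<bar>dmu (\<beta> i + \<beta> k) * d i\<bar> \<le> 1 * 1" for k
    unfolding abs_mult using dmu_pos[of "\<beta> i + \<beta> k"] dmu_le_quarter[of "\<beta> i + \<beta> k"] d[OF i_n] t
    by (intro mult_mono) auto
  hence info: "\<bar>(\<Sum>k\<in>{1..n} - {i}. dmu (\<beta> i + \<beta> k) * d i) - cross_info n r \<beta> i * d i\<bar> \<le> real r"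
    using sum_others_minus_cross_le[OF i r] by (simp add: cross_info_def sum_distrib_right)
  have "fisher n \<beta> d i = (\<Sum>k\<in>{1..n} - {i}. dmu (\<beta> i + \<beta> k) * d i) + (\<Sum>k\<in>{1..n} - {i}. dmu (\<beta> i + \<beta> k) * d k)"
    unfolding fisher_def by (simp add: distrib_left sum.distrib)
  thus ?thesis
    using info score_minus_cross_score_le[OF i r, of A \<beta>] score_linearization[of n d t i A \<beta>, OF d t i_n]
      nuisance_sum_le[of i n r \<beta> w W A G B d t, OF i_n r w score_le weighted_score_le d t critical]
    by linarith
qed

section \<open>Expansion of the likelihood ratio on typical graphs\<close>

definition cross_zscore :: "nat \<Rightarrow> nat \<Rightarrow> (nat \<Rightarrow> real) \<Rightarrow> (nat \<times> nat \<Rightarrow> bool) \<Rightarrow> nat \<Rightarrow> real" where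
  "cross_zscore n r \<beta> A i = cross_score n r \<beta> A i / sqrt (cross_info n r \<beta> i)"

lemma product_perturbation:
  fixes a c y v :: real
  assumes a: "\<bar>a - y\<bar> \<le> E" and c: "\<bar>c - y\<bar> \<le> E" and y: "\<bar>y\<bar> \<le> Y" and E: "E \<le> Y" and v: "0 < v0" "v0 \<le> v"
  shows "\<bar>a * c / v - y\<^sup>2 / v\<bar> \<le> 3 * Y * E / v0" "\<bar>a * c / v\<bar> \<le> 4 * Y\<^sup>2 / v0"
proof -
  have "a * c - y\<^sup>2 = y * (c - y) + (a - y) * y + (a - y) * (c - y)"
    by (simp add: power2_eq_square algebra_simps)
  also have "\<bar>\<dots>\<bar> \<le> \<bar>y\<bar> * \<bar>c - y\<bar> + \<bar>a - y\<bar> * \<bar>y\<bar> + \<bar>a - y\<bar> * \<bar>c - y\<bar>"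
    unfolding abs_mult[symmetric] by linarith
  also have "\<dots> \<le> Y * E + E * Y + Y * E"
    using a c y E by (intro add_mono mult_mono) auto
  also have "\<dots> = 3 * Y * E" by simp
  finally have "\<bar>a * c - y\<^sup>2\<bar> / v \<le> 3 * Y * E / v0"
    using v y E a by (intro frac_le) auto
  thus "\<bar>a * c / v - y\<^sup>2 / v\<bar> \<le> 3 * Y * E / v0"
    using v by (simp flip: diff_divide_distrib)
  have "\<bar>a\<bar> * \<bar>c\<bar> \<le> (2 * Y) * (2 * Y)" using a c y E by (intro mult_mono) auto
  hence "\<bar>a * c\<bar> / v \<le> 4 * Y\<^sup>2 / v0"
    using v by (intro frac_le) (auto simp: abs_mult power2_eq_square)
  thus "\<bar>a * c / v\<bar> \<le> 4 * Y\<^sup>2 / v0" using v by simp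
qed

lemma sum_product_perturbation:
  fixes a c y v :: "'i \<Rightarrow> real"
  assumes "\<And>i. i \<in> I \<Longrightarrow> \<bar>a i - y i\<bar> \<le> E" "\<And>i. i \<in> I \<Longrightarrow> \<bar>c i - y i\<bar> \<le> E"
    and "\<And>i. i \<in> I \<Longrightarrow> \<bar>y i\<bar> \<le> Y" "E \<le> Y" "0 < v0" "\<And>i. i \<in> I \<Longrightarrow> v0 \<le> v i"
  shows "\<bar>(\<Sum>i\<in>I. a i * c i / v i) - (\<Sum>i\<in>I. (y i)\<^sup>2 / v i)\<bar> \<le> real (card I) * (3 * Y * E / v0)"
    and "\<bar>\<Sum>i\<in>I. a i * c i / v i\<bar> \<le> real (card I) * (4 * Y\<^sup>2 / v0)"
proof -
  have "\<bar>a i * c i / v i - (y i)\<^sup>2 / v i\<bar> \<le> 3 * Y * E / v0" if "i \<in> I" for i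
    using that assms by (intro product_perturbation) auto
  thus "\<bar>(\<Sum>i\<in>I. a i * c i / v i) - (\<Sum>i\<in>I. (y i)\<^sup>2 / v i)\<bar> \<le> real (card I) * (3 * Y * E / v0)"
    using sum_norm_bound[of I "\<lambda>i. a i * c i / v i - (y i)\<^sup>2 / v i" "3 * Y * E / v0"]
      by (simp add: sum_subtractf)
  have "\<bar>a i * c i / v i\<bar> \<le> 4 * Y\<^sup>2 / v0" if "i \<in> I" for i
    using that assms by (intro product_perturbation(2)[where E = E and y = "y i"]) auto
  thus "\<bar>\<Sum>i\<in>I. a i * c i / v i\<bar> \<le> real (card I) * (4 * Y\<^sup>2 / v0)"
    using sum_norm_bound[of I "\<lambda>i. a i * c i / v i" "4 * Y\<^sup>2 / v0"] by simp
qed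

definition nuisance_weight :: "nat \<Rightarrow> (nat \<Rightarrow> real) \<Rightarrow> real \<Rightarrow> nat \<Rightarrow> nat \<Rightarrow> real" where
  "nuisance_weight n \<beta> b i = (SOME w. nuisance_weights n \<beta> i w \<and> (\<forall>j. \<bar>w j\<bar> \<le> 2 * b / real n))"

definition typical_graphs :: "nat \<Rightarrow> nat \<Rightarrow> (nat \<Rightarrow> real) \<Rightarrow> real \<Rightarrow> (nat \<times> nat \<Rightarrow> bool) set" where
  "typical_graphs n r \<beta> b =
    {A. (\<forall>j\<in>{1..n}. \<bar>score n A \<beta> j\<bar> \<le> sqrt (real n * ln n)) \<and>
        (\<forall>i\<in>{1..r}. \<bar>\<Sum>j\<in>{1..n}. nuisance_weight n \<beta> b i j * score n A \<beta> j\<bar> \<le> 4 * b * ln n)}"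

text \<open>\<open>4804 = 4 + 3200 + 1600\<close> collects the weighted noise and the weighted and plain quadratic remainders,
  \<open>84 = 82 + 2\<close> the scores and edges of the first \<open>r\<close> nodes.\<close>

definition expansion_const :: "nat \<Rightarrow> real" where
  "expansion_const r = 4804 + 84 * real r"

definition lrt_const :: "nat \<Rightarrow> real" where
  "lrt_const r = real r * (48 * expansion_const r + 20480)"

definition lrt_rate :: "nat \<Rightarrow> real \<Rightarrow> real" where
  "lrt_rate n b = b ^ 4 * (ln (real n))\<^sup>2 / sqrt (real n)"

locale large_sample = curvature_bound +
  fixes r :: nat
  assumes r_bounds: "1 \<le> r" "2 * r \<le> n" "r\<^sup>2 \<le> n" and ln_ge: "1 \<le> ln (real n)"
    and rate_le: "expansion_const r * lrt_rate n b \<le> 1"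
begin

definition radius :: real where
  "radius = 20 * b * sqrt (ln (real n)) / sqrt (real n)"

definition expansion_error :: real where
  "expansion_error = expansion_const r * b ^ 3 * ln (real n)"

lemma r_le_n: "r \<le> n"
  using r_bounds by simp

lemma sqrt_n: "1 \<le> sqrt (real n)" "(sqrt (real n))\<^sup>2 = real n"
  using n_ge by auto

lemma sqrt_ln: "1 \<le> sqrt (ln (real n))" "(sqrt (ln (real n)))\<^sup>2 = ln (real n)"
  using ln_ge by auto

lemma b_pos: "0 < b" "1 \<le> b"
  using b_ge by auto

lemma expansion_const_ge: "4804 \<le> expansion_const r"
  by (simp add: expansion_const_def)

lemma powers_le_lrt_rate:
  assumes "i \<le> 4" "j \<le> 4"
  shows "b ^ i * sqrt (ln (real n)) ^ j / sqrt (real n) \<le> lrt_rate n b"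
proof -
  have "b ^ i * sqrt (ln (real n)) ^ j \<le> b ^ 4 * sqrt (ln (real n)) ^ 4"
    using assms b_pos sqrt_ln by (intro mult_mono power_increasing) auto
  also have "sqrt (ln (real n)) ^ 4 = (ln (real n))\<^sup>2"
    using sqrt_ln(2) by (metis mult_2 numeral_Bit0 power_add power2_eq_square)
  finally show ?thesis unfolding lrt_rate_def by (rule divide_right_mono) simp
qed

lemma powers_le_error:
  assumes "i \<le> 3" "j \<le> 2"
  shows "b ^ i * sqrt (ln (real n)) ^ j \<le> b ^ 3 * ln (real n)"
proof -
  have "b ^ i * sqrt (ln (real n)) ^ j \<le> b ^ 3 * sqrt (ln (real n)) ^ 2"
    using assms b_pos sqrt_ln by (intro mult_mono power_increasing) auto
  thus ?thesis using sqrt_ln(2) by simp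
qed

lemma radius_pos: "0 < radius"
  using b_pos ln_ge n_ge by (simp add: radius_def)

lemma radius_le: "radius \<le> 1 / 4"
proof -
  have "radius = 20 * (b ^ 1 * sqrt (ln (real n)) ^ 1 / sqrt (real n))" by (simp add: radius_def)
  also have "\<dots> \<le> 20 * lrt_rate n b" by (intro mult_left_mono powers_le_lrt_rate) auto
  also have "4804 * lrt_rate n b \<le> expansion_const r * lrt_rate n b"
    using b_pos by (intro mult_right_mono expansion_const_ge) (simp add: lrt_rate_def)
  hence "20 * lrt_rate n b \<le> 1 / 4" using rate_le by simp
  finally show ?thesis .
qed

lemma radius_dominates_score: "6 * b * sqrt (real n * ln n) < (real n - 1) * radius"
proof -
  define x where "x = b * sqrt (real n * ln n)"
  have "0 < x" using b_pos ln_ge n_ge by (simp add: x_def)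
  hence "6 * x < 3 / 4 * (20 * x)" by simp
  also have "\<dots> \<le> (real n - 1) / real n * (20 * x)"
    using n_ge \<open>0 < x\<close> by (intro mult_right_mono) (auto simp: field_simps)
  also have "20 * x = real n * radius"
    using sqrt_n(1) by (simp add: x_def radius_def real_sqrt_mult field_simps)
  finally show ?thesis using n_ge by (simp add: x_def mult.assoc)
qed

lemma nuisance_weight_spec:
  assumes "i \<in> {1..r}"
  shows "nuisance_weights n \<beta> i (nuisance_weight n \<beta> b i) \<and>
    (\<forall>j. \<bar>nuisance_weight n \<beta> b i j\<bar> \<le> 2 * b / real n)"
proof -
  have "i \<in> {1..n}" using assms r_le_n by auto
  from someI_ex[OF nuisance_weights_exist[OF this]] show ?thesis unfolding nuisance_weight_def .
qed

lemma expansion_terms_le_error: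
  "4 * b * ln n + real n * (2 * b / n * (real n * (2 * radius)\<^sup>2))
     + real r * (2 * b / n * (sqrt (real n * ln n) + real n * (2 * radius)))
     + real n * (2 * radius)\<^sup>2 + 2 * real r \<le> expansion_error"
proof -
  define s l where "s = sqrt (real n)" and "l = sqrt (ln (real n))"
  have s: "1 \<le> s" "real n = s\<^sup>2" and l: "1 \<le> l" "ln (real n) = l\<^sup>2"
    using sqrt_n sqrt_ln by (simp_all add: s_def l_def)
  have radius: "radius = 20 * b * l / s" by (simp add: radius_def s_def l_def)
  have G: "sqrt (real n * ln n) = s * l" by (simp add: real_sqrt_mult s_def l_def)
  have dom: "b ^ i * l ^ j \<le> b ^ 3 * l\<^sup>2" if "i \<le> 3" "j \<le> 2" for i j
    using powers_le_error[OF that] sqrt_ln(2) by (simp add: l_def)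
  have curvature: "real n * (2 * radius)\<^sup>2 = 1600 * (b\<^sup>2 * l\<^sup>2)"
    unfolding radius s(2) using s(1) by (simp add: power2_eq_square)
  have weighted: "real n * (2 * b / n * (real n * (2 * radius)\<^sup>2)) = 3200 * (b ^ 3 * l\<^sup>2)"
    unfolding curvature using n_ge by (simp add: power2_eq_square power3_eq_cube)
  have "2 * b / n * (s * l + real n * (2 * radius)) = (2 * (b * l) + 80 * (b\<^sup>2 * l)) / s"
    unfolding radius s(2) using s(1) by (simp add: field_simps power2_eq_square)
  also have "\<dots> \<le> 2 * (b * l) + 80 * (b\<^sup>2 * l)"
    using divide_left_mono[OF s(1), of "2 * (b * l) + 80 * (b\<^sup>2 * l)"] b_pos l s(1) by simp
  also have "\<dots> \<le> 82 * (b ^ 3 * l\<^sup>2)" using dom[of 1 1] dom[of 2 1] by simp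
  finally have tested: "real r * (2 * b / n * (s * l + real n * (2 * radius))) \<le> real r * (82 * (b ^ 3 * l\<^sup>2))"
    by (rule mult_left_mono) simp
  have "4 * b * l\<^sup>2 \<le> 4 * (b ^ 3 * l\<^sup>2)" "1600 * (b\<^sup>2 * l\<^sup>2) \<le> 1600 * (b ^ 3 * l\<^sup>2)"
    using dom[of 1 2] dom[of 2 2] by simp_all
  moreover have "2 * real r \<le> real r * (2 * (b ^ 3 * l\<^sup>2))"
    using mult_left_mono[of 2 "2 * (b ^ 3 * l\<^sup>2)" "real r"] dom[of 0 0] by simp
  ultimately show ?thesis
    using tested unfolding weighted G unfolding curvature l(2) expansion_error_def expansion_const_def
    by (simp add: algebra_simps)
qed

lemma expansion_error_nonneg: "0 \<le> expansion_error"
  using b_pos ln_ge expansion_const_ge by (simp add: expansion_error_def)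

lemma expansion_error_le: "expansion_error \<le> sqrt (real n * ln n)"
proof -
  have "expansion_error / sqrt (real n) = expansion_const r * (b ^ 3 * sqrt (ln (real n)) ^ 2 / sqrt (real n))"
    using sqrt_ln(2) by (simp add: expansion_error_def)
  also have "\<dots> \<le> expansion_const r * lrt_rate n b"
    using expansion_const_ge by (intro mult_left_mono powers_le_lrt_rate) auto
  also have "\<dots> \<le> 1" by (rule rate_le)
  finally have "expansion_error \<le> sqrt (real n) * 1" using sqrt_n(1) by (simp add: pos_divide_le_eq)
  also have "\<dots> \<le> sqrt (real n) * sqrt (ln (real n))" using sqrt_ln by (intro mult_left_mono) auto
  finally show ?thesis by (simp add: real_sqrt_mult)
qed

lemma typical_score_expansion:
  assumes A: "A \<in> typical_graphs n r \<beta> b" and i: "i \<in> {1..r}"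
    and d: "\<And>j. \<bar>d j\<bar> \<le> radius" and critical: "\<And>j. j \<in> {r+1..n} \<Longrightarrow> score n A (\<lambda>j. \<beta> j + d j) j = 0"
  shows "\<bar>score n A (\<lambda>j. \<beta> j + d j) i - cross_score n r \<beta> A i + cross_info n r \<beta> i * d i\<bar> \<le> expansion_error"
  by (rule order_trans[OF score_expansion[where w = "nuisance_weight n \<beta> b i"] expansion_terms_le_error])
     (use A i d critical r_le_n radius_le nuisance_weight_spec in \<open>auto simp: typical_graphs_def\<close>)

lemma typical_cross_score_le:
  assumes A: "A \<in> typical_graphs n r \<beta> b" and i: "i \<in> {1..r}"
  shows "\<bar>cross_score n r \<beta> A i\<bar> \<le> 2 * sqrt (real n * ln n)"
proof -
  have "real r \<le> sqrt (real n)"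
    using r_bounds(3) by (intro real_le_rsqrt) (simp flip: of_nat_power)
  also have "\<dots> \<le> sqrt (real n) * sqrt (ln (real n))"
    using mult_left_mono[OF sqrt_ln(1), of "sqrt (real n)"] by simp
  finally have "real r \<le> sqrt (real n * ln n)" by (simp add: real_sqrt_mult)
  moreover have "\<bar>score n A \<beta> i\<bar> \<le> sqrt (real n * ln n)"
    using A i r_le_n unfolding typical_graphs_def by auto
  ultimately show ?thesis using score_minus_cross_score_le[OF i r_le_n, of A \<beta>] by linarith
qed

lemma cross_info_ge:
  assumes "i \<in> {1..r}"
  shows "real n / (2 * b) \<le> cross_info n r \<beta> i"
proof -
  have "(\<Sum>k\<in>{r+1..n}. 1 / b) \<le> cross_info n r \<beta> i"
    unfolding cross_info_def using assms r_le_n by (intro sum_mono dmu_ge) auto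
  moreover have "real n / (2 * b) \<le> (\<Sum>k\<in>{r+1..n}. 1 / b)"
  proof -
    have "real n \<le> 2 * (real n - real r)" using of_nat_mono[OF r_bounds(2), where ?'a = real] by simp
    thus ?thesis using b_pos r_le_n by (simp add: field_simps of_nat_diff)
  qed
  ultimately show ?thesis by linarith
qed

lemma cross_info_pos: "i \<in> {1..r} \<Longrightarrow> 0 < cross_info n r \<beta> i"
  by (rule less_le_trans[OF _ cross_info_ge]) (use n_ge b_pos in auto)

lemma lrt_error_terms_le:
  "real r * (3 * (4 * sqrt (real n * ln n)) * (2 * expansion_error) / (real n / (2 * b)))
     + 4 * (2 * radius) * (real r * (4 * (4 * sqrt (real n * ln n))\<^sup>2 / (real n / (2 * b))))
   \<le> lrt_const r * lrt_rate n b"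
proof -
  define s l where "s = sqrt (real n)" and "l = sqrt (ln (real n))"
  have s: "1 \<le> s" "real n = s\<^sup>2" and l: "ln (real n) = l\<^sup>2"
    using sqrt_n sqrt_ln by (simp_all add: s_def l_def)
  have radius: "radius = 20 * b * l / s" by (simp add: radius_def s_def l_def)
  have G: "sqrt (real n * ln n) = s * l" by (simp add: real_sqrt_mult s_def l_def)
  have "real r * (3 * (4 * (s * l)) * (2 * expansion_error) / (s\<^sup>2 / (2 * b)))
      + 4 * (2 * radius) * (real r * (4 * (4 * (s * l))\<^sup>2 / (s\<^sup>2 / (2 * b)))) =
    real r * (48 * expansion_const r * (b ^ 4 * l ^ 3 / s) + 20480 * (b ^ 2 * l ^ 3 / s))"
    unfolding expansion_error_def radius l using s(1) b_pos
    by (simp add: field_simps power2_eq_square power3_eq_cube power4_eq_xxxx)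
  also have "\<dots> \<le> real r * (48 * expansion_const r * lrt_rate n b + 20480 * lrt_rate n b)"
    using expansion_const_ge unfolding s_def l_def
    by (intro mult_left_mono add_mono powers_le_lrt_rate) auto
  also have "\<dots> = lrt_const r * lrt_rate n b" by (simp add: lrt_const_def algebra_simps)
  finally show ?thesis unfolding G unfolding s(2) .
qed

lemma typical_unrestricted_critical_point:
  assumes "A \<in> typical_graphs n r \<beta> b"
  obtains d where "\<And>j. \<bar>d j\<bar> \<le> radius" "\<And>j. j \<in> {1..n} \<Longrightarrow> score n A (\<lambda>j. \<beta> j + d j) j = 0"
proof -
  have "\<bar>score n A \<beta> j\<bar> \<le> sqrt (real n * ln n)" if "j \<in> {1..n}" for j
    using assms that unfolding typical_graphs_def by blast
  from block_critical_point[OF radius_pos radius_le this radius_dominates_score, of 0]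
  show thesis using that by simp metis
qed

lemma typical_restricted_critical_point:
  assumes "A \<in> typical_graphs n r \<beta> b"
  shows "\<exists>c \<kappa>. (\<forall>j. \<bar>c j\<bar> \<le> radius) \<and> (\<forall>i\<in>{1..r}. c i = \<kappa>) \<and>
    (\<forall>j\<in>{r+1..n}. score n A (\<lambda>j. \<beta> j + c j) j = 0) \<and>
    (if frozen then \<kappa> = 0 else (\<Sum>i\<in>{1..r}. score n A (\<lambda>j. \<beta> j + c j) i) = 0)"
proof -
  have "\<bar>score n A \<beta> j\<bar> \<le> sqrt (real n * ln n)" if "j \<in> {1..n}" for j
    using assms that unfolding typical_graphs_def by blast
  from block_critical_point[OF radius_pos radius_le this radius_dominates_score, of r frozen]
  obtain c \<kappa> where "\<And>j. \<bar>c j\<bar> \<le> radius" "\<And>i. i \<in> {1..r} \<Longrightarrow> c i = \<kappa>"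
    "\<And>j. j \<in> {r+1..n} \<Longrightarrow> score n A (\<lambda>j. \<beta> j + c j) j = 0" "frozen \<Longrightarrow> \<kappa> = 0"
    "\<lbrakk>\<not> frozen; 1 \<le> r; r \<le> n\<rbrakk> \<Longrightarrow> (\<Sum>i\<in>{1..r}. score n A (\<lambda>j. \<beta> j + c j) i) = 0"
    by blast
  thus ?thesis using r_bounds(1) r_le_n by (intro exI[of _ c] exI[of _ \<kappa>]) auto
qed

lemma lrt_approx_score_pairing:
  assumes d: "\<And>j. \<bar>d j\<bar> \<le> radius" "\<And>j. j \<in> {1..n} \<Longrightarrow> score n A (\<lambda>j. \<beta> j + d j) j = 0"
    and c: "\<And>j. \<bar>c j\<bar> \<le> radius" "\<And>j. j \<in> {r+1..n} \<Longrightarrow> score n A (\<lambda>j. \<beta> j + c j) j = 0"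
    and null: "(\<lambda>j. \<beta> j + c j) \<in> S"
      "\<And>\<gamma>'. \<gamma>' \<in> S \<Longrightarrow> (\<Sum>i\<in>{1..r}. (\<gamma>' i - (\<beta> i + c i)) * score n A (\<lambda>j. \<beta> j + c j) i) = 0"
  shows "has_max (loglik n A) UNIV" "has_max (loglik n A) S"
    and "\<bar>LRT n A S - (\<Sum>i\<in>{1..r}. (d i - c i) * score n A (\<lambda>j. \<beta> j + c j) i)\<bar>
      \<le> 4 * (2 * radius) * (\<Sum>i\<in>{1..r}. (d i - c i) * score n A (\<lambda>j. \<beta> j + c j) i)"
proof -
  let ?s = "score n A (\<lambda>j. \<beta> j + c j)"
  have supported: "(\<Sum>j\<in>{1..n}. x j * ?s j) = (\<Sum>i\<in>{1..r}. x i * ?s i)" for x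
    using r_le_n c(2) by (intro sum.mono_neutral_right) auto
  have full: "has_max (loglik n A) UNIV" "Sup (range (loglik n A)) = loglik n A (\<lambda>j. \<beta> j + d j)"
    using critical_point_maximizes[of "\<lambda>j. \<beta> j + d j" UNIV n A] d(2) by auto
  have restricted: "has_max (loglik n A) S" "Sup (loglik n A ` S) = loglik n A (\<lambda>j. \<beta> j + c j)"
    using critical_point_maximizes[OF null(1), of n A] null(2) unfolding supported by blast+
  show "has_max (loglik n A) UNIV" "has_max (loglik n A) S" by (rule full(1), rule restricted(1))
  have "LRT n A S = 2 * (loglik n A (\<lambda>j. \<beta> j + c j + (d j - c j)) - loglik n A (\<lambda>j. \<beta> j + c j))"
    unfolding LRT_def full restricted by simp
  moreover have "\<bar>d j - c j\<bar> \<le> 2 * radius" for j using c(1)[of j] d(1)[of j] by linarith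
  ultimately show "\<bar>LRT n A S - (\<Sum>i\<in>{1..r}. (d i - c i) * ?s i)\<bar>
      \<le> 4 * (2 * radius) * (\<Sum>i\<in>{1..r}. (d i - c i) * ?s i)"
    using twice_loglik_diff_approx[of "\<lambda>j. d j - c j" n A "\<lambda>j. \<beta> j + c j" "2 * radius"]
      d(2) radius_le unfolding supported by simp
qed

lemma score_pairing_approx:
  assumes A: "A \<in> typical_graphs n r \<beta> b"
    and d: "\<And>j. \<bar>d j\<bar> \<le> radius" "\<And>j. j \<in> {1..n} \<Longrightarrow> score n A (\<lambda>j. \<beta> j + d j) j = 0"
    and c: "\<And>j. \<bar>c j\<bar> \<le> radius" "\<And>i. i \<in> {1..r} \<Longrightarrow> c i = \<kappa>"
      "\<And>j. j \<in> {r+1..n} \<Longrightarrow> score n A (\<lambda>j. \<beta> j + c j) j = 0"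
    and centre: "\<And>i. i \<in> {1..r} \<Longrightarrow> \<bar>cross_info n r \<beta> i * (\<kappa> - m)\<bar> \<le> expansion_error"
      "\<And>i. i \<in> {1..r} \<Longrightarrow> \<bar>cross_info n r \<beta> i * m\<bar> \<le> 2 * sqrt (real n * ln n)"
  shows "\<bar>(\<Sum>i\<in>{1..r}. (d i - c i) * score n A (\<lambda>j. \<beta> j + c j) i) -
        (\<Sum>i\<in>{1..r}. (cross_score n r \<beta> A i - cross_info n r \<beta> i * m)\<^sup>2 / cross_info n r \<beta> i)\<bar>
      \<le> real r * (3 * (4 * sqrt (real n * ln n)) * (2 * expansion_error) / (real n / (2 * b)))"
    and "\<bar>\<Sum>i\<in>{1..r}. (d i - c i) * score n A (\<lambda>j. \<beta> j + c j) i\<bar>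
      \<le> real r * (4 * (4 * sqrt (real n * ln n))\<^sup>2 / (real n / (2 * b)))"
proof -
  let ?s = "score n A (\<lambda>j. \<beta> j + c j)" and ?v = "cross_info n r \<beta>" and ?y = "cross_score n r \<beta> A"
  have score: "\<bar>?s i - (?y i - ?v i * m)\<bar> \<le> 2 * expansion_error" if i: "i \<in> {1..r}" for i
    using typical_score_expansion[OF A i c(1,3)] centre(1)[OF i]
      unfolding c(2)[OF i] right_diff_distrib by linarith
  have displacement: "\<bar>?v i * (d i - \<kappa>) - (?y i - ?v i * m)\<bar> \<le> 2 * expansion_error" if i: "i \<in> {1..r}" for i
  proof -
    have "score n A (\<lambda>j. \<beta> j + d j) i = 0" using d(2) i r_le_n by auto
    moreover have "\<bar>score n A (\<lambda>j. \<beta> j + d j) i - ?y i + ?v i * d i\<bar> \<le> expansion_error"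
      using d(2) by (intro typical_score_expansion[OF A i d(1)]) auto
    ultimately show ?thesis using centre(1)[OF i] unfolding right_diff_distrib by linarith
  qed
  have main: "\<bar>?y i - ?v i * m\<bar> \<le> 4 * sqrt (real n * ln n)" if i: "i \<in> {1..r}" for i
    using typical_cross_score_le[OF A i] centre(2)[OF i] by linarith
  have "2 * expansion_error \<le> 4 * sqrt (real n * ln n)"
    using expansion_error_le expansion_error_nonneg by linarith
  note bounds = sum_product_perturbation[of "{1..r}" "\<lambda>i. ?v i * (d i - \<kappa>)" "\<lambda>i. ?y i - ?v i * m" _ ?s _ _ ?v,
      OF displacement score main this _ cross_info_ge]
  have "(\<Sum>i\<in>{1..r}. ?v i * (d i - \<kappa>) * ?s i / ?v i) = (\<Sum>i\<in>{1..r}. (d i - c i) * ?s i)"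
  proof (intro sum.cong refl)
    fix i assume "i \<in> {1..r}"
    thus "?v i * (d i - \<kappa>) * ?s i / ?v i = (d i - c i) * ?s i" using cross_info_pos[of i] c(2)[of i] by simp
  qed
  thus "\<bar>(\<Sum>i\<in>{1..r}. (d i - c i) * ?s i) - (\<Sum>i\<in>{1..r}. (?y i - ?v i * m)\<^sup>2 / ?v i)\<bar>
      \<le> real r * (3 * (4 * sqrt (real n * ln n)) * (2 * expansion_error) / (real n / (2 * b)))"
    and "\<bar>\<Sum>i\<in>{1..r}. (d i - c i) * ?s i\<bar> \<le> real r * (4 * (4 * sqrt (real n * ln n))\<^sup>2 / (real n / (2 * b)))"
    using bounds n_ge b_pos by simp_all
qed

text \<open>The fixed null has \<open>\<kappa> = m = 0\<close>; in the homogeneous null \<open>m\<close> is the mean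
  cross score divided by the common information, which approximates \<open>\<kappa>\<close>.\<close>

lemma lrt_approx_centred:
  assumes A: "A \<in> typical_graphs n r \<beta> b"
    and c: "\<And>j. \<bar>c j\<bar> \<le> radius" "\<And>i. i \<in> {1..r} \<Longrightarrow> c i = \<kappa>"
      "\<And>j. j \<in> {r+1..n} \<Longrightarrow> score n A (\<lambda>j. \<beta> j + c j) j = 0"
    and null: "(\<lambda>j. \<beta> j + c j) \<in> S"
      "\<And>\<gamma>'. \<gamma>' \<in> S \<Longrightarrow> (\<Sum>i\<in>{1..r}. (\<gamma>' i - (\<beta> i + c i)) * score n A (\<lambda>j. \<beta> j + c j) i) = 0"
    and centre: "\<And>i. i \<in> {1..r} \<Longrightarrow> \<bar>cross_info n r \<beta> i * (\<kappa> - m)\<bar> \<le> expansion_error"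
      "\<And>i. i \<in> {1..r} \<Longrightarrow> \<bar>cross_info n r \<beta> i * m\<bar> \<le> 2 * sqrt (real n * ln n)"
  shows "has_max (loglik n A) UNIV" "has_max (loglik n A) S"
    and "\<bar>LRT n A S - (\<Sum>i\<in>{1..r}. (cross_score n r \<beta> A i - cross_info n r \<beta> i * m)\<^sup>2 / cross_info n r \<beta> i)\<bar>
       \<le> lrt_const r * lrt_rate n b"
proof -
  obtain d where d: "\<And>j. \<bar>d j\<bar> \<le> radius" "\<And>j. j \<in> {1..n} \<Longrightarrow> score n A (\<lambda>j. \<beta> j + d j) j = 0"
    using typical_unrestricted_critical_point[OF A] by blast
  define Q where "Q = (\<Sum>i\<in>{1..r}. (d i - c i) * score n A (\<lambda>j. \<beta> j + c j) i)"
  note lrt = lrt_approx_score_pairing[of d A c S, OF d c(1,3) null, folded Q_def]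
  note pairing = score_pairing_approx[of A d c \<kappa> m, OF A d c centre, folded Q_def]
  show "has_max (loglik n A) UNIV" by (rule lrt(1))
  show "has_max (loglik n A) S" by (rule lrt(2))
  have "4 * (2 * radius) * Q \<le>
      4 * (2 * radius) * (real r * (4 * (4 * sqrt (real n * ln n))\<^sup>2 / (real n / (2 * b))))"
    using pairing(2) radius_pos by (intro mult_left_mono) auto
  thus "\<bar>LRT n A S - (\<Sum>i\<in>{1..r}. (cross_score n r \<beta> A i - cross_info n r \<beta> i * m)\<^sup>2 / cross_info n r \<beta> i)\<bar>
       \<le> lrt_const r * lrt_rate n b"
    using lrt(3) pairing(1) lrt_error_terms_le by linarith
qed

lemma fixed_null_lrt_approx:
  assumes A: "A \<in> typical_graphs n r \<beta> b" and null: "\<And>i. i \<in> {1..r} \<Longrightarrow> \<beta> i = \<beta>0 i"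
  shows "has_max (loglik n A) UNIV \<and> has_max (loglik n A) (fixed_null_set r \<beta>0) \<and>
     \<bar>LRT n A (fixed_null_set r \<beta>0) - sum_sq r (cross_zscore n r \<beta> A)\<bar> \<le> lrt_const r * lrt_rate n b"
proof -
  obtain c \<kappa> where "\<forall>j. \<bar>c j\<bar> \<le> radius" "\<forall>i\<in>{1..r}. c i = \<kappa>"
    "\<forall>j\<in>{r+1..n}. score n A (\<lambda>j. \<beta> j + c j) j = 0" and \<kappa>: "\<kappa> = 0"
    using typical_restricted_critical_point[OF A, of True] by auto
  note c = this(1-3)[rule_format]
  have "(\<lambda>j. \<beta> j + c j) \<in> fixed_null_set r \<beta>0"
    using c(2) \<kappa> null by (simp add: fixed_null_set_def)
  moreover have "(\<Sum>i\<in>{1..r}. (\<gamma>' i - (\<beta> i + c i)) * score n A (\<lambda>j. \<beta> j + c j) i) = 0"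
    if "\<gamma>' \<in> fixed_null_set r \<beta>0" for \<gamma>'
    using that c(2) \<kappa> null by (simp add: fixed_null_set_def)
  moreover have "(\<Sum>i\<in>{1..r}. (cross_score n r \<beta> A i - cross_info n r \<beta> i * 0)\<^sup>2 / cross_info n r \<beta> i) =
      sum_sq r (cross_zscore n r \<beta> A)"
    using cross_info_pos
      unfolding sum_sq_def cross_zscore_def power_divide by (intro sum.cong) (auto simp: less_imp_le)
  ultimately show ?thesis
    using lrt_approx_centred[OF A c, of "fixed_null_set r \<beta>0" 0] \<kappa> expansion_error_nonneg n_ge ln_ge by simp
qed

lemma homogeneous_centre_le:
  assumes A: "A \<in> typical_graphs n r \<beta> b"
    and c: "\<And>j. \<bar>c j\<bar> \<le> radius" "\<And>i. i \<in> {1..r} \<Longrightarrow> c i = \<kappa>"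
      "\<And>j. j \<in> {r+1..n} \<Longrightarrow> score n A (\<lambda>j. \<beta> j + c j) j = 0"
    and score_sum: "(\<Sum>i\<in>{1..r}. score n A (\<lambda>j. \<beta> j + c j) i) = 0"
    and info: "\<And>i. i \<in> {1..r} \<Longrightarrow> cross_info n r \<beta> i = v"
  defines "mean \<equiv> (\<Sum>i\<in>{1..r}. cross_score n r \<beta> A i) / real r"
  shows "\<bar>v * \<kappa> - mean\<bar> \<le> expansion_error" "\<bar>mean\<bar> \<le> 2 * sqrt (real n * ln n)"
proof -
  let ?s = "score n A (\<lambda>j. \<beta> j + c j)" and ?y = "cross_score n r \<beta> A"
  have "\<bar>?s i - ?y i + v * \<kappa>\<bar> \<le> expansion_error" if "i \<in> {1..r}" for i
    using typical_score_expansion[OF A that c(1,3)] unfolding c(2)[OF that] info[OF that] .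
  hence "\<bar>\<Sum>i\<in>{1..r}. ?s i - ?y i + v * \<kappa>\<bar> \<le> real r * expansion_error"
    using sum_norm_bound[of "{1..r}" "\<lambda>i. ?s i - ?y i + v * \<kappa>"] by simp
  also have "(\<Sum>i\<in>{1..r}. ?s i - ?y i + v * \<kappa>) = real r * (v * \<kappa> - mean)"
    using score_sum r_bounds(1) by (simp add: sum.distrib sum_subtractf mean_def right_diff_distrib)
  finally show "\<bar>v * \<kappa> - mean\<bar> \<le> expansion_error" using r_bounds(1) by (simp add: abs_mult)
  have "\<bar>\<Sum>i\<in>{1..r}. ?y i\<bar> \<le> real r * (2 * sqrt (real n * ln n))"
    using sum_norm_bound[of "{1..r}" ?y] typical_cross_score_le[OF A] by simp
  thus "\<bar>mean\<bar> \<le> 2 * sqrt (real n * ln n)" using r_bounds(1) by (simp add: mean_def divide_simps mult.commute)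
qed

lemma homog_null_lrt_approx:
  assumes A: "A \<in> typical_graphs n r \<beta> b" and null: "\<And>i. i \<in> {1..r} \<Longrightarrow> \<beta> i = \<beta> 1"
  shows "has_max (loglik n A) UNIV \<and> has_max (loglik n A) (homog_null_set r) \<and>
     \<bar>LRT n A (homog_null_set r) - centred_sum_sq r (cross_zscore n r \<beta> A)\<bar> \<le> lrt_const r * lrt_rate n b"
proof -
  let ?y = "cross_score n r \<beta> A"
  define v where "v = cross_info n r \<beta> 1"
  have info: "cross_info n r \<beta> i = v" if "i \<in> {1..r}" for i
    unfolding v_def cross_info_def null[OF that] ..
  have v: "0 < v" unfolding v_def using r_bounds(1) by (intro cross_info_pos) simp
  define m where "m = (\<Sum>i\<in>{1..r}. ?y i) / real r / v"
  have vm: "v * m = (\<Sum>i\<in>{1..r}. ?y i) / real r" using v by (simp add: m_def)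
  obtain c \<kappa> where "\<forall>j. \<bar>c j\<bar> \<le> radius" "\<forall>i\<in>{1..r}. c i = \<kappa>"
    "\<forall>j\<in>{r+1..n}. score n A (\<lambda>j. \<beta> j + c j) j = 0"
    and score_sum: "(\<Sum>i\<in>{1..r}. score n A (\<lambda>j. \<beta> j + c j) i) = 0"
    using typical_restricted_critical_point[OF A, of False] by auto
  note c = this(1-3)[rule_format]
  let ?s = "score n A (\<lambda>j. \<beta> j + c j)"
  have common: "\<beta> i + c i = \<beta> 1 + \<kappa>" if "i \<in> {1..r}" for i
    by (simp only: null[OF that] c(2)[OF that])
  hence "(\<lambda>j. \<beta> j + c j) \<in> homog_null_set r"
    using r_bounds(1) by (simp add: homog_null_set_def)
  moreover have "(\<Sum>i\<in>{1..r}. (\<gamma>' i - (\<beta> i + c i)) * ?s i) = 0" if "\<gamma>' \<in> homog_null_set r" for \<gamma>'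
  proof -
    have "(\<gamma>' i - (\<beta> i + c i)) * ?s i = (\<gamma>' 1 - (\<beta> 1 + \<kappa>)) * ?s i" if i: "i \<in> {1..r}" for i
    proof -
      have "\<gamma>' i = \<gamma>' 1" using \<open>\<gamma>' \<in> homog_null_set r\<close> i unfolding homog_null_set_def by blast
      thus ?thesis by (simp only: common[OF i])
    qed
    hence "(\<Sum>i\<in>{1..r}. (\<gamma>' i - (\<beta> i + c i)) * ?s i) = (\<Sum>i\<in>{1..r}. (\<gamma>' 1 - (\<beta> 1 + \<kappa>)) * ?s i)"
      by (intro sum.cong refl)
    thus ?thesis using score_sum by (simp flip: sum_distrib_left)
  qed
  moreover have "\<bar>v * (\<kappa> - m)\<bar> \<le> expansion_error" "\<bar>v * m\<bar> \<le> 2 * sqrt (real n * ln n)"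
    using homogeneous_centre_le[OF A c score_sum info] by (simp_all add: vm right_diff_distrib)
  moreover have "(\<Sum>i\<in>{1..r}. (?y i - v * m)\<^sup>2 / v) = centred_sum_sq r (cross_zscore n r \<beta> A)"
  proof -
    have "cross_zscore n r \<beta> A i = ?y i / sqrt v" if "i \<in> {1..r}" for i
      by (simp add: cross_zscore_def info[OF that])
    hence "centred_sum_sq r (cross_zscore n r \<beta> A) = centred_sum_sq r (\<lambda>i. ?y i / sqrt v)"
      by (simp add: centred_sum_sq_def)
    thus ?thesis using centred_sum_sq_divide_sqrt[OF v] by (simp add: vm)
  qed
  ultimately show ?thesis
    using lrt_approx_centred[OF A c, of "homog_null_set r" m] info by simp
qed

end

section \<open>Concentration and asymptotic normality of the scores\<close>

lemma (in prob_space) hoeffding_weighted_sum: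
  fixes X :: "'i \<Rightarrow> 'a \<Rightarrow> real"
  assumes I: "finite I" and indep: "indep_vars (\<lambda>_. borel) X I"
    and range: "\<And>i \<omega>. i \<in> I \<Longrightarrow> X i \<omega> \<in> {l i..l i + 1}" and mean: "\<And>i. i \<in> I \<Longrightarrow> expectation (X i) = 0"
    and V: "(\<Sum>i\<in>I. (c i)\<^sup>2) \<le> V" and \<epsilon>: "0 < \<epsilon>"
  shows "prob {\<omega>\<in>space M. \<epsilon> \<le> \<bar>\<Sum>i\<in>I. c i * X i \<omega>\<bar>} \<le> 2 * exp (- 2 * \<epsilon>\<^sup>2 / V)"
proof (cases "(\<Sum>i\<in>I. (c i)\<^sup>2) = 0")
  case True
  hence "c i = 0" if "i \<in> I" for i using that I by (simp add: sum_nonneg_eq_0_iff)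
  thus ?thesis using \<epsilon> by simp
next
  case False
  hence pos: "(\<Sum>i\<in>I. (c i)\<^sup>2) > 0" by (simp add: sum_nonneg order_less_le)
  define lo hi where "lo i = min (c i * l i) (c i * (l i + 1))"
    and "hi i = max (c i * l i) (c i * (l i + 1))" for i
  have width: "(hi i - lo i)\<^sup>2 = (c i)\<^sup>2" for i
    unfolding hi_def lo_def by (cases "c i \<ge> 0") (auto simp: distrib_left)
  interpret Hoeffding_ineq M I "\<lambda>i \<omega>. c i * X i \<omega>" lo hi "\<Sum>i\<in>I. expectation (\<lambda>\<omega>. c i * X i \<omega>)"
  proof unfold_locales
    show "indep_vars (\<lambda>_. borel) (\<lambda>i \<omega>. c i * X i \<omega>) I"
      by (rule indep_vars_compose2[OF indep, of "\<lambda>i x. c i * x"]) simp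
    fix i assume "i \<in> I"
    have "c i * X i \<omega> \<in> {lo i..hi i}" for \<omega>
    proof (cases "c i \<ge> 0")
      case True
      hence "c i * l i \<le> c i * X i \<omega>" "c i * X i \<omega> \<le> c i * (l i + 1)"
        using range[OF \<open>i \<in> I\<close>, of \<omega>] by (intro mult_left_mono; simp)+
      thus ?thesis by (simp add: lo_def hi_def min_le_iff_disj le_max_iff_disj)
    next
      case False
      hence "c i * X i \<omega> \<le> c i * l i" "c i * (l i + 1) \<le> c i * X i \<omega>"
        using range[OF \<open>i \<in> I\<close>, of \<omega>] by (intro mult_left_mono_neg; simp)+
      thus ?thesis by (simp add: lo_def hi_def min_le_iff_disj le_max_iff_disj)
    qed
    thus "AE \<omega> in M. c i * X i \<omega> \<in> {lo i..hi i}" by simp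
  qed (use I in auto)
  have "(\<Sum>i\<in>I. expectation (\<lambda>\<omega>. c i * X i \<omega>)) = 0" by (intro sum.neutral ballI) (simp add: mean)
  hence "prob {\<omega>\<in>space M. \<epsilon> \<le> \<bar>\<Sum>i\<in>I. c i * X i \<omega>\<bar>} \<le> 2 * exp (- 2 * \<epsilon>\<^sup>2 / (\<Sum>i\<in>I. (c i)\<^sup>2))"
    using Hoeffding_ineq_abs_ge[of \<epsilon>] \<epsilon> pos unfolding width by simp
  also have "\<dots> \<le> 2 * exp (- 2 * \<epsilon>\<^sup>2 / V)"
    using divide_left_mono[of "\<Sum>i\<in>I. (c i)\<^sup>2" V "2 * \<epsilon>\<^sup>2"] V pos by simp
  finally show ?thesis .
qed

definition edge_dev :: "(nat \<Rightarrow> real) \<Rightarrow> nat \<times> nat \<Rightarrow> (nat \<times> nat \<Rightarrow> bool) \<Rightarrow> real" where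
  "edge_dev \<beta> e A = of_bool (A e) - mu (\<beta> (fst e) + \<beta> (snd e))"

lemma abs_edge_dev_le: "\<bar>edge_dev \<beta> e A\<bar> \<le> 1"
  using mu_bounds[of "\<beta> (fst e) + \<beta> (snd e)"] by (auto simp: edge_dev_def)

lemma expectation_edge:
  fixes f :: "bool \<Rightarrow> real" and \<beta> :: "nat \<Rightarrow> real"
  assumes "e \<in> pairs n"
  defines "p \<equiv> mu (\<beta> (fst e) + \<beta> (snd e))"
  shows "measure_pmf.expectation (beta_graph n \<beta>) (\<lambda>A. f (A e)) = p * f True + (1 - p) * f False"
proof -
  have "map_pmf (\<lambda>A. A e) (beta_graph n \<beta>) = bernoulli_pmf p"
    unfolding beta_graph_def using assms by (subst Pi_pmf_component) (auto simp: case_prod_beta)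
  moreover have "measure_pmf.expectation (beta_graph n \<beta>) (\<lambda>A. f (A e)) =
      measure_pmf.expectation (map_pmf (\<lambda>A. A e) (beta_graph n \<beta>)) f"
    by simp
  ultimately show ?thesis using mu_bounds unfolding p_def by simp
qed

lemma expectation_edge_dev:
  assumes "e \<in> pairs n"
  shows "measure_pmf.expectation (beta_graph n \<beta>) (edge_dev \<beta> e) = 0"
    and "measure_pmf.expectation (beta_graph n \<beta>) (\<lambda>A. (edge_dev \<beta> e A)\<^sup>2) = dmu (\<beta> (fst e) + \<beta> (snd e))"
  using expectation_edge[OF assms, of \<beta> "\<lambda>x. of_bool x - mu (\<beta> (fst e) + \<beta> (snd e))"]
    expectation_edge[OF assms, of \<beta> "\<lambda>x. (of_bool x - mu (\<beta> (fst e) + \<beta> (snd e)))\<^sup>2"]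
  by (simp_all add: edge_dev_def[abs_def] dmu_eq_mu_mult power2_eq_square algebra_simps)

lemma indep_edges:
  "prob_space.indep_vars (measure_pmf (beta_graph n \<beta>)) (\<lambda>_. count_space UNIV) (\<lambda>e A. A e) (pairs n)"
  unfolding beta_graph_def by (rule indep_vars_Pi_pmf) simp

lemma indep_edge_devs:
  "prob_space.indep_vars (measure_pmf (beta_graph n \<beta>)) (\<lambda>_. borel) (edge_dev \<beta>) (pairs n)"
  unfolding edge_dev_def[abs_def]
  by (rule prob_space.indep_vars_compose2[OF measure_pmf.prob_space_axioms indep_edges,
      where Y = "\<lambda>e x. of_bool x - mu (\<beta> (fst e) + \<beta> (snd e))"]) simp

lemma sum_mult_score_edges:
  "(\<Sum>j\<in>{1..n}. x j * score n A \<beta> j) = (\<Sum>e\<in>pairs n. (x (fst e) + x (snd e)) * edge_dev \<beta> e A)"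
proof -
  have "(\<Sum>j\<in>{1..n}. x j * score n A \<beta> j) = offdiag_sum n (\<lambda>j k. x j * (adj A j k - mu (\<beta> j + \<beta> k)))"
    unfolding score_def deg_def sum_subtractf[symmetric] sum_distrib_left ..
  also have "\<dots> = (\<Sum>e\<in>pairs n. (x (fst e) + x (snd e)) * edge_dev \<beta> e A)"
    unfolding offdiag_sum_pairs
    by (intro sum.cong refl) (auto simp: pairs_def adj_def edge_dev_def add.commute distrib_right)
  finally show ?thesis .
qed

lemma prob_weighted_score_ge:
  assumes V: "(\<Sum>e\<in>pairs n. (x (fst e) + x (snd e))\<^sup>2) \<le> V" "0 < V" and \<epsilon>: "0 < \<epsilon>" "V * ln n \<le> \<epsilon>\<^sup>2"
    and n: "1 \<le> n"
  shows "measure_pmf.prob (beta_graph n \<beta>) {A. \<epsilon> \<le> \<bar>\<Sum>j\<in>{1..n}. x j * score n A \<beta> j\<bar>} \<le> 2 / (real n)\<^sup>2"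
proof -
  let ?l = "\<lambda>e. - mu (\<beta> (fst e) + \<beta> (snd e))"
  have range: "edge_dev \<beta> e A \<in> {?l e..?l e + 1}" for e A
    by (auto simp: edge_dev_def)
  have "measure_pmf.prob (beta_graph n \<beta>) {A. \<epsilon> \<le> \<bar>\<Sum>j\<in>{1..n}. x j * score n A \<beta> j\<bar>} \<le> 2 * exp (- 2 * \<epsilon>\<^sup>2 / V)"
    using measure_pmf.hoeffding_weighted_sum[where l = ?l, OF finite_pairs indep_edge_devs range
        expectation_edge_dev(1) V(1) \<epsilon>(1)]
    unfolding sum_mult_score_edges by simp
  also have "\<dots> \<le> 2 * exp (- 2 * ln n)"
    using V(2) \<epsilon>(2) by (simp add: pos_le_divide_eq mult.commute)
  also have "\<dots> = 2 / (real n)\<^sup>2"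
    using n by (simp add: exp_minus exp_double divide_inverse)
  finally show ?thesis .
qed

lemma sum_incident_edges_le:
  fixes j :: nat
  defines "x \<equiv> \<lambda>k. of_bool (k = j) :: real"
  shows "(\<Sum>e\<in>pairs n. (x (fst e) + x (snd e))\<^sup>2) \<le> real n"
proof -
  have "(\<Sum>e\<in>pairs n. (x (fst e) + x (snd e))\<^sup>2) = (\<Sum>(a, b)\<in>pairs n. x a + x b)"
    by (intro sum.cong refl) (auto simp: x_def pairs_def)
  also have "\<dots> = (\<Sum>a\<in>{1..n}. x a * real (card ({1..n} - {a})))"
    unfolding offdiag_sum_pairs[where F = "\<lambda>a b. x a", symmetric] by (simp add: mult.commute)
  also have "\<dots> \<le> (\<Sum>a\<in>{1..n}. x a * real n)"
    using card_mono[of "{1..n}" "{1..n} - {_}"] by (intro sum_mono mult_left_mono) (auto simp: x_def)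
  also have "\<dots> \<le> real n" by (simp add: x_def of_bool_def if_distrib[of "\<lambda>u. u * _"] cong: if_cong)
  finally show ?thesis .
qed

context large_sample
begin

lemma prob_score_ge:
  assumes "j \<in> {1..n}"
  shows "measure_pmf.prob (beta_graph n \<beta>) {A. sqrt (real n * ln n) \<le> \<bar>score n A \<beta> j\<bar>} \<le> 2 / (real n)\<^sup>2"
proof -
  have "(\<Sum>k\<in>{1..n}. of_bool (k = j) * score n A \<beta> k) = score n A \<beta> j" for A
    using assms by (simp add: of_bool_def if_distrib[of "\<lambda>u. u * _"] cong: if_cong)
  thus ?thesis
    using prob_weighted_score_ge[OF sum_incident_edges_le[of j n], where \<epsilon> = "sqrt (real n * ln n)" and \<beta> = \<beta>]
      n_ge ln_ge by simp
qed

lemma prob_nuisance_score_ge: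
  assumes i: "i \<in> {1..r}"
  shows "measure_pmf.prob (beta_graph n \<beta>)
    {A. 4 * b * ln n \<le> \<bar>\<Sum>j\<in>{1..n}. nuisance_weight n \<beta> b i j * score n A \<beta> j\<bar>} \<le> 2 / (real n)\<^sup>2"
proof (rule prob_weighted_score_ge)
  let ?w = "nuisance_weight n \<beta> b i"
  have "(\<Sum>e\<in>pairs n. (?w (fst e) + ?w (snd e))\<^sup>2) \<le> (\<Sum>e\<in>pairs n. (4 * b / real n)\<^sup>2)"
  proof (intro sum_mono)
    fix e :: "nat \<times> nat"
    have "\<bar>?w (fst e)\<bar> \<le> 2 * b / real n" "\<bar>?w (snd e)\<bar> \<le> 2 * b / real n"
      using nuisance_weight_spec[OF i] by auto
    hence "\<bar>?w (fst e) + ?w (snd e)\<bar> \<le> 4 * b / real n" by simp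
    from power_mono[OF this, of 2] show "(?w (fst e) + ?w (snd e))\<^sup>2 \<le> (4 * b / real n)\<^sup>2" by simp
  qed
  also have "\<dots> = real (card (pairs n)) * (4 * b / real n)\<^sup>2" by simp
  also have "\<dots> \<le> real (n * n) * (4 * b / real n)\<^sup>2"
  proof (intro mult_right_mono of_nat_mono)
    have "card (pairs n) \<le> card ({1..n} \<times> {1..n})" by (intro card_mono) (auto simp: pairs_def)
    thus "card (pairs n) \<le> n * n" by (simp add: card_cartesian_product)
  qed auto
  also have "\<dots> = 16 * b\<^sup>2" using n_ge by (simp add: power2_eq_square field_simps)
  finally show "(\<Sum>e\<in>pairs n. (?w (fst e) + ?w (snd e))\<^sup>2) \<le> 16 * b\<^sup>2" .
  have "ln (real n) \<le> (ln (real n))\<^sup>2" using ln_ge by (intro self_le_power) auto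
  thus "16 * b\<^sup>2 * ln n \<le> (4 * b * ln n)\<^sup>2" by (simp add: power_mult_distrib mult_left_mono)
qed (use n_ge b_pos ln_ge in auto)

lemma prob_typical_graphs: "1 - 4 / real n \<le> measure_pmf.prob (beta_graph n \<beta>) (typical_graphs n r \<beta> b)"
proof -
  let ?P = "measure_pmf.prob (beta_graph n \<beta>)"
  define X where "X j = {A. sqrt (real n * ln n) \<le> \<bar>score n A \<beta> j\<bar>}" for j
  define Y where "Y i = {A. 4 * b * ln n \<le> \<bar>\<Sum>j\<in>{1..n}. nuisance_weight n \<beta> b i j * score n A \<beta> j\<bar>}" for i
  have "1 - ?P (typical_graphs n r \<beta> b) = ?P (- typical_graphs n r \<beta> b)"
    using measure_pmf.prob_compl[of "typical_graphs n r \<beta> b" "beta_graph n \<beta>"] by (simp add: Compl_eq_Diff_UNIV)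
  also have "\<dots> \<le> ?P ((\<Union>j\<in>{1..n}. X j) \<union> (\<Union>i\<in>{1..r}. Y i))"
    by (intro measure_pmf.finite_measure_mono)
        (auto simp: typical_graphs_def X_def Y_def not_le intro: less_imp_le)
  also have "\<dots> \<le> ?P (\<Union>j\<in>{1..n}. X j) + ?P (\<Union>i\<in>{1..r}. Y i)"
    by (intro measure_Un_le) auto
  also have "\<dots> \<le> (\<Sum>j\<in>{1..n}. ?P (X j)) + (\<Sum>i\<in>{1..r}. ?P (Y i))"
    by (intro add_mono measure_UNION_le) auto
  also have "\<dots> \<le> (\<Sum>j\<in>{1..n}. 2 / (real n)\<^sup>2) + (\<Sum>i\<in>{1..r}. 2 / (real n)\<^sup>2)"
    unfolding X_def Y_def by (intro add_mono sum_mono prob_score_ge prob_nuisance_score_ge)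
  also have "\<dots> = (real n + real r) * (2 / (real n)\<^sup>2)" by (simp add: distrib_right add_divide_distrib)
  also have "\<dots> \<le> (real n + real n) * (2 / (real n)\<^sup>2)"
    using r_le_n by (intro mult_right_mono) auto
  also have "\<dots> = 4 / real n" using n_ge by (simp add: power2_eq_square field_simps)
  finally show ?thesis by simp
qed

end

definition cross_edges :: "nat \<Rightarrow> nat \<Rightarrow> nat \<Rightarrow> (nat \<times> nat) set" where
  "cross_edges n r i = Pair i ` {r+1..n}"

lemma cross_edges_subset: "i \<in> {1..r} \<Longrightarrow> cross_edges n r i \<subseteq> pairs n"
  by (auto simp: cross_edges_def pairs_def)

lemma sum_cross_edges: "(\<Sum>e\<in>cross_edges n r i. f e) = (\<Sum>k\<in>{r+1..n}. f (i, k))"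
  unfolding cross_edges_def by (subst sum.reindex) (auto intro: inj_onI)

lemma sum_edge_dev_cross_edges: "(\<Sum>e\<in>cross_edges n r i. edge_dev \<beta> e A) = cross_score n r \<beta> A i"
  by (simp add: sum_cross_edges cross_score_def edge_dev_def)

lemma sum_variance_cross_edges:
  assumes "i \<in> {1..r}"
  shows "(\<Sum>e\<in>cross_edges n r i. measure_pmf.expectation (beta_graph n \<beta>) (\<lambda>A. (edge_dev \<beta> e A)\<^sup>2)) =
    cross_info n r \<beta> i"
proof -
  have "(\<Sum>e\<in>cross_edges n r i. measure_pmf.expectation (beta_graph n \<beta>) (\<lambda>A. (edge_dev \<beta> e A)\<^sup>2)) =
      (\<Sum>e\<in>cross_edges n r i. dmu (\<beta> (fst e) + \<beta> (snd e)))"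
    using cross_edges_subset[OF assms] by (intro sum.cong refl expectation_edge_dev(2)) blast
  thus ?thesis by (simp add: sum_cross_edges cross_info_def)
qed

lemma weak_conv_cross_zscore:
  assumes i: "i \<in> {1..r}" and info: "filterlim (\<lambda>n. cross_info n r (\<beta> n) i) at_top sequentially"
  shows "weak_conv_m (\<lambda>n. distr (measure_pmf (beta_graph n (\<beta> n))) borel (\<lambda>A. cross_zscore n r (\<beta> n) A i))
     std_normal_distribution"
proof -
  define \<sigma> where "\<sigma> n = sqrt (cross_info n r (\<beta> n) i)" for n
  define X where "X n e A = edge_dev (\<beta> n) e A / \<sigma> n" for n e A
  have "weak_conv_m (\<lambda>n. distr (measure_pmf (beta_graph n (\<beta> n))) borel (\<lambda>A. \<Sum>e\<in>cross_edges n r i. X n e A))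
      std_normal_distribution"
  proof (rule weak_conv_bounded_triangular_array[OF measure_pmf.prob_space_axioms])
    show "prob_space.indep_vars (measure_pmf (beta_graph n (\<beta> n))) (\<lambda>_. borel) (X n) (cross_edges n r i)" for n
      unfolding X_def
      by (rule prob_space.indep_vars_compose2[OF measure_pmf.prob_space_axioms, OF prob_space.indep_vars_subset,
          OF measure_pmf.prob_space_axioms indep_edge_devs cross_edges_subset[OF i]]) simp
    have "0 \<le> \<sigma> n" for n by (simp add: \<sigma>_def cross_info_def sum_nonneg dmu_pos less_imp_le)
    thus "\<bar>X n e A\<bar> \<le> 1 / \<sigma> n" for n e A
      using abs_edge_dev_le[of "\<beta> n" e A] by (simp add: X_def divide_right_mono)
    show "(\<lambda>n. 1 / \<sigma> n) \<longlonglongrightarrow> 0"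
      unfolding \<sigma>_def
      by (rule tendsto_divide_0[OF tendsto_const filterlim_at_top_imp_at_infinity,
          OF filterlim_compose[OF sqrt_at_top info]])
    show "(LINT A|measure_pmf (beta_graph n (\<beta> n)). X n e A) = 0" if "e \<in> cross_edges n r i" for n e
      using expectation_edge_dev(1)[of e n "\<beta> n"] that cross_edges_subset[OF i] by (auto simp: X_def)
    have "\<forall>\<^sub>F n in sequentially. 0 < cross_info n r (\<beta> n) i"
      by (rule filterlim_at_top_dense[THEN iffD1, OF info, THEN spec])
    thus "\<forall>\<^sub>F n in sequentially. (\<Sum>e\<in>cross_edges n r i. LINT A|measure_pmf (beta_graph n (\<beta> n)). (X n e A)\<^sup>2) = 1"
      by eventually_elim
        (simp add: X_def power_divide \<sigma>_def sum_variance_cross_edges[OF i] flip: sum_divide_distrib)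
  qed (simp add: cross_edges_def)
  moreover have "(\<Sum>e\<in>cross_edges n r i. X n e A) = cross_zscore n r (\<beta> n) A i" for n A
    by (simp add: X_def \<sigma>_def cross_zscore_def sum_edge_dev_cross_edges flip: sum_divide_distrib)
  ultimately show ?thesis by simp
qed

lemma indep_cross_zscores:
  "prob_space.indep_vars (measure_pmf (beta_graph n \<beta>)) (\<lambda>_. borel) (\<lambda>i A. cross_zscore n r \<beta> A i) {1..r}"
proof -
  let ?M = "measure_pmf (beta_graph n \<beta>)" and ?K = "cross_edges n r"
  have "prob_space.indep_vars ?M (\<lambda>i. PiM (?K i) (\<lambda>_. count_space UNIV))
      (\<lambda>i A. restrict (\<lambda>e. A e) (?K i)) {1..r}"
    by (rule prob_space.indep_vars_restrict[OF measure_pmf.prob_space_axioms indep_edges cross_edges_subset])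
       (auto simp: cross_edges_def disjoint_family_on_def)
  hence "prob_space.indep_vars ?M (\<lambda>_. borel) (\<lambda>i A. cross_zscore n r \<beta> (restrict (\<lambda>e. A e) (?K i)) i) {1..r}"
  proof (rule prob_space.indep_vars_compose2[OF measure_pmf.prob_space_axioms])
    fix i
    have "(\<lambda>f. of_bool (f (i, k)) :: real) \<in> borel_measurable (PiM (?K i) (\<lambda>_. count_space UNIV))"
      if "k \<in> {r+1..n}" for k
      by (rule measurable_PiM_component_rev[where f = "of_bool"]) (use that in \<open>auto simp: cross_edges_def\<close>)
    thus "(\<lambda>A. cross_zscore n r \<beta> A i) \<in> borel_measurable (PiM (?K i) (\<lambda>_. count_space UNIV))"
      unfolding cross_zscore_def cross_score_def
      by (intro borel_measurable_divide borel_measurable_sum borel_measurable_diff) auto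
  qed
  moreover have "cross_zscore n r \<beta> (restrict (\<lambda>e. A e) (?K i)) i = cross_zscore n r \<beta> A i" for A i
    unfolding cross_zscore_def cross_score_def
    by (intro arg_cong2[of _ _ _ _ "(/)"] sum.cong) (auto simp: cross_edges_def)
  ultimately show ?thesis by simp
qed

lemma weak_conv_function_of_cross_zscores:
  assumes r: "1 \<le> r"
    and info: "\<And>i. i \<in> {1..r} \<Longrightarrow> filterlim (\<lambda>n. cross_info n r (\<beta> n) i) at_top sequentially"
    and F: "F \<in> borel_measurable (PiM {1..r} (\<lambda>_. borel))"
        "continuous_on UNIV F" "\<And>z. F (restrict z {1..r}) = F z"
  shows "weak_conv_m (\<lambda>n. distr (measure_pmf (beta_graph n (\<beta> n))) borel (\<lambda>A. F (cross_zscore n r (\<beta> n) A)))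
     (distr (normal_vector r) borel F)"
proof -
  let ?M = "\<lambda>n. measure_pmf (beta_graph n (\<beta> n))"
  let ?\<mu> = "\<lambda>i n. distr (?M n) borel (\<lambda>A. cross_zscore n r (\<beta> n) A i)"
  have "distr (PiM {1..r} (\<lambda>i. ?\<mu> i n)) borel F = distr (?M n) borel (\<lambda>A. F (cross_zscore n r (\<beta> n) A))" for n
  proof -
    have "PiM {1..r} (\<lambda>i. ?\<mu> i n) =
        distr (?M n) (PiM {1..r} (\<lambda>_. borel)) (\<lambda>A. \<lambda>i\<in>{1..r}. cross_zscore n r (\<beta> n) A i)"
      using indep_cross_zscores[of n "\<beta> n" r] r
      by (subst (asm) prob_space.indep_vars_iff_distr_eq_PiM'[OF measure_pmf.prob_space_axioms]) auto
    also have "distr \<dots> borel F = distr (?M n) borel (F \<circ> (\<lambda>A. \<lambda>i\<in>{1..r}. cross_zscore n r (\<beta> n) A i))"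
      by (rule distr_distr[OF F(1)]) (rule measurable_restrict, simp)
    finally show ?thesis by (simp only: comp_def F(3))
  qed
  moreover have "weak_conv_m (\<lambda>n. distr (PiM {1..r} (\<lambda>i. ?\<mu> i n)) borel F) (distr (normal_vector r) borel F)"
    by (rule weak_conv_PiM_continuous_mapping[OF _ _ real_dist_normal_dist _ F(1,2)])
       (auto intro!: weak_conv_cross_zscore info prob_space.real_distribution_distr[OF measure_pmf.prob_space_axioms])
  ultimately show ?thesis by simp
qed

section \<open>Asymptotics\<close>

lemma bn_cn_bounds:
  assumes n: "2 \<le> n"
  shows "4 \<le> bn n \<beta>" "0 < cn n \<beta>" "cn n \<beta> \<le> bn n \<beta>"
    and "\<And>j k. \<lbrakk>j \<in> {1..n}; k \<in> {1..n}; j \<noteq> k\<rbrakk> \<Longrightarrow> 1 / bn n \<beta> \<le> dmu (\<beta> j + \<beta> k)"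
proof -
  define S where "S = {(1 + exp (\<beta> i + \<beta> j))\<^sup>2 / exp (\<beta> i + \<beta> j) | i j.
                  i \<in> {1..n} \<and> j \<in> {1..n} \<and> i \<noteq> j}"
  have bn: "bn n \<beta> = Max S" and cn: "cn n \<beta> = Min S" by (simp_all add: bn_def cn_def S_def)
  have "S \<subseteq> (\<lambda>(i, j). (1 + exp (\<beta> i + \<beta> j))\<^sup>2 / exp (\<beta> i + \<beta> j)) ` ({1..n} \<times> {1..n})"
    by (auto simp: S_def)
  hence finite: "finite S" by (rule finite_subset) simp
  have mem: "1 / dmu (\<beta> j + \<beta> k) \<in> S" if "j \<in> {1..n}" "k \<in> {1..n}" "j \<noteq> k" for j k
    unfolding S_def using that by (auto simp: dmu_def)
  have nonempty: "S \<noteq> {}" using mem[of 1 2] n by auto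
  have ge4: "4 \<le> x" if x: "x \<in> S" for x
  proof -
    obtain i j where "x = 1 / dmu (\<beta> i + \<beta> j)" using x by (auto simp: S_def dmu_def)
    thus ?thesis using dmu_pos[of "\<beta> i + \<beta> j"] dmu_le_quarter[of "\<beta> i + \<beta> j"]
      by (simp add: pos_le_divide_eq)
  qed
  show bn_ge: "4 \<le> bn n \<beta>" unfolding bn by (rule ge4[OF Max_in[OF finite nonempty]])
  show "0 < cn n \<beta>" unfolding cn using ge4[OF Min_in[OF finite nonempty]] by simp
  show "cn n \<beta> \<le> bn n \<beta>" unfolding bn cn using Min_le[OF finite Max_in[OF finite nonempty]] .
  fix j k assume jk: "j \<in> {1..n}" "k \<in> {1..n}" "j \<noteq> k"
  have "1 / dmu (\<beta> j + \<beta> k) \<le> bn n \<beta>" unfolding bn by (rule Max_ge[OF finite mem[OF jk]])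
  thus "1 / bn n \<beta> \<le> dmu (\<beta> j + \<beta> k)" using dmu_pos[of "\<beta> j + \<beta> k"] bn_ge by (simp add: field_simps)
qed

lemma lrt_rate_le_square:
  assumes n: "2 \<le> n"
  shows "lrt_rate n (bn n \<beta>) \<le> ((bn n \<beta> ^ 3 / cn n \<beta>) / (real n powr (1/6) / ln (real n)))\<^sup>2"
proof -
  define b c where "b = bn n \<beta>" and "c = cn n \<beta>"
  have bc: "4 \<le> b" "0 < c" "c \<le> b" using bn_cn_bounds[OF n] by (simp_all add: b_def c_def)
  have n1: "1 \<le> real n" using n by simp
  have "b ^ 2 \<le> b ^ 3 / c"
    using bc by (simp add: field_simps power2_eq_square power3_eq_cube)
  hence "(b ^ 2)\<^sup>2 \<le> (b ^ 3 / c)\<^sup>2" by (rule power_mono) simp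
  hence curvature: "b ^ 4 \<le> (b ^ 3 / c)\<^sup>2" by simp
  have "(real n powr (1/6))\<^sup>2 = real n powr (1/3)" using n1 by (simp add: powr_power)
  also have "\<dots> \<le> real n powr (1/2)" using n1 by (intro powr_mono) auto
  also have "\<dots> = sqrt n" using n1 by (simp add: powr_half_sqrt)
  finally have size: "(real n powr (1/6))\<^sup>2 \<le> sqrt n" .
  have "b ^ 4 * (ln (real n))\<^sup>2 / sqrt n \<le> (b ^ 3 / c)\<^sup>2 * (ln (real n))\<^sup>2 / (real n powr (1/6))\<^sup>2"
    using curvature size n1 bc by (intro frac_le mult_right_mono mult_nonneg_nonneg) auto
  thus ?thesis by (simp add: lrt_rate_def b_def c_def power_divide power_mult_distrib)
qed

lemma lrt_rate_tendsto_0: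
  assumes "(\<lambda>n. bn n (\<beta> n) ^ 3 / cn n (\<beta> n)) \<in> o(\<lambda>n. real n powr (1/6) / ln (real n))"
  shows "(\<lambda>n. lrt_rate n (bn n (\<beta> n))) \<longlonglongrightarrow> 0"
proof (rule tendsto_sandwich[OF _ _ tendsto_const])
  show "(\<lambda>n. ((bn n (\<beta> n) ^ 3 / cn n (\<beta> n)) / (real n powr (1/6) / ln (real n)))\<^sup>2) \<longlonglongrightarrow> 0"
    using tendsto_power[OF smalloD_tendsto[OF assms], of 2] by simp
  show "\<forall>\<^sub>F n in sequentially. lrt_rate n (bn n (\<beta> n)) \<le>
      ((bn n (\<beta> n) ^ 3 / cn n (\<beta> n)) / (real n powr (1/6) / ln (real n)))\<^sup>2"
    using eventually_ge_at_top[of 2] by eventually_elim (rule lrt_rate_le_square)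
qed (simp add: lrt_rate_def)

locale negligible_rate =
  fixes \<beta> :: "nat \<Rightarrow> nat \<Rightarrow> real" and r :: nat
  assumes r_pos: "1 \<le> r" and rate: "(\<lambda>n. lrt_rate n (bn n (\<beta> n))) \<longlonglongrightarrow> 0"
begin

abbreviation typical :: "nat \<Rightarrow> (nat \<times> nat \<Rightarrow> bool) set" where
  "typical n \<equiv> typical_graphs n r (\<beta> n) (bn n (\<beta> n))"

lemma eventually_large_sample: "\<forall>\<^sub>F n in sequentially. large_sample n (\<beta> n) (bn n (\<beta> n)) r"
proof -
  have "(\<lambda>n. expansion_const r * lrt_rate n (bn n (\<beta> n))) \<longlonglongrightarrow> 0"
    using tendsto_mult_right_zero[OF rate] by simp
  hence "\<forall>\<^sub>F n in sequentially. expansion_const r * lrt_rate n (bn n (\<beta> n)) < 1"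
    by (rule order_tendstoD) simp
  moreover have "\<forall>\<^sub>F n in sequentially. 1 \<le> ln (real n)"
    using filterlim_compose[OF ln_at_top filterlim_real_sequentially] unfolding filterlim_at_top by blast
  ultimately show ?thesis
    using eventually_ge_at_top[of "max 4 (2 * r)"] eventually_ge_at_top[of "r\<^sup>2"]
  proof eventually_elim
    case (elim n)
    thus ?case using r_pos bn_cn_bounds[where n = n and \<beta> = "\<beta> n"] by unfold_locales auto
  qed
qed

lemma prob_typical_tendsto_1: "(\<lambda>n. measure_pmf.prob (beta_graph n (\<beta> n)) (typical n)) \<longlonglongrightarrow> 1"
proof (rule tendsto_sandwich[OF _ _ _ tendsto_const])
  show "(\<lambda>n. 1 - 4 / real n) \<longlonglongrightarrow> 1"
    using tendsto_diff[OF tendsto_const lim_const_over_n[of 4], of 1] by simp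
  show "\<forall>\<^sub>F n in sequentially. 1 - 4 / real n \<le> measure_pmf.prob (beta_graph n (\<beta> n)) (typical n)"
    using eventually_large_sample by eventually_elim (rule large_sample.prob_typical_graphs)
qed simp

lemma cross_info_at_top:
  assumes i: "i \<in> {1..r}"
  shows "filterlim (\<lambda>n. cross_info n r (\<beta> n) i) at_top sequentially"
proof (rule filterlim_at_top_mono)
  show "filterlim (\<lambda>n. 1 / 2 * sqrt (real n)) at_top sequentially"
    by (rule filterlim_tendsto_pos_mult_at_top[OF tendsto_const])
       (auto intro: filterlim_compose[OF sqrt_at_top filterlim_real_sequentially])
  show "\<forall>\<^sub>F n in sequentially. 1 / 2 * sqrt (real n) \<le> cross_info n r (\<beta> n) i"
    using eventually_large_sample
  proof eventually_elim
    case (elim n)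
    then interpret large_sample n "\<beta> n" "bn n (\<beta> n)" r .
    have "bn n (\<beta> n) / sqrt (real n) \<le> lrt_rate n (bn n (\<beta> n))" using powers_le_lrt_rate[of 1 0] by simp
    also have "\<dots> \<le> expansion_const r * lrt_rate n (bn n (\<beta> n))"
      using mult_right_mono[of 1 "expansion_const r" "lrt_rate n (bn n (\<beta> n))"] expansion_const_ge b_pos
      by (simp add: lrt_rate_def)
    also have "\<dots> \<le> 1" by (rule rate_le)
    finally have "bn n (\<beta> n) * sqrt (real n) \<le> sqrt (real n) * sqrt (real n)"
      using n_ge by (intro mult_right_mono) (auto simp: field_simps)
    hence "1 / 2 * sqrt (real n) \<le> real n / (2 * bn n (\<beta> n))" using b_pos by (simp add: field_simps)
    also have "\<dots> \<le> cross_info n r (\<beta> n) i" by (rule cross_info_ge[OF i])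
    finally show ?case .
  qed
qed

lemma lrt_limit:
  fixes F :: "(nat \<Rightarrow> real) \<Rightarrow> real" and N :: "nat \<Rightarrow> (nat \<Rightarrow> real) set"
  assumes F: "F \<in> borel_measurable (PiM {1..r} (\<lambda>_. borel))" "continuous_on UNIV F"
      "\<And>z. F (restrict z {1..r}) = F z"
    and approx: "\<And>n A. \<lbrakk>large_sample n (\<beta> n) (bn n (\<beta> n)) r; A \<in> typical n\<rbrakk> \<Longrightarrow>
      has_max (loglik n A) UNIV \<and> has_max (loglik n A) (N n) \<and>
      \<bar>LRT n A (N n) - F (cross_zscore n r (\<beta> n) A)\<bar> \<le> lrt_const r * lrt_rate n (bn n (\<beta> n))"
  shows "weak_conv_m (\<lambda>n. LRT_law n (\<beta> n) (N n)) (distr (normal_vector r) borel F)"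
    and "(\<lambda>n. prob_mle_exist n (\<beta> n) (N n)) \<longlonglongrightarrow> 1"
proof -
  interpret normal: prob_space "normal_vector r" by (rule prob_space_PiM) (rule prob_space_std_normal)
  have "F \<in> borel_measurable (normal_vector r)" using F(1) by (simp cong: measurable_cong_sets)
  hence limit_law: "real_distribution (distr (normal_vector r) borel F)"
    by (rule normal.real_distribution_distr)
  show "weak_conv_m (\<lambda>n. LRT_law n (\<beta> n) (N n)) (distr (normal_vector r) borel F)"
    unfolding LRT_law_def
  proof (rule weak_conv_slutsky[OF measure_pmf.prob_space_axioms limit_law _ _ _ prob_typical_tendsto_1])
    show "weak_conv_m (\<lambda>n. distr (measure_pmf (beta_graph n (\<beta> n))) borel (\<lambda>A. F (cross_zscore n r (\<beta> n) A)))
        (distr (normal_vector r) borel F)"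
      using r_pos cross_info_at_top F by (rule weak_conv_function_of_cross_zscores)
    show "\<forall>\<^sub>F n in sequentially. \<forall>A\<in>typical n.
        \<bar>LRT n A (N n) - F (cross_zscore n r (\<beta> n) A)\<bar> \<le> lrt_const r * lrt_rate n (bn n (\<beta> n))"
      using eventually_large_sample by eventually_elim (use approx in blast)
    show "(\<lambda>n. lrt_const r * lrt_rate n (bn n (\<beta> n))) \<longlonglongrightarrow> 0"
      using tendsto_mult_right_zero[OF rate] by simp
  qed simp_all
  show "(\<lambda>n. prob_mle_exist n (\<beta> n) (N n)) \<longlonglongrightarrow> 1"
  proof (rule tendsto_sandwich[OF _ _ prob_typical_tendsto_1 tendsto_const])
    show "\<forall>\<^sub>F n in sequentially. measure_pmf.prob (beta_graph n (\<beta> n)) (typical n) \<le>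
        prob_mle_exist n (\<beta> n) (N n)"
      using eventually_large_sample unfolding prob_mle_exist_def
      by eventually_elim (use approx in \<open>auto intro!: measure_pmf.finite_measure_mono\<close>)
  qed (simp add: prob_mle_exist_def)
qed

theorem fixed_null_lrt_limit:
  assumes null: "\<And>n i. \<lbrakk>i \<in> {1..r}; i \<le> n\<rbrakk> \<Longrightarrow> \<beta> n i = \<beta>0 n i"
  shows "weak_conv_m (\<lambda>n. LRT_law n (\<beta> n) (fixed_null_set r (\<beta>0 n))) (chi_sq r)"
    and "(\<lambda>n. prob_mle_exist n (\<beta> n) (fixed_null_set r (\<beta>0 n))) \<longlonglongrightarrow> 1"
proof -
  have approx: "has_max (loglik n A) UNIV \<and> has_max (loglik n A) (fixed_null_set r (\<beta>0 n)) \<and>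
      \<bar>LRT n A (fixed_null_set r (\<beta>0 n)) - sum_sq r (cross_zscore n r (\<beta> n) A)\<bar> \<le>
          lrt_const r * lrt_rate n (bn n (\<beta> n))"
    if "large_sample n (\<beta> n) (bn n (\<beta> n)) r" "A \<in> typical n" for n A
    using null large_sample.r_le_n[OF that(1)] by (intro large_sample.fixed_null_lrt_approx[OF that]) auto
  note limit = lrt_limit[OF sum_sq_measurable sum_sq_continuous sum_sq_restrict approx]
  show "weak_conv_m (\<lambda>n. LRT_law n (\<beta> n) (fixed_null_set r (\<beta>0 n))) (chi_sq r)"
    using limit(1) unfolding distr_sum_sq[OF r_pos] .
  show "(\<lambda>n. prob_mle_exist n (\<beta> n) (fixed_null_set r (\<beta>0 n))) \<longlonglongrightarrow> 1" by (rule limit(2))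
qed

theorem homog_null_lrt_limit:
  assumes r: "2 \<le> r" and null: "\<And>n i. \<lbrakk>i \<in> {1..r}; i \<le> n\<rbrakk> \<Longrightarrow> \<beta> n i = \<beta> n 1"
  shows "weak_conv_m (\<lambda>n. LRT_law n (\<beta> n) (homog_null_set r)) (chi_sq (r - 1))"
    and "(\<lambda>n. prob_mle_exist n (\<beta> n) (homog_null_set r)) \<longlonglongrightarrow> 1"
proof -
  have approx: "has_max (loglik n A) UNIV \<and> has_max (loglik n A) (homog_null_set r) \<and>
      \<bar>LRT n A (homog_null_set r) - centred_sum_sq r (cross_zscore n r (\<beta> n) A)\<bar> \<le>
          lrt_const r * lrt_rate n (bn n (\<beta> n))"
    if "large_sample n (\<beta> n) (bn n (\<beta> n)) r" "A \<in> typical n" for n A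
    using large_sample.r_le_n[OF that(1)] by (intro large_sample.homog_null_lrt_approx[OF that] null) auto
  note limit = lrt_limit[OF centred_sum_sq_measurable centred_sum_sq_continuous[OF r_pos]
      centred_sum_sq_restrict approx]
  show "weak_conv_m (\<lambda>n. LRT_law n (\<beta> n) (homog_null_set r)) (chi_sq (r - 1))"
    using limit(1) unfolding distr_centred_sum_sq[OF r] .
  show "(\<lambda>n. prob_mle_exist n (\<beta> n) (homog_null_set r)) \<longlonglongrightarrow> 1" by (rule limit(2))
qed

end

theorem theorem2:
  fixes \<beta> :: "nat \<Rightarrow> nat \<Rightarrow> real" and \<beta>0 :: "nat \<Rightarrow> nat \<Rightarrow> real" and r :: nat
  assumes r_pos: "r \<ge> 1"
    and rate: "(\<lambda>n. bn n (\<beta> n) ^ 3 / cn n (\<beta> n)) \<in> o(\<lambda>n. real n powr (1/6) / ln (real n))"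
  shows
    "((\<forall>n. \<forall>i\<in>{1..r}. i \<le> n \<longrightarrow> \<beta> n i = \<beta>0 n i) \<longrightarrow>
        weak_conv_m (\<lambda>n. LRT_law n (\<beta> n) (fixed_null_set r (\<beta>0 n))) (chi_sq r) \<and>
        (\<lambda>n. prob_mle_exist n (\<beta> n) (fixed_null_set r (\<beta>0 n))) \<longlonglongrightarrow> 1)
     \<and>
     ((r \<ge> 2 \<and> (\<forall>n. \<forall>i\<in>{1..r}. i \<le> n \<longrightarrow> \<beta> n i = \<beta> n 1)) \<longrightarrow>
        weak_conv_m (\<lambda>n. LRT_law n (\<beta> n) (homog_null_set r)) (chi_sq (r - 1)) \<and>
        (\<lambda>n. prob_mle_exist n (\<beta> n) (homog_null_set r)) \<longlonglongrightarrow> 1)"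
proof -
  interpret negligible_rate \<beta> r
    by unfold_locales (rule r_pos, rule lrt_rate_tendsto_0[OF rate])
  show ?thesis
    using fixed_null_lrt_limit[of \<beta>0] homog_null_lrt_limit by blast
qed

end
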